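(* Let $F$ be a finite field of characteristic $2$. Let $n\ge m\ge 1$, $k\ge 2$, $l\in\{1,2\}$, $H_1\cong D_8$, $H_2\cong Q_8$, and let $$G_l\cong \bigl(M_2(n+1,1)\mathbin{\mathsf Y}H_l\mathbin{\mathsf Y}D_8^{\mathsf Y(k-2)}\bigr)\times\mathbb{Z}_{2^m},$$ with derived subgroup $\langle c\rangle$ of order $2$. Then: (i) If $n=1$, then $|\Omega_1(G_1)|=2^{2k+1}+2^{k+1}=|\Omega_c(G_2)|$ and $|\Omega_c(G_1)|=2^{2k+1}-2^{k+1}=|\Omega_1(G_2)|$. If $n\ge 2$, then $|\Omega_1(G_l)|=2^{2k+1}=|\Omega_c(G_l)|$ for $l=1,2$. (ii) $|V_*(FG_l)|$ equals $|F|^{\frac{|G_l|+|\Omega_1(G_l)|}{2}-1}$ if $n=m=1$; $2|F|^{\frac{|G_l|+|\Omega_1(G_l)|}{2}-1}$ if $n>m=1$; and $4|F|^{\frac{|G_l|+|\Omega_1(G_l)|}{2}-1}$ if $n\ge m\ge 2$.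
   Context: $V(FG)=\{\sum_{g}\alpha_g g\in FG:\sum_g\alpha_g=1\}$; $(\sum_g\alpha_g g)^*=\sum_g\alpha_g g^{-1}$; $V_*(FG)=\{x\in V(FG):x^*=x^{-1}\}$. $\Omega_1(G)=\{g\in G:g^2=1\}$ and $\Omega_c(G)=\{g\in G: g^2=c\}$. $D_8$, $Q_8$ are the dihedral and quaternion groups of order $8$. $M_2(u,v)=\langle a,b\mid a^{2^u}=b^{2^v}=1,\ a^b=a^{1+2^{u-1}}\rangle$ for $u\ge2,v\ge1$ (so $M_2(2,1)\cong D_8$). $H\mathbin{\mathsf Y}K$ denotes the central product; here all central factors have derived subgroup of order $2$, and the central product is formed by identifying these derived subgroups with one common subgroup $\langle c\rangle$, so that factors intersect exactly in $\langle c\rangle$. $D_8^{\mathsf Y j}$ is the central product of $j$ copies of $D_8$ (omitted if $j=0$). *)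

theory Defs
  imports "HOL-Algebra.Algebra" "HOL-Library.Cardinality"
begin

section \<open>Groups given by generators and relations\<close>

text \<open>A letter \<open>(x, True)\<close> stands for the generator \<open>x\<close> and \<open>(x, False)\<close> for its inverse.
  A relation \<open>l = r\<close> is given as the pair \<open>(l, r)\<close> of words.\<close>

type_synonym 'x word = "('x \<times> bool) list"

inductive word_eq :: "('x word \<times> 'x word) set \<Rightarrow> 'x word \<Rightarrow> 'x word \<Rightarrow> bool"
  for R :: "('x word \<times> 'x word) set"
  where
    refl: "word_eq R w w"
  | sym: "word_eq R v w \<Longrightarrow> word_eq R w v"
  | trans: "word_eq R u v \<Longrightarrow> word_eq R v w \<Longrightarrow> word_eq R u w"
  | cancel: "word_eq R (p @ [(x, e), (x, \<not> e)] @ q) (p @ q)"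
  | relation: "(l, r) \<in> R \<Longrightarrow> word_eq R (p @ l @ q) (p @ r @ q)"

text \<open>The generators are all the elements of the type \<open>'x\<close>.\<close>

definition presented_group :: "('x word \<times> 'x word) set \<Rightarrow> 'x word set monoid" where
  "presented_group R =
    \<lparr>carrier = UNIV // {(v, w). word_eq R v w},
     monoid.mult = (\<lambda>A B. {w. \<exists>u\<in>A. \<exists>v\<in>B. word_eq R (u @ v) w}),
     one = {w. word_eq R [] w}\<rparr>"

datatype gen = GenA | GenB

definition word_a :: "nat \<Rightarrow> gen word" where
  "word_a i = replicate i (GenA, True)"

definition word_b :: "nat \<Rightarrow> gen word" where
  "word_b i = replicate i (GenB, True)"

text \<open>The word for \<open>a\<^sup>b\<close>, with the convention \<open>a\<^sup>b = b\<inverse> a b\<close>.\<close>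

definition word_conj_ab :: "gen word" where
  "word_conj_ab = [(GenB, False), (GenA, True), (GenB, True)]"

definition M2 :: "nat \<Rightarrow> nat \<Rightarrow> gen word set monoid" where
  "M2 u v = presented_group
    {(word_a (2 ^ u), []), (word_b (2 ^ v), []), (word_conj_ab, word_a (1 + 2 ^ (u - 1)))}"

definition D8 :: "gen word set monoid" where
  "D8 = presented_group
    {(word_a 4, []), (word_b 2, []), (word_conj_ab, [(GenA, False)])}"

definition Q8 :: "gen word set monoid" where
  "Q8 = presented_group
    {(word_a 4, []), (word_b 2, word_a 2), (word_conj_ab, [(GenA, False)])}"

section \<open>Central products over the derived subgroups\<close>

text \<open>For a finite family of groups whose derived subgroups \<open>\<langle>c\<^sub>i\<rangle>\<close> have order 2. Identifying
  all the \<open>c\<^sub>i\<close> with one element \<open>c\<close> of order 2 amounts to factoring the direct product by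
  the kernel of \<open>(c\<^sub>i\<^bsup>e i\<^esup>)\<^sub>i \<mapsto> c\<^bsup>\<Sum> e i\<^esup>\<close>, that is, by the tuples in the
  product of the derived subgroups with an even number of nontrivial entries.\<close>

definition central_identification ::
    "'i set \<Rightarrow> ('i \<Rightarrow> ('a, 'b) monoid_scheme) \<Rightarrow> ('i \<Rightarrow> 'a) set" where
  "central_identification I G =
    {x \<in> (\<Pi>\<^sub>E i\<in>I. derived (G i) (carrier (G i))). even (card {i \<in> I. x i \<noteq> \<one>\<^bsub>G i\<^esub>})}"

definition central_product ::
    "'i set \<Rightarrow> ('i \<Rightarrow> ('a, 'b) monoid_scheme) \<Rightarrow> ('i \<Rightarrow> 'a) set monoid" where
  "central_product I G = product_group I G Mod central_identification I G"

section \<open>Group algebras and unitary units\<close>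

text \<open>An element \<open>\<Sum>\<^sub>g \<alpha>\<^sub>g g\<close> is the coefficient function \<open>g \<mapsto> \<alpha>\<^sub>g\<close>, finitely supported and
  zero outside the carrier of the group.\<close>

definition group_algebra :: "('a, 'e) monoid_scheme \<Rightarrow> ('a \<Rightarrow> 'f::field) ring" where
  "group_algebra G =
    \<lparr>carrier = {x. {g. x g \<noteq> 0} \<subseteq> carrier G \<and> finite {g. x g \<noteq> 0}},
     monoid.mult = (\<lambda>x y g. if g \<in> carrier G
                     then \<Sum>h\<in>{h \<in> carrier G. x h \<noteq> 0}. x h * y (inv\<^bsub>G\<^esub> h \<otimes>\<^bsub>G\<^esub> g)
                     else 0),
     one = (\<lambda>g. if g = \<one>\<^bsub>G\<^esub> then 1 else 0),
     ring.zero = (\<lambda>g. 0),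
     ring.add = (\<lambda>x y g. x g + y g)\<rparr>"

definition normalized_elements :: "('a, 'e) monoid_scheme \<Rightarrow> ('a \<Rightarrow> 'f::field) set" where
  "normalized_elements G =
    {x \<in> carrier (group_algebra G). (\<Sum>g\<in>{g. x g \<noteq> 0}. x g) = 1}"

definition star :: "('a, 'e) monoid_scheme \<Rightarrow> ('a \<Rightarrow> 'f::field) \<Rightarrow> ('a \<Rightarrow> 'f)" where
  "star G x = (\<lambda>g. if g \<in> carrier G then x (inv\<^bsub>G\<^esub> g) else 0)"

definition unitary_units :: "('a, 'e) monoid_scheme \<Rightarrow> ('a \<Rightarrow> 'f::field) set" where
  "unitary_units G =
    {x \<in> normalized_elements G.
       x \<in> Units (group_algebra G) \<and> star G x = inv\<^bsub>group_algebra G\<^esub> x}"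

section \<open>Elements with prescribed square\<close>

definition Omega_1 :: "('a, 'e) monoid_scheme \<Rightarrow> 'a set" where
  "Omega_1 G = {g \<in> carrier G. g [^]\<^bsub>G\<^esub> (2::nat) = \<one>\<^bsub>G\<^esub>}"

definition Omega_c :: "('a, 'e) monoid_scheme \<Rightarrow> 'a \<Rightarrow> 'a set" where
  "Omega_c G c = {g \<in> carrier G. g [^]\<^bsub>G\<^esub> (2::nat) = c}"

end

(* For a central extension p : G -> A of an abelian group A by a group {1, c} of order two, the
   defect y y* - 1 turns multiplication into addition on the elements y of FG whose image in FA is
   unitary, and its zeros are the unitary elements of FG. Hence |V_*(FG)| equals
   |F|^|A| |V_*(FA)| divided by the size of the image of the defect. The image consists of elements
   that are invariant under inversion and multiplication by c and vanish on Omega_1(G).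
   Evaluating the defect at 1 + b(g + h) shows that all such elements occur as soon as enough
   elements of Omega_c(G) fail to commute with an involution; for K x Z_4 -> K x Z_2 the
   Artin-Schreier condition t + t^2 cuts the image down to index two, which is where the
   factors 2 come from. Starting from an elementary abelian group, one adds the cyclic factors of
   G/<c> step by step and finally passes to G. The sum and the difference of |Omega_1| and |Omega_c|
   are multiplicative over the central factors. *)
theory Submission
  imports Defs "HOL-Library.Function_Algebras"
begin

section \<open>Convolution on a finite group\<close>

text \<open>Additivity of the defect rests on the ideal \<open>(1 + c)FG\<close>: it has square
  zero, and products with it depend only on images in the commutative algebra FA, so conjugating a
  defect by a lift multiplies it by a unitary element and its star, that is, by 1. The exponents
  balance by themselves: with N the number of free coefficients of a symmetric element, |A| + (|A| +
  |Omega_1(A)|)/2 = (|G| + |Omega_1(G)|)/2 + N, so a defect that reaches all symmetric elements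
  carries the formula for A over to G without a new factor. The quotient of G by c is the product of
  an elementary abelian group, Z_(2^m) and Z_(2^n), the last one coming from the first central
  factor; each cyclic factor contributes one 2 exactly if its order is at least four. The obstacle
  in the last step is that for n \<ge> 2 the element \<open>a^(2^(n-1))\<close> of the first factor
  has square c and is central, so no involution fails to commute with it. It is reached through a
  second element of Omega_c that commutes with it but not with all involutions; the second central
  factor supplies one, as k \<ge> 2.\<close>

definition coeffs :: "('a, 'b) monoid_scheme \<Rightarrow> ('a \<Rightarrow> 'f::field) set" where
  "coeffs G = {x. \<forall>g. g \<notin> carrier G \<longrightarrow> x g = 0}"

text \<open>Agrees with the product of \<open>group_algebra\<close> on a finite group. Summing over
  the whole carrier instead of the support makes every reindexing by a bijection of the group
  available.\<close>

definition conv :: "('a, 'b) monoid_scheme \<Rightarrow> ('a \<Rightarrow> 'f::field) \<Rightarrow> ('a \<Rightarrow> 'f) \<Rightarrow> 'a \<Rightarrow> 'f" where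
  "conv G x y = (\<lambda>g. if g \<in> carrier G
     then \<Sum>h\<in>carrier G. x h * y (inv\<^bsub>G\<^esub> h \<otimes>\<^bsub>G\<^esub> g) else 0)"

definition point :: "'a \<Rightarrow> 'f::field \<Rightarrow> 'a \<Rightarrow> 'f" where
  "point g b = (\<lambda>u. if u = g then b else 0)"

text \<open>Only a one-sided equation is kept. In characteristic two, over a finite group and a
  finite field, augmentation 1 and invertibility with inverse \<open>star G x\<close> follow from
  it; this links the set to \<open>unitary_units\<close>.\<close>

definition unitary :: "('a, 'b) monoid_scheme \<Rightarrow> ('a \<Rightarrow> 'f::field) set" where
  "unitary G = {x \<in> coeffs G. conv G x (star G x) = point \<one>\<^bsub>G\<^esub> 1}"

lemma coeffs_add [intro]: "x \<in> coeffs G \<Longrightarrow> y \<in> coeffs G \<Longrightarrow> x + y \<in> coeffs G"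
  by (simp add: coeffs_def)

lemma coeffs_zero [simp]: "0 \<in> coeffs G"
  by (simp add: coeffs_def)

lemma point_in_coeffs [intro]: "g \<in> carrier G \<Longrightarrow> point g b \<in> coeffs G"
  by (auto simp: coeffs_def point_def)

lemma conv_in_coeffs [simp, intro]: "conv G x y \<in> coeffs G"
  by (simp add: coeffs_def conv_def)

lemma star_in_coeffs [simp, intro]: "star G x \<in> coeffs G"
  by (simp add: coeffs_def star_def)

lemma coeffs_eqI:
  assumes "x \<in> coeffs G" "y \<in> coeffs G" "\<And>g. g \<in> carrier G \<Longrightarrow> x g = y g"
  shows "x = y"
  using assms by (auto simp: coeffs_def fun_eq_iff) metis

lemma point_add: "point g a + point g b = point g (a + b)"
  by (auto simp: point_def)

lemma point_zero [simp]: "point g 0 = 0"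
  by (auto simp: point_def)

lemma conv_add_left: "conv G (x + y) z = conv G x z + conv G y z"
  by (auto simp: conv_def fun_eq_iff sum.distrib distrib_right)

lemma conv_add_right: "conv G z (x + y) = conv G z x + conv G z y"
  by (auto simp: conv_def fun_eq_iff sum.distrib distrib_left)

lemma conv_zero_left [simp]: "conv G 0 x = 0"
  by (auto simp: conv_def fun_eq_iff)

lemma star_add: "star G (x + y) = star G x + star G y"
  by (auto simp: star_def fun_eq_iff)

section \<open>Functions constant on the orbits of an involution\<close>

text \<open>\<open>2 * N = card S + card {x \<in> S. i x = x}\<close> says that \<open>N\<close> is the number of orbits of \<open>i\<close> on \<open>S\<close>.\<close>

lemma card_invariant_functions:
  assumes "finite S" "\<And>x. x \<in> S \<Longrightarrow> i x \<in> S" "\<And>x. x \<in> S \<Longrightarrow> i (i x) = x"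
  shows "\<exists>N. 2 * N = card S + card {x \<in> S. i x = x} \<and>
    finite {f :: 'a \<Rightarrow> 'f::{zero,finite}. (\<forall>x. x \<notin> S \<longrightarrow> f x = 0) \<and> (\<forall>x\<in>S. f (i x) = f x)} \<and>
    card {f :: 'a \<Rightarrow> 'f. (\<forall>x. x \<notin> S \<longrightarrow> f x = 0) \<and> (\<forall>x\<in>S. f (i x) = f x)} = CARD('f) ^ N"
  using assms
proof (induction "card S" arbitrary: S rule: less_induct)
  case less
  let ?F = "\<lambda>S. {f :: 'a \<Rightarrow> 'f. (\<forall>x. x \<notin> S \<longrightarrow> f x = 0) \<and> (\<forall>x\<in>S. f (i x) = f x)}"
  show ?case
  proof (cases "S = {}")
    case True
    then have "?F S = {\<lambda>_. 0}" by auto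
    with True show ?thesis by auto
  next
    case False
    then obtain a where a: "a \<in> S" by blast
    define T where "T = S - {a, i a}"
    have T: "T \<subseteq> S" "finite T" "card T < card S"
      using a less.prems(1) by (auto simp: T_def intro!: psubset_card_mono)
    have iY: "i x \<in> T" "i (i x) = x" if "x \<in> T" for x
      using that less.prems(2,3) a by (auto simp: T_def) (metis less.prems(3))+
    from less.hyps[OF T(3,2) iY] obtain N where
      N: "2 * N = card T + card {x \<in> T. i x = x}" "finite (?F T)" "card (?F T) = CARD('f) ^ N"
      by blast
    have ia: "i a \<in> S" "i (i a) = a" using a less.prems by auto
    \<comment> \<open>An invariant function on \<open>S\<close> is an invariant function on
      \<open>T\<close> together with one freely chosen value on the removed orbit, which has one or
      two points.\<close>
    have "bij_betw (\<lambda>(f, b) x. if x = a \<or> x = i a then b else f x) (?F T \<times> (UNIV :: 'f set)) (?F S)"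
    proof (rule bij_betw_byWitness[where f' = "\<lambda>f. (\<lambda>x. if x = a \<or> x = i a then 0 else f x, f a)"])
      show "\<forall>p\<in>?F T \<times> UNIV. (\<lambda>f. (\<lambda>x. if x = a \<or> x = i a then 0 else f x, f a))
          ((\<lambda>(f, b) x. if x = a \<or> x = i a then b else f x) p) = p"
        by (auto simp: T_def fun_eq_iff)
      show "\<forall>f\<in>?F S. (\<lambda>(f, b) x. if x = a \<or> x = i a then b else f x)
          ((\<lambda>f. (\<lambda>x. if x = a \<or> x = i a then 0 else f x, f a)) f) = f"
      proof
        fix f assume "f \<in> ?F S"
        then have "f (i a) = f a" using a by blast
        then show "(\<lambda>(f, b) x. if x = a \<or> x = i a then b else f x)
          ((\<lambda>f. (\<lambda>x. if x = a \<or> x = i a then 0 else f x, f a)) f) = f"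
          by (simp add: fun_eq_iff)
      qed
      have T: "x \<noteq> a" "x \<noteq> i a" "i x \<noteq> a" "i x \<noteq> i a" "x \<in> S" if "x \<in> T" for x
        using that iY[OF that] by (auto simp: T_def)
      show "(\<lambda>f. (\<lambda>x. if x = a \<or> x = i a then 0 else f x, f a)) ` ?F S \<subseteq> ?F T \<times> UNIV"
      proof (rule image_subsetI)
        fix f assume f: "f \<in> ?F S"
        then have "\<forall>x. x \<notin> T \<longrightarrow> (if x = a \<or> x = i a then 0 else f x) = 0"
          by (simp add: T_def)
        moreover have "\<forall>x\<in>T. (if i x = a \<or> i x = i a then 0 else f (i x)) =
            (if x = a \<or> x = i a then 0 else f x)"
          using f T by simp
        ultimately show "(\<lambda>x. if x = a \<or> x = i a then 0 else f x, f a) \<in> ?F T \<times> UNIV"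
          by simp
      qed
      show "(\<lambda>(f, b) x. if x = a \<or> x = i a then b else f x) ` (?F T \<times> UNIV) \<subseteq> ?F S"
      proof (clarify, intro conjI allI ballI impI)
        fix f :: "'a \<Rightarrow> 'f" and b x
        assume f0: "\<forall>x. x \<notin> T \<longrightarrow> f x = 0" and fi: "\<forall>x\<in>T. f (i x) = f x"
        show "(if x = a \<or> x = i a then b else f x) = 0" if "x \<notin> S"
          using that a ia(1) f0 by (auto simp: T_def)
        show "(if i x = a \<or> i x = i a then b else f (i x)) = (if x = a \<or> x = i a then b else f x)"
          if "x \<in> S"
        proof (cases "x \<in> T")
          case True
          then show ?thesis using T[OF True] fi by simp
        next
          case False
          then have "x = a \<or> x = i a" using that by (auto simp: T_def)
          then show ?thesis using ia(2) by auto
        qed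
      qed
    qed
    note bij = this
    have "finite (?F S)"
      using bij_betw_finite[OF bij] N(2) by simp
    moreover have "card (?F S) = card (?F T) * CARD('f)"
      using bij_betw_same_card[OF bij] by (simp add: card_cartesian_product)
    moreover have "2 * Suc N = card S + card {x \<in> S. i x = x}"
    proof (cases "i a = a")
      case True
      then have "S = insert a T" "{x \<in> S. i x = x} = insert a {x \<in> T. i x = x}" "a \<notin> T"
        using a by (auto simp: T_def)
      then show ?thesis using N(1) T(2) by simp
    next
      case False
      then have "S = insert a (insert (i a) T)" "{x \<in> S. i x = x} = {x \<in> T. i x = x}"
          "a \<notin> T" "i a \<notin> T"
        using a ia by (auto simp: T_def)
      then show ?thesis using N(1) T(2) False by simp
    qed
    ultimately show ?thesis
      using N(3) by (intro exI[of _ "Suc N"] conjI) (simp_all only: power_Suc mult.commute)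
  qed
qed

lemma finite_coeffs:
  assumes "finite (carrier G)"
  shows "finite (coeffs G :: ('a \<Rightarrow> 'f::{field,finite}) set)"
    and "card (coeffs G :: ('a \<Rightarrow> 'f) set) = CARD('f) ^ card (carrier G)"
  \<comment> \<open>For the identity map every point is an orbit, so the number of free values is
    the cardinality of the carrier.\<close>
  using card_invariant_functions[OF assms, where i = "\<lambda>x. x" and ?'f = 'f]
  by (auto simp: coeffs_def simp flip: mult_2)

lemma (in group) mult_inv_cancel [simp]:
  assumes "a \<in> carrier G" "g \<in> carrier G"
  shows "a \<otimes> (inv a \<otimes> g) = g" "inv a \<otimes> (a \<otimes> g) = g"
  using assms by (simp_all flip: m_assoc)

section \<open>Algebra laws for convolution and star\<close>

locale finite_group = group G for G (structure) +
  assumes fin: "finite (carrier G)"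
begin

lemma sum_inv_shift:
  assumes "g \<in> carrier G"
  shows "(\<Sum>h\<in>carrier G. f (inv h \<otimes> g)) = (\<Sum>h\<in>carrier G. f h)"
  by (rule sum.reindex_bij_witness[where i = "\<lambda>k. g \<otimes> inv k" and j = "\<lambda>h. inv h \<otimes> g"])
     (use assms in \<open>auto simp: inv_mult_group m_assoc\<close>)

lemma conv_point_left:
  assumes "h \<in> carrier G" "g \<in> carrier G"
  shows "conv G (point h b) y g = b * y (inv h \<otimes> g)"
proof -
  have "conv G (point h b) y g = (\<Sum>k\<in>carrier G. if k = h then b * y (inv h \<otimes> g) else 0)"
    unfolding conv_def point_def using assms by (auto intro!: sum.cong)
  then show ?thesis using assms fin by simp
qed

lemma conv_one_left:
  assumes "x \<in> coeffs G" shows "conv G (point \<one> 1) x = x"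
  by (rule coeffs_eqI[of _ G]) (use assms in \<open>auto simp: conv_point_left\<close>)

lemma conv_points:
  assumes "h \<in> carrier G" "g \<in> carrier G"
  shows "conv G (point h a) (point g b) = point (h \<otimes> g) (a * b)"
proof (rule coeffs_eqI[of _ G])
  fix u assume u: "u \<in> carrier G"
  have "inv h \<otimes> u = g \<longleftrightarrow> u = h \<otimes> g"
    using assms u by (metis inv_closed inv_solve_left)
  then show "conv G (point h a) (point g b) u = point (h \<otimes> g) (a * b) u"
    using assms u by (simp add: conv_point_left) (simp add: point_def)
qed (use assms in auto)

lemma star_point:
  assumes "g \<in> carrier G" shows "star G (point g b) = point (inv g) b"
  using assms by (auto simp: star_def point_def fun_eq_iff)

lemma star_star: "x \<in> coeffs G \<Longrightarrow> star G (star G x) = x"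
  by (rule coeffs_eqI[of "star G (star G x)" G]) (simp_all, simp add: star_def)

text \<open>Inversion reverses products, so \<open>star\<close> does too. Left-sided identities
  become right-sided ones by applying it, as in \<open>conv_one_right\<close>;
  \<open>conv_pull_left\<close> arises from \<open>conv_pull_right\<close> in the same way.\<close>

lemma star_conv: "star G (conv G x y) = conv G (star G y) (star G x)"
proof (rule coeffs_eqI[of _ G])
  fix g assume g: "g \<in> carrier G"
  have "star G (conv G x y) g = (\<Sum>h\<in>carrier G. x h * y (inv h \<otimes> inv g))"
    using g by (simp add: star_def conv_def)
  also have "\<dots> = (\<Sum>h\<in>carrier G. x (inv (inv h \<otimes> g)) * y (inv (inv (inv h \<otimes> g)) \<otimes> inv g))"
    using sum_inv_shift[OF g, of "\<lambda>h. x (inv h) * y (inv (inv h) \<otimes> inv g)"]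
    by (subst sum_inv_shift[OF g, of "\<lambda>h. x (inv h) * y (inv (inv h) \<otimes> inv g)"])
       (rule sum.reindex_bij_witness[where i = "\<lambda>h. inv h" and j = "\<lambda>h. inv h"], auto)
  also have "\<dots> = (\<Sum>h\<in>carrier G. star G y h * star G x (inv h \<otimes> g))"
    using g by (intro sum.cong) (auto simp: star_def inv_mult_group m_assoc)
  finally show "star G (conv G x y) g = conv G (star G y) (star G x) g"
    using g by (simp add: conv_def)
qed auto

lemma conv_one_right:
  assumes "x \<in> coeffs G" shows "conv G x (point \<one> 1) = x"
proof -
  have "star G (conv G x (point \<one> 1)) = star G x"
    by (simp add: star_conv star_point conv_one_left)
  then show ?thesis using star_star assms conv_in_coeffs by metis
qed

lemma conv_assoc: "conv G (conv G x y) z = conv G x (conv G y z)"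
proof (rule coeffs_eqI[of _ G])
  fix g assume g: "g \<in> carrier G"
  have "conv G (conv G x y) z g =
      (\<Sum>h\<in>carrier G. \<Sum>k\<in>carrier G. x k * y (inv k \<otimes> h) * z (inv h \<otimes> g))"
    using g by (simp add: conv_def sum_distrib_right cong: sum.cong)
  also have "\<dots> = (\<Sum>k\<in>carrier G. \<Sum>h\<in>carrier G. x k * y (inv k \<otimes> h) * z (inv h \<otimes> g))"
    by (rule sum.swap)
  also have "\<dots> = (\<Sum>k\<in>carrier G. \<Sum>l\<in>carrier G. x k * (y l * z (inv l \<otimes> (inv k \<otimes> g))))"
  proof (rule sum.cong[OF HOL.refl])
    fix k assume k: "k \<in> carrier G"
    show "(\<Sum>h\<in>carrier G. x k * y (inv k \<otimes> h) * z (inv h \<otimes> g)) =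
      (\<Sum>l\<in>carrier G. x k * (y l * z (inv l \<otimes> (inv k \<otimes> g))))"
      by (rule sum.reindex_bij_witness[where i = "\<lambda>l. k \<otimes> l" and j = "\<lambda>h. inv k \<otimes> h"])
         (use g k in \<open>auto simp: inv_mult_group m_assoc mult.assoc\<close>)
  qed
  also have "\<dots> = conv G x (conv G y z) g"
    using g by (simp add: conv_def sum_distrib_left cong: sum.cong)
  finally show "conv G (conv G x y) z g = conv G x (conv G y z) g" .
qed auto

text \<open>The coefficients of \<open>x\<close> times \<open>star G x\<close> are autocorrelations
  of \<open>x\<close>; in this form the terms for \<open>h\<close> and for a translate of
  \<open>h\<close> can be compared.\<close>

lemma conv_star_apply:
  assumes "g \<in> carrier G"
  shows "conv G x (star G x) g = (\<Sum>h\<in>carrier G. x h * x (inv g \<otimes> h))"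
  unfolding conv_def star_def using assms by (auto simp: inv_mult_group intro!: sum.cong)

end

lemma (in comm_group) conv_comm:
  assumes "finite (carrier G)" shows "conv G x y = conv G y x"
proof -
  interpret finite_group G by unfold_locales (rule assms)
  show ?thesis
  proof (rule coeffs_eqI[of _ G])
    fix g assume g: "g \<in> carrier G"
    have "conv G x y g = (\<Sum>h\<in>carrier G. y h * x (inv h \<otimes> g))"
      unfolding conv_def using g
      by (simp, intro sum.reindex_bij_witness[where i = "\<lambda>h. inv h \<otimes> g" and j = "\<lambda>h. inv h \<otimes> g"])
        (auto simp: inv_mult_group m_assoc m_comm m_lcomm)
    then show "conv G x y g = conv G y x g" using g by (simp add: conv_def)
  qed auto
qed

section \<open>Arithmetic in characteristic two\<close>

lemma char2_two:
  assumes "CHAR('f::field) = 2" shows "(2 :: 'f) = 0"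
proof -
  have "of_nat 2 = (0 :: 'f)" using assms of_nat_CHAR by metis
  then show ?thesis by simp
qed

lemma char2_double:
  assumes "CHAR('f::field) = 2" shows "(x :: 'f) + x = 0"
  by (simp add: char2_two[OF assms] flip: mult_2)

lemma char2_eq_iff:
  assumes "CHAR('f::field) = 2" shows "(x :: 'f) + y = 0 \<longleftrightarrow> x = y"
  using char2_double[OF assms] by (metis add_right_cancel)

lemma char2_square_add:
  assumes "CHAR('f::field) = 2" shows "(x + y) * (x + y) = x * x + y * (y :: 'f)"
proof -
  have "(x + y) * (x + y) = x * x + y * y + (x * y + x * y)" by (simp add: algebra_simps)
  then show ?thesis by (simp only: char2_double[OF assms] add_0_right)
qed

lemma char2_sum_squares:
  assumes "CHAR('f::field) = 2" "finite S"
  shows "(\<Sum>x\<in>S. f x * f x) = (\<Sum>x\<in>S. f x :: 'f) * (\<Sum>x\<in>S. f x)"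
  using assms(2) by induction (simp_all add: char2_square_add[OF assms(1)])

text \<open>The orbits are pairs on which \<open>f\<close> takes equal values, and each pair
  cancels.\<close>

lemma char2_sum_involution:
  assumes "CHAR('f::field) = 2" "finite S"
    and "\<And>x. x \<in> S \<Longrightarrow> i x \<in> S" "\<And>x. x \<in> S \<Longrightarrow> i (i x) = x"
    and "\<And>x. x \<in> S \<Longrightarrow> i x \<noteq> x" "\<And>x. x \<in> S \<Longrightarrow> f (i x) = f x"
  shows "(\<Sum>x\<in>S. f x :: 'f) = 0"
  using assms(2-)
proof (induction "card S" arbitrary: S rule: less_induct)
  case less
  show ?case
  proof (cases "S = {}")
    case False
    then obtain a where a: "a \<in> S" by blast
    define T where "T = S - {a, i a}"
    have S: "S = insert a (insert (i a) T)" "a \<notin> T" "i a \<notin> T" "i a \<noteq> a" "finite T" "f (i a) = f a"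
      using a less.prems by (auto simp: T_def)
    have "sum f T = 0"
    proof (rule less.hyps)
      show "card T < card S" using S by simp
      show "i x \<in> T" if "x \<in> T" for x
        using that less.prems(2,3) a by (auto simp: T_def) (metis less.prems(3))+
    qed (use S less.prems in auto)
    then show ?thesis using S char2_double[OF assms(1), of "f a"] by (simp add: add.assoc[symmetric])
  qed simp
qed

section \<open>Central extensions of abelian groups by a group of order two\<close>

text \<open>The algebra homomorphism FG -> FA induced by \<open>p\<close>: coefficients are added
  along the fibers.\<close>

definition push :: "('a, 'b) monoid_scheme \<Rightarrow> ('a \<Rightarrow> 'c) \<Rightarrow> ('a \<Rightarrow> 'f::field) \<Rightarrow> 'c \<Rightarrow> 'f" where
  "push G p x = (\<lambda>a. \<Sum>g\<in>{g \<in> carrier G. p g = a}. x g)"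

text \<open>For a double cover this is \<open>1 + c\<close> times any element of FG with push
  \<open>f\<close>. The range of \<open>pull\<close> on FA is the ideal
  \<open>(1 + c)FG\<close>.\<close>

definition pull :: "('a, 'b) monoid_scheme \<Rightarrow> ('a \<Rightarrow> 'c) \<Rightarrow> ('c \<Rightarrow> 'f::field) \<Rightarrow> 'a \<Rightarrow> 'f" where
  "pull G p f = (\<lambda>g. if g \<in> carrier G then f (p g) else 0)"

text \<open>Only A is assumed to be abelian: the locale covers the steps between abelian groups as
  well as the final passage to the nonabelian group.\<close>

locale double_cover = finite_group G + A: comm_group A
  for G :: "('a, 'b) monoid_scheme" (structure) and A :: "('c, 'd) monoid_scheme" +
  fixes p :: "'a \<Rightarrow> 'c" and c :: 'a and F :: "'f::{field,finite} itself"
  assumes p_hom: "p \<in> hom G A"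
    and p_surj: "p ` carrier G = carrier A"
    and c_closed [simp]: "c \<in> carrier G"
    and c_not_one: "c \<noteq> \<one>"
    and p_kernel: "g \<in> carrier G \<Longrightarrow> p g = \<one>\<^bsub>A\<^esub> \<longleftrightarrow> g = \<one> \<or> g = c"
    and char_F: "CHAR('f) = 2"
begin

sublocale A: finite_group A
proof
  show "finite (carrier A)" using fin by (simp flip: p_surj)
qed

sublocale p: group_hom G A p
  by unfold_locales (rule p_hom)

lemma c_square [simp]: "c \<otimes> c = \<one>"
proof -
  have "p (c \<otimes> c) = \<one>\<^bsub>A\<^esub>" using p_kernel[of c] by simp
  then show ?thesis using p_kernel[of "c \<otimes> c"] c_not_one by simp
qed

lemma inv_c [simp]: "inv c = c"
  by (rule inv_equality) auto

text \<open>A conjugate of \<open>c\<close> lies in the kernel of \<open>p\<close> and is not the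
  identity, hence equals \<open>c\<close>.\<close>

lemma c_central:
  assumes "g \<in> carrier G" shows "g \<otimes> c = c \<otimes> g"
proof -
  let ?d = "inv g \<otimes> (c \<otimes> g)"
  have "p ?d = \<one>\<^bsub>A\<^esub>" using assms p_kernel[of c] by simp
  then have d: "?d = \<one> \<or> ?d = c" using assms by (subst (asm) p_kernel) auto
  have eq: "c \<otimes> g = g \<otimes> ?d" using assms by simp
  have "?d \<noteq> \<one>"
  proof
    assume "?d = \<one>"
    with eq assms have "c \<otimes> g = g" by simp
    then show False using assms c_not_one by simp
  qed
  with d eq show ?thesis by simp
qed

lemma c_mult_c [simp]: "g \<in> carrier G \<Longrightarrow> g \<otimes> c \<otimes> c = g"
  by (simp add: m_assoc)

lemma mult_c_neq: "g \<in> carrier G \<Longrightarrow> g \<otimes> c \<noteq> g"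
  using c_not_one by simp

lemma p_c [simp]: "p c = \<one>\<^bsub>A\<^esub>"
  by (simp add: p_kernel)

lemma p_eq_iff:
  assumes "g \<in> carrier G" "h \<in> carrier G"
  shows "p h = p g \<longleftrightarrow> h = g \<or> h = g \<otimes> c"
proof -
  have "p h = p g \<longleftrightarrow> p (inv g \<otimes> h) = \<one>\<^bsub>A\<^esub>"
    using assms by (auto simp: A.inv_solve_left')
  also have "\<dots> \<longleftrightarrow> h = g \<or> h = g \<otimes> c"
    using assms by (simp add: p_kernel inv_solve_left' del: p.hom_mult p.hom_inv)
  finally show ?thesis .
qed

lemma fiber:
  assumes "g \<in> carrier G" shows "{h \<in> carrier G. p h = p g} = {g, g \<otimes> c}"
  using assms by (auto simp: p_eq_iff)

lemma push_apply:
  assumes "g \<in> carrier G" shows "push G p x (p g) = x g + x (g \<otimes> c)"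
  using assms mult_c_neq[OF assms] by (simp add: push_def fiber)

lemma push_in_coeffs [simp, intro]: "push G p x \<in> coeffs A"
proof -
  have "{g \<in> carrier G. p g = a} = {}" if "a \<notin> carrier A" for a
    using that by auto
  then show ?thesis by (simp add: coeffs_def push_def del: Collect_empty_eq)
qed

lemma pull_in_coeffs [simp, intro]: "pull G p f \<in> coeffs G"
  by (simp add: coeffs_def pull_def)

lemma push_add: "push G p (x + y) = push G p x + push G p y"
  by (auto simp: push_def sum.distrib)

lemma push_point:
  assumes "g \<in> carrier G" shows "push G p (point g b) = point (p g) b"
  unfolding push_def point_def using assms fin by (auto simp: fun_eq_iff)

lemma push_pull: "push G p (pull G p f :: 'a \<Rightarrow> 'f) = 0"
proof (rule coeffs_eqI[of _ A])
  fix a assume "a \<in> carrier A"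
  then obtain g where "g \<in> carrier G" "a = p g" using p_surj by blast
  then show "push G p (pull G p f :: 'a \<Rightarrow> 'f) a = 0 a"
    by (simp add: push_apply pull_def char2_double[OF char_F])
qed auto

lemma sum_push: "(\<Sum>a\<in>carrier A. push G p x a * f a) = (\<Sum>g\<in>carrier G. x g * f (p g))"
proof -
  have "(\<Sum>a\<in>carrier A. push G p x a * f a) =
      (\<Sum>a\<in>carrier A. \<Sum>g\<in>{g \<in> carrier G. p g = a}. x g * f (p g))"
    by (simp add: push_def sum_distrib_right)
  also have "\<dots> = (\<Sum>g\<in>carrier G. x g * f (p g))"
    by (rule sum.group) (auto simp: fin A.fin)
  finally show ?thesis .
qed

lemma push_star: "push G p (star G x) = star A (push G p x)"
proof (rule coeffs_eqI[of _ A])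
  fix a assume "a \<in> carrier A"
  then obtain g where "g \<in> carrier G" "a = p g" using p_surj by blast
  then show "push G p (star G x) a = star A (push G p x) a"
    by (simp add: push_apply star_def flip: p.hom_inv)
      (simp add: push_apply inv_mult_group c_central)
qed auto

lemma pull_star: "pull G p (star A f) = star G (pull G p f)"
  by (auto simp: pull_def star_def)

text \<open>The ideal \<open>(1 + c)FG\<close> is a module over FA: a factor next to a pulled back
  element matters only through its push.\<close>

lemma conv_pull_right: "conv G y (pull G p f) = pull G p (conv A (push G p y) f)"
proof (rule coeffs_eqI[of _ G])
  fix g assume g: "g \<in> carrier G"
  then show "conv G y (pull G p f) g = pull G p (conv A (push G p y) f) g"
    by (simp add: conv_def pull_def sum_push cong: sum.cong)
qed auto

lemma conv_pull_left:
  assumes "f \<in> coeffs A"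
  shows "conv G (pull G p f) y = pull G p (conv A f (push G p y))"
proof -
  have "star G (conv G (pull G p f) y) = star G (pull G p (conv A f (push G p y)))"
    by (simp add: star_conv conv_pull_right push_star A.star_conv flip: pull_star)
  then show ?thesis using star_star by (metis conv_in_coeffs pull_in_coeffs)
qed

lemma push_conv: "push G p (conv G x y) = conv A (push G p x) (push G p y)"
proof (rule coeffs_eqI[of _ A])
  fix a assume "a \<in> carrier A"
  then obtain g where g: "g \<in> carrier G" "a = p g" using p_surj by blast
  have "conv A (push G p x) (push G p y) a = (\<Sum>h\<in>carrier G. x h * push G p y (p (inv h \<otimes> g)))"
    using g by (simp add: conv_def sum_push)
  also have "\<dots> = (\<Sum>h\<in>carrier G. x h * y (inv h \<otimes> g) + x h * y (inv h \<otimes> (g \<otimes> c)))"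
    using g by (intro sum.cong HOL.refl, subst push_apply) (auto simp: distrib_left m_assoc)
  also have "\<dots> = push G p (conv G x y) a"
    using g by (simp add: push_apply conv_def sum.distrib)
  finally show "push G p (conv G x y) a = conv A (push G p x) (push G p y) a" ..
qed auto

text \<open>A vanishing push says that the two values on each fiber add up to zero. In
  characteristic two they then agree, so the element is constant on fibers.\<close>

lemma push_eq_0_iff:
  assumes "z \<in> coeffs G" shows "push G p z = (0 :: 'c \<Rightarrow> 'f) \<longleftrightarrow> (\<exists>f\<in>coeffs A. z = pull G p f)"
proof
  assume z: "push G p z = (0 :: 'c \<Rightarrow> 'f)"
  define f where "f a = (if a \<in> carrier A then z (SOME g. g \<in> carrier G \<and> p g = a) else 0)" for a
  have "z = pull G p f"
  proof (rule coeffs_eqI[of _ G])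
    fix g assume g: "g \<in> carrier G"
    define h where "h = (SOME h. h \<in> carrier G \<and> p h = p g)"
    have h: "h \<in> carrier G" "p h = p g" using someI[of "\<lambda>h. h \<in> carrier G \<and> p h = p g" g] g
      by (auto simp: h_def)
    have "z g + z (g \<otimes> c) = 0" using z g by (simp flip: push_apply)
    then have "z h = z g" using h g p_eq_iff char2_eq_iff[OF char_F] by metis
    then show "z g = pull G p f g" using g by (simp add: pull_def f_def h_def)
  qed (use assms in auto)
  moreover have "f \<in> coeffs A" by (simp add: f_def coeffs_def)
  ultimately show "\<exists>f\<in>coeffs A. z = pull G p f" by blast
qed (auto simp: push_pull)

end

lemma card_uniform_fibers:
  assumes "finite S" "\<And>x. x \<in> S \<Longrightarrow> card {y \<in> S. f y = f x} = N"
  shows "card S = N * card (f ` S)"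
proof -
  have "card S = (\<Sum>b\<in>f ` S. \<Sum>x\<in>{x \<in> S. f x = b}. 1)"
    using assms(1) by (subst sum.group) auto
  also have "\<dots> = (\<Sum>b\<in>f ` S. N)"
    using assms by (intro sum.cong) auto
  finally show ?thesis by simp
qed

section \<open>Elements of square one and unitary elements\<close>

lemma (in group) Omega_1_iff: "g \<in> Omega_1 G \<longleftrightarrow> g \<in> carrier G \<and> g \<otimes> g = \<one>"
  by (auto simp: Omega_1_def numeral_2_eq_2)

lemma (in group) Omega_c_iff: "g \<in> Omega_c G a \<longleftrightarrow> g \<in> carrier G \<and> g \<otimes> g = a"
  by (auto simp: Omega_c_def numeral_2_eq_2)

text \<open>The element \<open>b(g + inv g)\<close>. For \<open>g\<close> of square one its two
  points coincide and cancel in characteristic two.\<close>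

definition symm_point :: "('a, 'b) monoid_scheme \<Rightarrow> 'a \<Rightarrow> 'f::field \<Rightarrow> 'a \<Rightarrow> 'f" where
  "symm_point G g b = point g b + point (inv\<^bsub>G\<^esub> g) b"

text \<open>The factor \<open>CARD('f)\<close> on the left replaces the \<open>- 1\<close> in the
  exponent of the final formula. \<open>e\<close> is the multiplier, in the end 1, 2 or 4; the
  division by two is exact by \<open>even_order_Omega_1\<close>.\<close>

definition unitary_count :: "('a, 'b) monoid_scheme \<Rightarrow> 'f::{field,finite} itself \<Rightarrow> nat \<Rightarrow> bool" where
  "unitary_count G F e \<longleftrightarrow> CARD('f) * card (unitary G :: ('a \<Rightarrow> 'f) set) =
     e * CARD('f) ^ ((order G + card (Omega_1 G)) div 2)"

lemma char2_fun_double: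
  assumes "CHAR('f::field) = 2"
  shows "(x :: 'a \<Rightarrow> 'f) + x = 0" "x + (x + y) = y" "(2 :: 'a \<Rightarrow> 'f) = 0"
proof -
  show "x + x = 0" by (rule ext) (simp only: plus_fun_apply zero_fun_apply char2_double[OF assms])
  then show "x + (x + y) = y" by (simp only: add.assoc[symmetric] add_0_left)
  show "(2 :: 'a \<Rightarrow> 'f) = 0"
    by (simp only: one_add_one[symmetric]) (simp add: fun_eq_iff char2_two[OF assms])
qed

context finite_group
begin

lemma Omega_1_inv: "{g \<in> carrier G. inv g = g} = Omega_1 G"
proof -
  have "inv g = g \<longleftrightarrow> g \<otimes> g = \<one>" if "g \<in> carrier G" for g
    using that by (metis inv_equality r_inv)
  then show ?thesis by (auto simp: Omega_1_iff)
qed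

lemma even_order_Omega_1: "even (order G + card (Omega_1 G))"
proof -
  obtain N where "2 * N = card (carrier G) + card {g \<in> carrier G. inv g = g}"
    using card_invariant_functions[OF fin, where i = "\<lambda>g. inv g" and ?'f = Enum.finite_2] by auto
  then show ?thesis by (metis Omega_1_inv dvd_triv_left order_def)
qed

lemma star_conv_star: "star G (conv G x (star G x)) = conv G x (star G x)"
  if "x \<in> coeffs G"
  using that by (simp add: star_conv star_star)

lemma conv_star_inv:
  assumes "x \<in> coeffs G" "g \<in> carrier G"
  shows "conv G x (star G x) (inv g) = conv G x (star G x) g"
proof -
  have "conv G x (star G x) g = star G (conv G x (star G x)) g"
    by (simp add: star_conv_star[OF assms(1)])
  also have "\<dots> = conv G x (star G x) (inv g)"
    using assms(2) by (simp add: star_def)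
  finally show ?thesis ..
qed

lemma conv_star_one:
  assumes "CHAR('f::field) = 2"
  shows "conv G x (star G x) \<one> = (\<Sum>g\<in>carrier G. x g) * (\<Sum>g\<in>carrier G. x g :: 'f)"
  by (simp add: conv_star_apply char2_sum_squares[OF assms fin, symmetric])

text \<open>The terms for \<open>h\<close> and \<open>g \<otimes> h\<close> of the autocorrelation
  are equal and cancel.\<close>

lemma conv_star_involution:
  assumes "CHAR('f::field) = 2" "g \<in> Omega_1 G" "g \<noteq> \<one>"
  shows "conv G x (star G x) g = (0 :: 'f)"
proof -
  have g: "g \<in> carrier G" "inv g = g" using assms(2) Omega_1_inv by auto
  then have [simp]: "g \<otimes> (g \<otimes> h) = h" if "h \<in> carrier G" for h
    using mult_inv_cancel(1)[of g h] that by simp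
  have "(\<Sum>h\<in>carrier G. x h * x (g \<otimes> h)) = 0"
    by (rule char2_sum_involution[OF assms(1) fin, where i = "\<lambda>h. g \<otimes> h"])
      (use g assms(3) in \<open>auto simp: mult.commute\<close>)
  then show ?thesis using g by (simp add: conv_star_apply)
qed

text \<open>The coefficient of \<open>x\<close> times \<open>star G x\<close> at the identity is the
  square of the augmentation, and 1 is the only square root of 1 in characteristic two.\<close>

lemma sum_unitary:
  assumes "CHAR('f::field) = 2" "x \<in> unitary G"
  shows "(\<Sum>g\<in>carrier G. x g) = (1 :: 'f)"
proof -
  let ?s = "\<Sum>g\<in>carrier G. x g"
  have "?s * ?s = 1"
    using assms conv_star_one[OF assms(1), of x] by (simp add: unitary_def point_def)
  then have "(?s + 1) * (?s + 1) = 0"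
    by (simp add: char2_square_add[OF assms(1)] char2_double[OF assms(1)])
  then show ?thesis by (simp add: char2_eq_iff[OF assms(1)])
qed

lemma unitary_conv:
  assumes "x \<in> unitary G" "y \<in> unitary G" shows "conv G x y \<in> unitary G"
proof -
  have "conv G (conv G x y) (star G (conv G x y)) =
      conv G x (conv G (conv G y (star G y)) (star G x))"
    by (simp add: star_conv conv_assoc)
  then show ?thesis using assms by (simp add: unitary_def conv_one_left)
qed

lemma symm_point_in_coeffs [intro]: "g \<in> carrier G \<Longrightarrow> symm_point G g b \<in> coeffs G"
  by (auto simp: symm_point_def)

lemma symm_point_add: "symm_point G g a + symm_point G g b = symm_point G g (a + b)"
  by (auto simp: symm_point_def point_def fun_eq_iff)

lemma symm_point_inv: "g \<in> carrier G \<Longrightarrow> symm_point G (inv g) b = symm_point G g b"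
  by (simp add: symm_point_def add.commute)

lemma symm_point_Omega_1:
  assumes "CHAR('f::field) = 2" "g \<in> Omega_1 G"
  shows "symm_point G g (b :: 'f) = 0"
proof -
  have "inv g = g" using assms(2) Omega_1_inv by auto
  then show ?thesis by (simp add: symm_point_def char2_fun_double[OF assms(1)])
qed

text \<open>Two points with the same coefficient are used so that their contributions
  \<open>b * b\<close> at the identity cancel; a single point would leave one of them
  behind.\<close>

lemma conv_star_three_points:
  assumes "CHAR('f::field) = 2" "g \<in> carrier G" "h \<in> carrier G"
    and y: "y = point \<one> 1 + (point g b + point h (b :: 'f))"
  shows "conv G y (star G y) =
    point \<one> 1 + (symm_point G g b + symm_point G h b + symm_point G (g \<otimes> inv h) (b * b))"
  using assms(2,3) unfolding y
  by (simp add: star_add star_point conv_add_left conv_add_right conv_points inv_mult_group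
      symm_point_def add.assoc add.commute add.left_commute char2_fun_double[OF assms(1)])

end

section \<open>Lifts of unitary elements and their defects\<close>

context double_cover
begin

lemma p_lift:
  assumes "a \<in> carrier A" obtains g where "g \<in> carrier G" "a = p g"
proof -
  have "a \<in> p ` carrier G" using assms by (simp only: p_surj)
  then show ?thesis using that by (elim imageE)
qed

definition lifts :: "('a \<Rightarrow> 'f) set" where
  "lifts = {y \<in> coeffs G. push G p y \<in> unitary A}"

definition defect :: "('a \<Rightarrow> 'f) \<Rightarrow> 'a \<Rightarrow> 'f" where
  "defect y = conv G y (star G y) + point \<one> 1"

text \<open>The constraints that every defect satisfies for formal reasons. Whether they are the
  only ones decides the multiplier in \<open>unitary_count_step\<close>.\<close>

definition symmetric_part :: "('a \<Rightarrow> 'f) set" where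
  "symmetric_part = {z \<in> coeffs G. (\<forall>g\<in>carrier G. z (g \<otimes> c) = z g \<and> z (inv g) = z g) \<and>
     (\<forall>g\<in>Omega_1 G. z g = 0)}"

lemmas double = char2_fun_double[OF char_F]

lemma eq_iff_add_eq_0: "(x :: 'b2 \<Rightarrow> 'f) = y \<longleftrightarrow> x + y = 0"
  by (metis add_right_cancel double(1))

lemma finite_lifts: "finite lifts"
  by (rule finite_subset[OF _ finite_coeffs(1)[OF fin]]) (auto simp: lifts_def)

lemma push_one: "push G p (point \<one> 1) = point \<one>\<^bsub>A\<^esub> 1"
  by (simp add: push_point)

lemma defect_eq_pull:
  assumes "y \<in> lifts"
  obtains s where "s \<in> coeffs A" "defect y = pull G p s"
proof -
  have "push G p (defect y) = 0"
    using assms by (simp add: defect_def push_add push_conv push_star lifts_def unitary_def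
      push_one double)
  moreover have "defect y \<in> coeffs G" by (auto simp: defect_def)
  ultimately show ?thesis using that push_eq_0_iff by blast
qed

lemma conv_star_eq: "conv G y (star G y) = point \<one> 1 + defect y"
  by (simp add: defect_def double add.left_commute)

text \<open>The product of \<open>y\<close> and \<open>star G y\<close> is 1 plus a pulled back
  \<open>s\<close>. Surrounding it by \<open>x\<close> and \<open>star G x\<close> happens, for
  \<open>s\<close>, in the commutative algebra FA, where the image of \<open>x\<close> is unitary;
  so \<open>s\<close> is unchanged and is added to the defect of \<open>x\<close>.\<close>

lemma conv_lifts:
  assumes "x \<in> lifts" "y \<in> lifts"
  shows "conv G x y \<in> lifts" "defect (conv G x y) = defect x + defect y"
proof -
  show "conv G x y \<in> lifts"
    using assms by (auto simp: lifts_def push_conv intro: A.unitary_conv)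
  from assms(2) obtain s where s: "s \<in> coeffs A" "defect y = pull G p s" by (rule defect_eq_pull)
  let ?u = "push G p x"
  have "conv A ?u (conv A s (star A ?u)) = conv A (conv A ?u (star A ?u)) s"
    by (simp add: A.conv_comm[OF A.fin, of s] A.conv_assoc)
  also have "\<dots> = s"
    using assms(1) s by (simp add: lifts_def unitary_def A.conv_one_left)
  finally have u: "conv A ?u (conv A s (star A ?u)) = s" .
  have "conv G (conv G x y) (star G (conv G x y)) =
      conv G x (conv G (conv G y (star G y)) (star G x))"
    by (simp add: star_conv conv_assoc)
  also have "\<dots> = conv G x (star G x) + conv G x (conv G (pull G p s) (star G x))"
    by (simp add: conv_star_eq s conv_add_left conv_add_right conv_one_left)
  also have "conv G x (conv G (pull G p s) (star G x)) = pull G p s"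
    by (simp add: conv_pull_left[OF s(1)] conv_pull_right push_star u)
  finally have "conv G (conv G x y) (star G (conv G x y)) = conv G x (star G x) + defect y"
    by (simp only: s(2))
  then show "defect (conv G x y) = defect x + defect y"
    unfolding defect_def[of x] defect_def[of "conv G x y"] by (simp only: add_ac)
qed

lemma unitary_eq: "unitary G = {y \<in> lifts. defect y = 0}"
proof -
  have "y \<in> lifts" if "y \<in> unitary G" for y
  proof -
    have "conv A (push G p y) (star A (push G p y)) = push G p (conv G y (star G y))"
      by (simp add: push_conv push_star)
    then show ?thesis using that by (simp add: lifts_def unitary_def push_one)
  qed
  then show ?thesis
    by (auto simp: unitary_def lifts_def defect_def eq_iff_add_eq_0[of _ "point \<one> 1"])
qed

text \<open>Right multiplication by a lift is injective: \<open>y * star y = 1 + s\<close> with \<open>s * s = 0\<close>.\<close>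

lemma inj_on_conv_lift:
  assumes "y \<in> lifts" shows "inj_on (\<lambda>x. conv G x y) lifts"
proof -
  from assms obtain s where s: "s \<in> coeffs A" "defect y = pull G p s" by (rule defect_eq_pull)
  let ?t = "point \<one> 1 + pull G p s"
  \<comment> \<open>The ideal has square zero: a product with it goes through the push, which
    annihilates pulled back elements.\<close>
  have "conv G (pull G p s) (pull G p s) = 0"
    unfolding conv_pull_right push_pull by (simp add: pull_def fun_eq_iff)
  then have "conv G ?t ?t = point \<one> 1"
    by (simp add: conv_add_left conv_add_right conv_one_left conv_one_right conv_points double)
  then have "conv G y (conv G (star G y) ?t) = point \<one> 1"
    by (simp add: conv_star_eq s flip: conv_assoc)
  then show ?thesis
    by (intro inj_on_inverseI[where g = "\<lambda>z. conv G z (conv G (star G y) ?t)"])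
      (simp add: conv_assoc conv_one_right lifts_def)
qed

text \<open>Right multiplication by a lift \<open>y\<close> permutes the lifts and adds
  \<open>defect y\<close>. Every fiber of the defect is therefore a translate of the fiber over
  zero, which is \<open>unitary G\<close>.\<close>

lemma card_lifts_defect: "card lifts = card (unitary G :: ('a \<Rightarrow> 'f) set) * card (defect ` lifts)"
proof (rule card_uniform_fibers[OF finite_lifts])
  fix y assume y: "y \<in> lifts"
  let ?r = "\<lambda>x. conv G x y"
  have surj: "?r ` lifts = lifts"
    by (rule endo_inj_surj[OF finite_lifts _ inj_on_conv_lift[OF y]]) (use conv_lifts y in auto)
  have "{z \<in> lifts. defect z = defect y} = ?r ` unitary G"
  proof (intro equalityI subsetI)
    fix z assume z: "z \<in> {z \<in> lifts. defect z = defect y}"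
    then obtain x where x: "x \<in> lifts" "z = ?r x" using surj by blast
    then have "defect x = 0" using z conv_lifts(2)[OF x(1) y] by simp
    then show "z \<in> ?r ` unitary G" using x by (auto simp: unitary_eq)
  qed (use y conv_lifts in \<open>auto simp: unitary_eq\<close>)
  moreover have "inj_on ?r (unitary G)"
    using inj_on_conv_lift[OF y] by (rule inj_on_subset) (auto simp: unitary_eq)
  ultimately show "card {z \<in> lifts. defect z = defect y} = card (unitary G :: ('a \<Rightarrow> 'f) set)"
    by (simp add: card_image)
qed

lemma push_surj:
  assumes "u \<in> coeffs A" obtains y where "y \<in> coeffs G" "push G p y = u"
proof -
  \<comment> \<open>\<open>t\<close> is a section of \<open>p\<close>. The lift takes the values of
    \<open>u\<close> on the section and is zero elsewhere.\<close>
  define t where "t a = (SOME g. g \<in> carrier G \<and> p g = a)" for a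
  have t: "t a \<in> carrier G" "p (t a) = a" if "a \<in> carrier A" for a
  proof -
    have "\<exists>g. g \<in> carrier G \<and> p g = a" using p_lift[OF that] by metis
    from someI_ex[OF this] show "t a \<in> carrier G" "p (t a) = a" by (simp_all add: t_def)
  qed
  define y where "y g = (if g \<in> carrier G \<and> g = t (p g) then u (p g) else 0)" for g
  have "push G p y a = u a" if a: "a \<in> carrier A" for a
  proof -
    have "push G p y a = y (t a) + y (t a \<otimes> c)"
      using push_apply[of "t a" y] t[OF a] by simp
    moreover have "p (t a \<otimes> c) = a" using t[OF a] a by simp
    ultimately show ?thesis using t[OF a] mult_c_neq[of "t a"] by (simp add: y_def del: p.hom_mult)
  qed
  then have "push G p y = u" using assms by (intro coeffs_eqI[of _ A]) auto
  moreover have "y \<in> coeffs G" by (simp add: y_def coeffs_def)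
  ultimately show ?thesis using that by blast
qed

lemma inj_on_pull: "inj_on (pull G p) (coeffs A)"
proof (rule inj_onI)
  fix x y assume xy: "x \<in> coeffs A" "y \<in> coeffs A" "pull G p x = pull G p y"
  have "x (p g) = y (p g)" if "g \<in> carrier G" for g
    using fun_cong[OF xy(3), of g] that by (simp add: pull_def)
  then have "x a = y a" if "a \<in> carrier A" for a using p_lift[OF that] by metis
  then show "x = y" using xy(1,2) by (intro coeffs_eqI[of _ A]) auto
qed

text \<open>Over each unitary element of FA the lifts form a translate of the kernel of push, which
  \<open>pull\<close> identifies with FA.\<close>

lemma card_lifts_push:
  "card lifts = CARD('f) ^ card (carrier A) * card (unitary A :: ('c \<Rightarrow> 'f) set)"
proof -
  have "push G p ` lifts = unitary A"
  proof (intro equalityI subsetI)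
    fix u assume u: "u \<in> (unitary A :: ('c \<Rightarrow> 'f) set)"
    then have "u \<in> coeffs A" by (simp add: unitary_def)
    then obtain y where "y \<in> coeffs G" "push G p y = u" by (rule push_surj)
    with u show "u \<in> push G p ` lifts" by (auto simp: lifts_def)
  qed (auto simp: lifts_def)
  moreover have "card lifts = CARD('f) ^ card (carrier A) * card (push G p ` lifts)"
  proof (rule card_uniform_fibers[OF finite_lifts])
    fix y assume y: "y \<in> lifts"
    have "{z \<in> lifts. push G p z = push G p y} = (\<lambda>f. y + pull G p f) ` coeffs A"
    proof (intro equalityI subsetI)
      fix z assume z: "z \<in> {z \<in> lifts. push G p z = push G p y}"
      then have "push G p (y + z) = 0" by (simp add: push_add double)
      moreover have "y + z \<in> coeffs G" using y z by (auto simp: lifts_def)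
      ultimately obtain f where "f \<in> coeffs A" "y + z = pull G p f"
        using push_eq_0_iff by blast
      then have "z = y + pull G p f" by (metis double(2))
      then show "z \<in> (\<lambda>f. y + pull G p f) ` coeffs A" using \<open>f \<in> coeffs A\<close> by blast
    qed (use y in \<open>auto simp: lifts_def push_add push_pull\<close>)
    moreover have "inj_on (\<lambda>f. y + pull G p f) (coeffs A)"
      using inj_on_pull by (auto simp: inj_on_def)
    ultimately show "card {z \<in> lifts. push G p z = push G p y} = CARD('f) ^ card (carrier A)"
      by (simp add: card_image finite_coeffs(2)[OF A.fin])
  qed
  ultimately show ?thesis by simp
qed

lemma card_c_closed:
  assumes "S \<subseteq> carrier G" "\<And>g. g \<in> S \<Longrightarrow> g \<otimes> c \<in> S"
  shows "card S = 2 * card (p ` S)"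
proof (rule card_uniform_fibers)
  show "finite S" using assms(1) fin by (rule finite_subset)
  fix g assume g: "g \<in> S"
  then have "{h \<in> S. p h = p g} = {g, g \<otimes> c}"
    using fiber[of g] assms by blast
  then show "card {h \<in> S. p h = p g} = 2"
    using g assms(1) mult_c_neq[of g] by (auto simp: card_insert_if)
qed

lemma mult_c_square:
  assumes "g \<in> carrier G" shows "(g \<otimes> c) \<otimes> (g \<otimes> c) = g \<otimes> g"
proof -
  have "(g \<otimes> c) \<otimes> (g \<otimes> c) = g \<otimes> (c \<otimes> g) \<otimes> c" using assms by (simp add: m_assoc)
  also have "\<dots> = g \<otimes> g" using assms by (simp add: m_assoc flip: c_central)
  finally show ?thesis .
qed

lemma mult_c_Omega:
  "g \<in> Omega_1 G \<Longrightarrow> g \<otimes> c \<in> Omega_1 G" "g \<in> Omega_c G c \<Longrightarrow> g \<otimes> c \<in> Omega_c G c"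
  by (auto simp: Omega_1_iff Omega_c_iff mult_c_square)

lemma Omega_1_A_iff:
  assumes "g \<in> carrier G" shows "p g \<in> Omega_1 A \<longleftrightarrow> g \<in> Omega_1 G \<or> g \<in> Omega_c G c"
  using assms p_kernel[of "g \<otimes> g"] by (auto simp: A.Omega_1_iff Omega_1_iff Omega_c_iff)

lemma disjoint_p_Omega: "p ` Omega_1 G \<inter> p ` Omega_c G c = {}"
proof -
  have False if "g \<in> Omega_1 G" "h \<in> Omega_c G c" "p g = p h" for g h
  proof -
    have "g = h \<or> g = h \<otimes> c" using that p_eq_iff by (auto simp: Omega_1_iff Omega_c_iff)
    then have "g \<in> Omega_c G c" using that mult_c_Omega(2) by auto
    then show False using that c_not_one by (auto simp: Omega_1_iff Omega_c_iff)
  qed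
  then show ?thesis by blast
qed

lemma card_Omega:
  "card (carrier G) = 2 * card (carrier A)"
  "card (Omega_1 G) = 2 * card (p ` Omega_1 G)"
  "card (Omega_c G c) = 2 * card (p ` Omega_c G c)"
  "card (Omega_1 A) = card (p ` Omega_1 G) + card (p ` Omega_c G c)"
proof -
  have sub: "Omega_1 G \<subseteq> carrier G" "Omega_c G c \<subseteq> carrier G"
    by (auto simp: Omega_1_iff Omega_c_iff)
  show "card (carrier G) = 2 * card (carrier A)"
    using card_c_closed[of "carrier G"] by (simp add: p_surj)
  show "card (Omega_1 G) = 2 * card (p ` Omega_1 G)" "card (Omega_c G c) = 2 * card (p ` Omega_c G c)"
    using sub mult_c_Omega by (intro card_c_closed; blast)+
  have "Omega_1 A = p ` Omega_1 G \<union> p ` Omega_c G c"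
  proof (intro equalityI subsetI)
    fix a assume a: "a \<in> Omega_1 A"
    then obtain g where "g \<in> carrier G" "a = p g"
      using p_lift by (auto simp: A.Omega_1_iff)
    with a show "a \<in> p ` Omega_1 G \<union> p ` Omega_c G c" using Omega_1_A_iff by auto
  qed (use sub Omega_1_A_iff in auto)
  then show "card (Omega_1 A) = card (p ` Omega_1 G) + card (p ` Omega_c G c)"
    using disjoint_p_Omega sub fin by (simp add: card_Un_disjoint finite_subset)
qed

text \<open>Through \<open>pull\<close> these elements are the functions on A that are invariant
  under inversion and vanish on the image of \<open>Omega_1\<close>. In the remaining set
  \<open>T\<close> inversion fixes exactly the image of \<open>Omega_c\<close>, and N counts its
  orbits.\<close>

lemma card_symmetric_part:
  "finite symmetric_part \<and>
   (\<exists>N. 4 * N + card (Omega_1 G) = card (carrier G) + card (Omega_c G c) \<and>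
        card symmetric_part = CARD('f) ^ N)"
proof -
  define T where "T = carrier A - p ` Omega_1 G"
  let ?S = "{f :: 'c \<Rightarrow> 'f. (\<forall>x. x \<notin> T \<longrightarrow> f x = 0) \<and> (\<forall>x\<in>T. f (inv\<^bsub>A\<^esub> x) = f x)}"
  have inv_Omega: "p (inv g) \<in> p ` Omega_1 G" if "g \<in> carrier G" "p g \<in> p ` Omega_1 G" for g
  proof -
    from that(2) obtain h where h: "h \<in> Omega_1 G" "p g = p h" by blast
    then have "inv h = h" "h \<in> carrier G" using Omega_1_inv by auto
    then have "p (inv g) = p h" using h(2) that(1) p.hom_inv by metis
    then show ?thesis using h(1) by simp
  qed
  have T_inv: "inv\<^bsub>A\<^esub> a \<in> T" if "a \<in> T" for a
  proof -
    have "a \<in> carrier A" using that by (simp add: T_def)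
    then obtain g where g: "g \<in> carrier G" "a = p g" by (rule p_lift)
    then show ?thesis using that inv_Omega[of "inv g"] by (auto simp: T_def)
  qed
  have fixT: "{x \<in> T. inv\<^bsub>A\<^esub> x = x} = p ` Omega_c G c"
  proof -
    have "{x \<in> T. inv\<^bsub>A\<^esub> x = x} = Omega_1 A - p ` Omega_1 G"
      unfolding T_def A.Omega_1_inv[symmetric] by blast
    also have "\<dots> = p ` Omega_c G c"
    proof (intro equalityI subsetI)
      fix a assume a: "a \<in> Omega_1 A - p ` Omega_1 G"
      then obtain g where "g \<in> carrier G" "a = p g"
        using p_lift by (auto simp: A.Omega_1_iff)
      with a show "a \<in> p ` Omega_c G c" using Omega_1_A_iff by auto
    next
      fix a assume "a \<in> p ` Omega_c G c"
      then show "a \<in> Omega_1 A - p ` Omega_1 G"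
        using Omega_1_A_iff disjoint_p_Omega by (auto simp: Omega_c_iff)
    qed
    finally show ?thesis .
  qed
  have TA: "T \<subseteq> carrier A" by (auto simp: T_def)
  then have finT: "finite T" using A.fin by (rule finite_subset)
  have invT: "inv\<^bsub>A\<^esub> (inv\<^bsub>A\<^esub> a) = a" if "a \<in> T" for a using that TA by auto
  obtain N where N: "2 * N = card T + card {x \<in> T. inv\<^bsub>A\<^esub> x = x}" "finite ?S"
      "card ?S = CARD('f) ^ N"
    using card_invariant_functions[OF finT T_inv invT, where ?'f = 'f] by blast
  have "card T + card (p ` Omega_1 G) = card (carrier A)"
  proof -
    have "p ` Omega_1 G \<subseteq> carrier A" by (auto simp: Omega_1_iff)
    then show ?thesis
      unfolding T_def using A.fin by (simp add: card_Diff_subset card_mono finite_subset)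
  qed
  \<comment> \<open>The carrier, \<open>Omega_1\<close> and \<open>Omega_c\<close> are twice as
    large as their images in A, which turns \<open>2 * N\<close> into \<open>4 * N\<close>.\<close>
  with N(1) have count: "4 * N + card (Omega_1 G) = card (carrier G) + card (Omega_c G c)"
    unfolding fixT card_Omega(1-3) by linarith
  have "symmetric_part = pull G p ` ?S"
  proof (intro equalityI subsetI)
    fix z assume z: "z \<in> symmetric_part"
    then have "z \<in> coeffs G" by (simp add: symmetric_part_def)
    moreover have "push G p z = 0"
    proof (rule coeffs_eqI[of _ A])
      fix a assume "a \<in> carrier A"
      then obtain g where "g \<in> carrier G" "a = p g" by (rule p_lift)
      then show "push G p z a = 0 a"
        using z by (simp add: symmetric_part_def push_apply char2_double[OF char_F])
    qed auto
    ultimately obtain f where f: "f \<in> coeffs A" "z = pull G p f" using push_eq_0_iff by blast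
    have fp: "f (p g) = z g" if "g \<in> carrier G" for g using that by (simp add: f(2) pull_def)
    have "f a = 0" if "a \<notin> T" for a
    proof (cases "a \<in> carrier A")
      case True
      then have "a \<in> p ` Omega_1 G" using that by (simp add: T_def)
      then obtain g where "g \<in> Omega_1 G" "a = p g" by blast
      then show ?thesis using fp[of g] z by (auto simp: symmetric_part_def Omega_1_iff)
    qed (use f in \<open>simp add: coeffs_def\<close>)
    moreover have "f (inv\<^bsub>A\<^esub> a) = f a" if "a \<in> T" for a
    proof -
      have "a \<in> carrier A" using that by (simp add: T_def)
      then obtain g where g: "g \<in> carrier G" "a = p g" by (rule p_lift)
      then show ?thesis using fp[of g] fp[of "inv g"] z by (simp add: symmetric_part_def)
    qed
    ultimately show "z \<in> pull G p ` ?S" using f by blast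
  next
    fix z assume "z \<in> pull G p ` ?S"
    then obtain f where f: "\<forall>x. x \<notin> T \<longrightarrow> f x = 0" "\<forall>x\<in>T. f (inv\<^bsub>A\<^esub> x) = f x"
      and z: "z = pull G p f" by blast
    have "f (inv\<^bsub>A\<^esub> (p g)) = f (p g)" if g: "g \<in> carrier G" for g
    proof (cases "p g \<in> T")
      case False
      then have "p (inv g) \<notin> T" using g inv_Omega[of g] by (auto simp: T_def)
      then show ?thesis using False f(1) g by simp
    qed (use f in auto)
    then show "z \<in> symmetric_part"
      using f(1) unfolding z symmetric_part_def by (auto simp: pull_def T_def Omega_1_iff coeffs_def)
  qed
  moreover have "inj_on (pull G p) ?S"
    using inj_on_pull by (rule inj_on_subset) (use TA in \<open>auto simp: coeffs_def\<close>)
  ultimately show ?thesis using N count by (auto simp: card_image)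
qed

text \<open>\<open>m\<close> is the index of the actual defects among the symmetric elements. The
  lifts are counted twice, by the fibers of push and by the fibers of the defect.\<close>

lemma unitary_count_step:
  assumes "unitary_count A F e" "m * card (defect ` lifts) = card symmetric_part"
  shows "unitary_count G F (m * e)"
proof -
  let ?q = "CARD('f)" and ?U = "card (unitary G :: ('a \<Rightarrow> 'f) set)"
  obtain N where N: "4 * N + card (Omega_1 G) = card (carrier G) + card (Omega_c G c)"
      "card symmetric_part = ?q ^ N" using card_symmetric_part by blast
  define h where "h = (order G + card (Omega_1 G)) div 2"
  define k where "k = (order A + card (Omega_1 A)) div 2"
  have h: "2 * h = order G + card (Omega_1 G)" and k: "2 * k = order A + card (Omega_1 A)"
    using even_order_Omega_1 A.even_order_Omega_1 by (auto simp: h_def k_def)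
  \<comment> \<open>The exponents balance exactly, so \<open>m\<close> is the only change to the
    multiplier.\<close>
  have hk: "card (carrier A) + k = h + N"
    using h k N(1) card_Omega by (simp add: order_def)
  have "?q * ?U * ?q ^ N = m * (?q * (?U * card (defect ` lifts)))"
    using assms(2) N(2) by (metis (no_types, lifting) mult.assoc mult.left_commute)
  also have "\<dots> = m * (?q ^ card (carrier A) * (?q * card (unitary A :: ('c \<Rightarrow> 'f) set)))"
    by (simp flip: card_lifts_defect add: card_lifts_push)
  also have "\<dots> = m * e * ?q ^ (card (carrier A) + k)"
    using assms(1) by (simp add: unitary_count_def k_def power_add)
  also have "\<dots> = m * e * ?q ^ h * ?q ^ N"
    by (simp add: hk power_add)
  finally show ?thesis by (simp add: unitary_count_def h_def)
qed

end

text \<open>Squaring is additive with trivial kernel, hence injective, and so bijective on a finite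
  field.\<close>

lemma char2_square_root:
  assumes "CHAR('f::{field,finite}) = 2" obtains a where "a * a = (b :: 'f)"
proof -
  have "inj (\<lambda>a :: 'f. a * a)"
  proof (rule injI)
    fix x y :: 'f assume "x * x = y * y"
    then have "(x + y) * (x + y) = 0"
      by (simp add: char2_square_add[OF assms] char2_two[OF assms])
    then show "x = y" by (simp add: char2_eq_iff[OF assms])
  qed
  then have "surj (\<lambda>a :: 'f. a * a)" by (simp add: finite_UNIV_inj_surj)
  then show ?thesis using that by (metis surjD)
qed

section \<open>Symmetric elements that occur as defects\<close>

context double_cover
begin

lemma sum_lift:
  assumes "y \<in> lifts" shows "(\<Sum>g\<in>carrier G. y g) = 1"
  using sum_push[of y "\<lambda>_. 1"] A.sum_unitary[OF char_F, of "push G p y"] assms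
  by (simp add: lifts_def)

text \<open>At the identity the defect is the squared augmentation plus 1, at other involutions the
  terms pair off. It is constant on fibers because it is pulled back, and invariant under inversion
  because \<open>star\<close> fixes it.\<close>

lemma defect_in_symmetric_part:
  assumes "y \<in> lifts" shows "defect y \<in> symmetric_part"
proof -
  obtain s where s: "defect y = pull G p s" using assms by (rule defect_eq_pull)
  have y: "y \<in> coeffs G" "push G p y \<in> unitary A" using assms by (auto simp: lifts_def)
  have "defect y \<one> = 0"
    using sum_lift[OF assms] by (simp add: defect_def conv_star_one[OF char_F] point_def char2_two[OF char_F])
  moreover have "defect y g = 0" if "g \<in> Omega_1 G" "g \<noteq> \<one>" for g
    using conv_star_involution[OF char_F that] that by (simp add: defect_def point_def)
  ultimately have "defect y g = 0" if "g \<in> Omega_1 G" for g using that by metis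
  moreover have "defect y (g \<otimes> c) = defect y g" if "g \<in> carrier G" for g
    using that by (simp add: s pull_def)
  moreover have "defect y (inv g) = defect y g" if "g \<in> carrier G" for g
    using that conv_star_inv[OF y(1) that] by (simp add: defect_def point_def)
  moreover have "defect y \<in> coeffs G" by (simp add: s)
  ultimately show ?thesis by (simp add: symmetric_part_def)
qed

lemma point_one_in_lifts: "point \<one> 1 \<in> lifts"
  by (auto simp: lifts_def push_point unitary_def A.star_point A.conv_points)

lemma zero_in_defects: "0 \<in> defect ` lifts"
proof (rule image_eqI)
  show "0 = defect (point \<one> 1)"
    by (simp add: defect_def star_point conv_points double)
qed (rule point_one_in_lifts)

lemma add_in_defects:
  assumes "x \<in> defect ` lifts" "y \<in> defect ` lifts" shows "x + y \<in> defect ` lifts"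
proof -
  from assms obtain u v where "u \<in> lifts" "x = defect u" "v \<in> lifts" "y = defect v" by blast
  then have "x + y = defect (conv G u v)" "conv G u v \<in> lifts" using conv_lifts by simp_all
  then show ?thesis by (rule image_eqI)
qed

text \<open>The witness is \<open>1 + b(g + h)\<close>; the hypothesis on A says that its image
  there is unitary.\<close>

lemma two_points_in_defects:
  assumes g: "g \<in> carrier G" and h: "h \<in> carrier G"
    and "symm_point A (p g) b + symm_point A (p h) b + symm_point A (p (g \<otimes> inv h)) (b * b) = 0"
  shows "symm_point G g b + symm_point G h b + symm_point G (g \<otimes> inv h) (b * b) \<in> defect ` lifts"
proof (rule image_eqI)
  let ?y = "point \<one> 1 + (point g b + point h b)"
  have "conv A (push G p ?y) (star A (push G p ?y)) = point \<one>\<^bsub>A\<^esub> 1"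
    using assms by (subst A.conv_star_three_points[OF char_F, of "p g" "p h" _ b])
      (simp_all add: push_add push_point)
  then show "?y \<in> lifts" using g h by (auto simp: lifts_def unitary_def)
  show "symm_point G g b + symm_point G h b + symm_point G (g \<otimes> inv h) (b * b) = defect ?y"
    unfolding defect_def conv_star_three_points[OF char_F g h HOL.refl] by (simp add: double add_ac)
qed

lemma c_in_Omega_1: "c \<in> Omega_1 G"
  by (simp add: Omega_1_iff)

text \<open>The choice \<open>h = g \<otimes> c\<close> works for every \<open>g\<close>: both
  points have the same image in A and cancel there, and the third term sits at the involution
  \<open>c\<close>, where a symmetric point is zero.\<close>

lemma orbit_in_defects:
  assumes "g \<in> carrier G"
  shows "symm_point G g b + symm_point G (g \<otimes> c) b \<in> defect ` lifts"
proof -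
  have gc: "g \<otimes> inv (g \<otimes> c) = c"
    using assms by (simp add: inv_mult_group c_central)
      (simp flip: m_assoc c_central)
  have "symm_point A \<one>\<^bsub>A\<^esub> (b * b) = (0 :: 'c \<Rightarrow> 'f)"
    by (rule A.symm_point_Omega_1[OF char_F]) (simp add: A.Omega_1_iff)
  moreover have "p (g \<otimes> c) = p g" using assms by simp
  ultimately have "symm_point G g b + symm_point G (g \<otimes> c) b +
      symm_point G (g \<otimes> inv (g \<otimes> c)) (b * b) \<in> defect ` lifts"
    using assms by (intro two_points_in_defects) (simp_all only: gc p_c double add_0_right
      m_closed c_closed)
  then show ?thesis
    by (simp add: gc symm_point_Omega_1[OF char_F c_in_Omega_1])
qed

lemma inv_Omega_c:
  assumes "g \<in> Omega_c G c" shows "inv g = g \<otimes> c"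
  using assms by (intro inv_equality) (auto simp: Omega_c_iff m_assoc c_central)

text \<open>Inverting such a \<open>g\<close> is the same as multiplying it by \<open>c\<close>, so
  the symmetric point is \<open>b(1 + c)g\<close> and lies in the ideal without a partner.\<close>

lemma symm_point_Omega_c:
  assumes "g \<in> Omega_c G c"
  shows "symm_point G g b u = (if u = g \<or> u = g \<otimes> c then b else 0)"
  using assms mult_c_neq[of g]
  by (auto simp: symm_point_def point_def inv_Omega_c Omega_c_iff)

lemma symm_point_in_symmetric_part:
  assumes g: "g \<in> Omega_c G c" shows "symm_point G g b \<in> symmetric_part"
proof -
  have gG: "g \<in> carrier G" using g by (simp add: Omega_c_iff)
  have "u \<noteq> g \<and> u \<noteq> g \<otimes> c" if "u \<in> Omega_1 G" for u
    using g that mult_c_Omega(2)[OF g] c_not_one by (auto simp: Omega_1_iff Omega_c_iff)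
  moreover have "u \<otimes> c = g \<longleftrightarrow> u = g \<otimes> c" "u \<otimes> c = g \<otimes> c \<longleftrightarrow> u = g" if "u \<in> carrier G" for u
    using that gG by auto
  moreover have "inv u = g \<longleftrightarrow> u = g \<otimes> c" "inv u = g \<otimes> c \<longleftrightarrow> u = g" if "u \<in> carrier G" for u
    using that gG inv_Omega_c[OF g] inv_Omega_c[OF mult_c_Omega(2)[OF g]] inv_inv
    by (metis c_mult_c)+
  ultimately show ?thesis
    using symm_point_in_coeffs[OF gG] by (auto simp: symmetric_part_def symm_point_Omega_c[OF g])
qed

lemma symmetric_part_add:
  "x \<in> symmetric_part \<Longrightarrow> y \<in> symmetric_part \<Longrightarrow> x + y \<in> symmetric_part"
  by (auto simp: symmetric_part_def)

text \<open>Induction on the support. For \<open>g\<close> outside \<open>Omega_1\<close>, the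
  points \<open>g\<close>, \<open>g \<otimes> c\<close> and their inverses form one coset of
  \<open>c\<close> if \<open>g\<close> has square \<open>c\<close>, and are four distinct points
  otherwise. A symmetric element is constant on them, and the two kinds of generators correspond to
  the two cases.\<close>

lemma symmetric_part_subset:
  assumes "0 \<in> S" "\<And>x y. x \<in> S \<Longrightarrow> y \<in> S \<Longrightarrow> x + y \<in> S"
    and pt: "\<And>g b. g \<in> Omega_c G c \<Longrightarrow> symm_point G g b \<in> S"
    and orb: "\<And>g b. g \<in> carrier G \<Longrightarrow> symm_point G g b + symm_point G (g \<otimes> c) b \<in> S"
  shows "symmetric_part \<subseteq> S"
proof
  fix z assume "z \<in> symmetric_part"
  then show "z \<in> S"
  proof (induction "card {g. z g \<noteq> 0}" arbitrary: z rule: less_induct)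
    case less
    note z = less.prems
    have fin_z: "finite {g. z g \<noteq> 0}"
      using z by (intro finite_subset[OF _ fin]) (auto simp: symmetric_part_def coeffs_def)
    show ?case
    proof (cases "z = 0")
      case False
      then obtain g where g: "z g \<noteq> 0" by (auto simp: fun_eq_iff)
      then have gG: "g \<in> carrier G" "g \<notin> Omega_1 G"
        using z by (auto simp: symmetric_part_def coeffs_def)
      have zg: "z (g \<otimes> c) = z g" "z (inv g) = z g" "z (inv (g \<otimes> c)) = z g"
        using z gG by (simp_all add: symmetric_part_def)
      \<comment> \<open>A generator that agrees with \<open>z\<close> at \<open>g\<close> and is
        supported where \<open>z\<close> is, so adding it shrinks the support.\<close>
      define e where "e = (if g \<in> Omega_c G c then symm_point G g (z g)
        else symm_point G g (z g) + symm_point G (g \<otimes> c) (z g))"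
      have "defect ` lifts \<subseteq> symmetric_part" using defect_in_symmetric_part by blast
      then have e: "e \<in> S" "e \<in> symmetric_part"
        using pt orb gG orbit_in_defects[OF gG(1), of "z g"] symm_point_in_symmetric_part by (auto simp: e_def)
      have "inv g \<noteq> g" using gG Omega_1_inv by blast
      moreover have "inv (g \<otimes> c) \<noteq> g" if "g \<notin> Omega_c G c"
      proof
        assume "inv (g \<otimes> c) = g"
        then have "g \<otimes> c \<otimes> g = \<one>" using gG r_inv[of "g \<otimes> c"] by simp
        then have "g \<otimes> g \<otimes> c = \<one>" using gG by (simp add: m_assoc c_central)
        then have "g \<otimes> g = c" using gG inv_equality[of "g \<otimes> g" c] by simp
        with that gG show False by (simp add: Omega_c_iff)
      qed
      ultimately have eg: "e g = z g"
        using gG mult_c_neq[of g] symm_point_Omega_c[of g "z g" g]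
        by (auto simp: e_def) (auto simp: symm_point_def point_def)
      have supp: "e u = 0" if "z u = 0" for u
      proof -
        have "u \<noteq> g" "u \<noteq> inv g" "u \<noteq> g \<otimes> c" "u \<noteq> inv (g \<otimes> c)"
          using that g zg by metis+
        then show ?thesis by (simp add: e_def symm_point_def point_def del: inv_mult_group)
      qed
      have "{u. (z + e) u \<noteq> 0} \<subset> {u. z u \<noteq> 0}"
      proof
        show "{u. (z + e) u \<noteq> 0} \<subseteq> {u. z u \<noteq> 0}" using supp by auto
        have "(z + e) g = 0" using eg char2_double[OF char_F] by simp
        then show "{u. (z + e) u \<noteq> 0} \<noteq> {u. z u \<noteq> 0}" using g by blast
      qed
      then have "z + e \<in> S"
        using psubset_card_mono[OF fin_z] symmetric_part_add[OF z e(2)] by (intro less.hyps) auto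
      then have "(z + e) + e \<in> S" using e(1) assms(2) by blast
      then show ?thesis by (simp add: add.assoc double)
    qed (use assms(1) in simp)
  qed
qed

lemma defects_full:
  assumes "\<And>v b. v \<in> Omega_c G c \<Longrightarrow> symm_point G v b \<in> defect ` lifts"
  shows "defect ` lifts = symmetric_part"
  using symmetric_part_subset[OF zero_in_defects add_in_defects assms orbit_in_defects]
    defect_in_symmetric_part by blast

lemma symm_point_A_eq_0:
  assumes "g \<in> Omega_1 G \<or> g \<in> Omega_c G c"
  shows "symm_point A (p g) b = (0 :: 'c \<Rightarrow> 'f)"
proof -
  have "g \<in> carrier G" using assms by (auto simp: Omega_1_iff Omega_c_iff)
  then show ?thesis using assms Omega_1_A_iff A.symm_point_Omega_1[OF char_F] by blast
qed

text \<open>All three points map to elements of square one in the abelian group A, where symmetric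
  points vanish.\<close>

lemma two_involutions_in_defects:
  assumes g: "g \<in> Omega_1 G \<or> g \<in> Omega_c G c" and h: "h \<in> Omega_1 G \<or> h \<in> Omega_c G c"
  shows "symm_point G g b + symm_point G h b + symm_point G (g \<otimes> inv h) (b * b) \<in> defect ` lifts"
proof (rule two_points_in_defects)
  show gG: "g \<in> carrier G" and hG: "h \<in> carrier G"
    using assms by (auto simp: Omega_1_iff Omega_c_iff)
  have O: "p g \<in> Omega_1 A" "p h \<in> Omega_1 A" using assms Omega_1_A_iff gG hG by auto
  then have "inv\<^bsub>A\<^esub> (p h) = p h" using A.Omega_1_inv by blast
  then have "p (g \<otimes> inv h) \<in> Omega_1 A"
    using gG hG O by (auto simp: A.Omega_1_iff A.m_assoc A.m_lcomm)
  then show "symm_point A (p g) b + symm_point A (p h) b + symm_point A (p (g \<otimes> inv h)) (b * b) = 0"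
    using assms by (simp add: symm_point_A_eq_0 A.symm_point_Omega_1[OF char_F] del: p.hom_mult)
qed

text \<open>Commuting only up to \<open>c\<close> makes \<open>v \<otimes> g\<close> an element of
  square one, its square being \<open>v \<otimes> v \<otimes> c\<close>. For the points
  \<open>g\<close> and \<open>v \<otimes> g\<close> only the third term survives; it sits at the
  inverse of \<open>v\<close> with coefficient \<open>a * a\<close>, and a square root
  \<open>a\<close> of \<open>b\<close> exists.\<close>

lemma noncommuting_in_defects:
  assumes v: "v \<in> Omega_c G c" and g: "g \<in> Omega_1 G" and ne: "v \<otimes> g \<noteq> g \<otimes> v"
  shows "symm_point G v b \<in> defect ` lifts"
proof -
  have vG: "v \<in> carrier G" "v \<otimes> v = c" and gG: "g \<in> carrier G" "g \<otimes> g = \<one>"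
    using v g by (auto simp: Omega_c_iff Omega_1_iff)
  have "p (v \<otimes> g) = p (g \<otimes> v)" using vG gG by (simp add: A.m_comm)
  then have vg: "v \<otimes> g = g \<otimes> v \<otimes> c" using ne p_eq_iff vG gG by blast
  have "v \<otimes> g \<otimes> (v \<otimes> g) = v \<otimes> g \<otimes> (g \<otimes> v \<otimes> c)" by (simp only: vg)
  also have "\<dots> = v \<otimes> (g \<otimes> g) \<otimes> v \<otimes> c" using vG(1) gG(1) by (simp add: m_assoc)
  also have "\<dots> = \<one>" using vG gG by simp
  finally have vgO: "v \<otimes> g \<in> Omega_1 G" using vG gG by (simp add: Omega_1_iff)
  have inv_v: "g \<otimes> inv (v \<otimes> g) = inv v" using vG gG by (simp add: inv_mult_group)
  obtain a where "a * a = b" using char_F by (rule char2_square_root)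
  then show ?thesis
    using two_involutions_in_defects[of g "v \<otimes> g" a] g vgO vG
    by (simp add: inv_v symm_point_Omega_1[OF char_F] symm_point_inv)
qed

text \<open>Here \<open>w \<otimes> v\<close> has square one, so the points \<open>v\<close> and
  \<open>w \<otimes> v\<close> leave a term \<open>b\<close> at \<open>v\<close> and a term
  \<open>b * b\<close> at the inverse of \<open>w\<close>. For \<open>w = v\<close> the coefficient
  becomes \<open>b + b * b\<close>, which is the origin of the Artin-Schreier condition.\<close>

lemma commuting_in_defects:
  assumes v: "v \<in> Omega_c G c" and w: "w \<in> Omega_c G c" and eq: "v \<otimes> w = w \<otimes> v"
  shows "symm_point G v b + symm_point G w (b * b) \<in> defect ` lifts"
proof -
  have vG: "v \<in> carrier G" "v \<otimes> v = c" and wG: "w \<in> carrier G" "w \<otimes> w = c"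
    using v w by (auto simp: Omega_c_iff)
  have "w \<otimes> v \<otimes> (w \<otimes> v) = w \<otimes> v \<otimes> (v \<otimes> w)" by (simp only: eq)
  also have "\<dots> = w \<otimes> (v \<otimes> v) \<otimes> w" using vG(1) wG(1) by (simp add: m_assoc)
  also have "\<dots> = w \<otimes> w \<otimes> c" using vG wG by (simp add: m_assoc c_central)
  also have "\<dots> = \<one>" using wG by simp
  finally have wvO: "w \<otimes> v \<in> Omega_1 G" using vG wG by (simp add: Omega_1_iff)
  have inv_w: "v \<otimes> inv (w \<otimes> v) = inv w" using vG wG by (simp add: inv_mult_group)
  show ?thesis
    using two_involutions_in_defects[of v "w \<otimes> v" b] v wvO wG
    by (simp add: inv_w symm_point_Omega_1[OF char_F] symm_point_inv)
qed

lemma commuting_with_in_defects: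
  assumes "v \<in> Omega_c G c" "w \<in> Omega_c G c" "v \<otimes> w = w \<otimes> v"
    and "\<And>b. symm_point G w b \<in> defect ` lifts"
  shows "symm_point G v b \<in> defect ` lifts"
proof -
  have "symm_point G v b = (symm_point G v b + symm_point G w (b * b)) + symm_point G w (b * b)"
    by (simp add: add.assoc double)
  then show ?thesis using add_in_defects[OF commuting_in_defects[OF assms(1-3)] assms(4)] by metis
qed

text \<open>The cube of \<open>g\<close> is the inverse of \<open>g \<otimes> c\<close>, so
  \<open>g\<close> and its cube become inverse to each other in A and cancel there. In FG they form
  an element of \<open>orbit_in_defects\<close>; what is left is a freely scaled term at
  \<open>g \<otimes> g\<close>.\<close>

lemma fourth_root_in_defects:
  assumes gG: "g \<in> carrier G" and g4: "(g \<otimes> g) \<otimes> (g \<otimes> g) = c"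
  shows "symm_point G (g \<otimes> g) b \<in> defect ` lifts"
proof -
  obtain a where a: "a * a = b" using char_F by (rule char2_square_root)
  let ?h = "g \<otimes> g \<otimes> g"
  have h: "?h = inv (g \<otimes> c)"
  proof (rule inv_equality[symmetric])
    have "?h \<otimes> (g \<otimes> c) = (g \<otimes> g) \<otimes> (g \<otimes> g) \<otimes> c" using gG by (simp add: m_assoc)
    then show "?h \<otimes> (g \<otimes> c) = \<one>" by (simp add: g4)
  qed (use gG in auto)
  have gh: "g \<otimes> inv ?h = inv (g \<otimes> g)" using gG by (simp add: inv_mult_group m_assoc)
  have "p ?h = inv\<^bsub>A\<^esub> (p g)" unfolding h using gG by simp
  moreover have "symm_point A (p (inv (g \<otimes> g))) (a * a) = (0 :: 'c \<Rightarrow> 'f)"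
  proof (rule symm_point_A_eq_0)
    have "inv (g \<otimes> g) \<otimes> inv (g \<otimes> g) = c" using gG g4 by (simp flip: inv_mult_group add: inv_c)
    then show "inv (g \<otimes> g) \<in> Omega_1 G \<or> inv (g \<otimes> g) \<in> Omega_c G c"
      using gG by (simp add: Omega_c_iff)
  qed
  ultimately have "symm_point G g a + symm_point G ?h a + symm_point G (g \<otimes> inv ?h) (a * a)
      \<in> defect ` lifts"
    using gG by (intro two_points_in_defects)
      (simp_all only: gh A.symm_point_inv[OF p.hom_closed[OF gG]] double add_0_right m_closed)
  then have "symm_point G g a + symm_point G (g \<otimes> c) a + symm_point G (g \<otimes> g) b \<in> defect ` lifts"
    by (simp only: gh a symm_point_inv m_closed gG, simp only: h symm_point_inv m_closed gG c_closed)
  from add_in_defects[OF orbit_in_defects[OF gG, of a] this] show ?thesis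
    by (simp add: double flip: add.assoc)
qed

text \<open>An element of \<open>Omega_c\<close> may commute with all involutions. It is then enough
  that it commutes with a \<open>w\<close> in \<open>Omega_c\<close> that does not, since
  \<open>commuting_in_defects\<close> ties the two together.\<close>

lemma unitary_count_noncommuting:
  assumes "unitary_count A F e"
    and "\<And>v. v \<in> Omega_c G c \<Longrightarrow> \<exists>w\<in>Omega_c G c. v \<otimes> w = w \<otimes> v \<and>
      (\<exists>g\<in>Omega_1 G. w \<otimes> g \<noteq> g \<otimes> w)"
  shows "unitary_count G F e"
proof -
  have "defect ` lifts = symmetric_part"
  proof (rule defects_full)
    fix v b assume v: "v \<in> Omega_c G c"
    from assms(2)[OF v] obtain w g where w: "w \<in> Omega_c G c" "v \<otimes> w = w \<otimes> v"
      and g: "g \<in> Omega_1 G" "w \<otimes> g \<noteq> g \<otimes> w" by blast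
    have w': "symm_point G w b \<in> defect ` lifts" for b
      by (rule noncommuting_in_defects[OF w(1) g])
    show "symm_point G v b \<in> defect ` lifts"
      by (rule commuting_with_in_defects[OF v w w'])
  qed
  then show ?thesis using unitary_count_step[OF assms(1), of 1] by simp
qed

end

section \<open>The Artin-Schreier obstruction\<close>

lemma char2_artin_schreier:
  assumes "CHAR('f::{field,finite}) = 2"
  shows "2 * card (range (\<lambda>t :: 'f. t + t * t)) = CARD('f)"
proof (rule card_uniform_fibers[symmetric, OF finite_class.finite_UNIV])
  fix x :: 'f
  \<comment> \<open>The map is additive with kernel {0, 1}, so its fibers are pairs.\<close>
  have "y + y * y = x + x * x \<longleftrightarrow> y = x \<or> y = x + 1" for y
  proof -
    have "(y + x) * (y + x + 1) = (y + x) * (y + x) + (y + x)"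
      by (simp only: distrib_left[of "y + x" "y + x"] mult_1_right)
    also have "\<dots> = (y + y * y) + (x + x * x)"
      by (simp only: char2_square_add[OF assms] add_ac)
    finally have "y + y * y = x + x * x \<longleftrightarrow> (y + x) * (y + x + 1) = 0"
      using char2_eq_iff[OF assms, of "y + y * y" "x + x * x"] by metis
    then show ?thesis by (simp only: mult_eq_0_iff add.assoc char2_eq_iff[OF assms])
  qed
  then have "{y \<in> UNIV. y + y * y = x + x * x} = {x, x + 1}" by auto
  then show "card {y \<in> UNIV. y + y * y = x + x * x} = 2" by simp
qed

context double_cover
begin

text \<open>\<open>l\<close> adds up the coefficients of the defect along \<open>Omega_c\<close>; that sum is constrained to the
  Artin--Schreier image \<open>t + t * t\<close>, and this is the only constraint.\<close>

lemma unitary_count_artin_schreier: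
  assumes count: "unitary_count A F e"
    and comm: "\<And>v w. v \<in> Omega_c G c \<Longrightarrow> w \<in> Omega_c G c \<Longrightarrow> v \<otimes> w = w \<otimes> v"
    and w: "w \<in> Omega_c G c"
    and l_add: "\<And>x y :: 'a \<Rightarrow> 'f. l (x + y) = l x + l y"
    and l_pt: "\<And>g b. g \<in> Omega_c G c \<Longrightarrow> l (symm_point G g b) = b"
    and l_orb: "\<And>g b. g \<in> carrier G \<Longrightarrow> l (symm_point G g b + symm_point G (g \<otimes> c) b) = 0"
    and l_defect: "\<And>y. y \<in> lifts \<Longrightarrow> l (defect y) \<in> range (\<lambda>t. t + t * t)"
  shows "unitary_count G F (2 * e)"
proof -
  let ?P = "range (\<lambda>t :: 'f. t + t * t)" and ?J = "defect ` lifts"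
  have l0: "l 0 = 0" using l_add[of 0 0] by (metis add_0 char2_double[OF char_F])
  have w_J: "symm_point G w (t + t * t) \<in> ?J" for t
    using commuting_in_defects[OF w w HOL.refl, of t] by (simp add: symm_point_add)
  \<comment> \<open>Modulo defects every symmetric element \<open>z\<close> is congruent to the
    generator at the single element \<open>w\<close>, with coefficient \<open>l z\<close>.\<close>
  have gen: "symmetric_part \<subseteq> {z. z + symm_point G w (l z) \<in> ?J}"
  proof (rule symmetric_part_subset)
    show "0 \<in> {z. z + symm_point G w (l z) \<in> ?J}"
      using zero_in_defects by (simp add: l0 symm_point_def)
    show "x + y \<in> {z. z + symm_point G w (l z) \<in> ?J}"
      if "x \<in> {z. z + symm_point G w (l z) \<in> ?J}" "y \<in> {z. z + symm_point G w (l z) \<in> ?J}" for x y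
    proof -
      have "(x + y) + symm_point G w (l (x + y)) =
          (x + symm_point G w (l x)) + (y + symm_point G w (l y))"
        by (simp add: l_add add_ac flip: symm_point_add)
      then show ?thesis using that by (simp only: mem_Collect_eq) (rule add_in_defects)
    qed
    show "symm_point G g b \<in> {z. z + symm_point G w (l z) \<in> ?J}" if g: "g \<in> Omega_c G c" for g b
    proof -
      have "symm_point G g b + symm_point G w b =
          (symm_point G g b + symm_point G w (b * b)) + symm_point G w (b + b * b)"
        by (simp add: add_ac double flip: symm_point_add)
      then show ?thesis
        using add_in_defects[OF commuting_in_defects[OF g w comm[OF g w]] w_J]
        by (simp only: mem_Collect_eq l_pt[OF g])
    qed
    show "symm_point G g b + symm_point G (g \<otimes> c) b \<in> {z. z + symm_point G w (l z) \<in> ?J}"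
      if "g \<in> carrier G" for g b
      using orbit_in_defects[OF that] l_orb[OF that] by (simp add: symm_point_def)
  qed
  \<comment> \<open>Whether a symmetric element is a defect is thus decided by \<open>l\<close>
    alone.\<close>
  have J: "?J = {z \<in> symmetric_part. l z \<in> ?P}"
  proof (intro equalityI subsetI)
    fix z assume z: "z \<in> {z \<in> symmetric_part. l z \<in> ?P}"
    then have "z + symm_point G w (l z) \<in> ?J" "symm_point G w (l z) \<in> ?J"
      using gen w_J by auto
    then have "(z + symm_point G w (l z)) + symm_point G w (l z) \<in> ?J"
      by (rule add_in_defects)
    then show "z \<in> ?J" by (simp add: add.assoc double)
  qed (use defect_in_symmetric_part l_defect in auto)
  have finS: "finite symmetric_part" using card_symmetric_part by blast
  have fibers: "card {z \<in> symmetric_part. l z = l x} = card {z \<in> symmetric_part. l z = 0}"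
    if x: "x \<in> symmetric_part" for x
  proof -
    have "bij_betw ((+) x) {z \<in> symmetric_part. l z = 0} {z \<in> symmetric_part. l z = l x}"
      by (rule bij_betw_byWitness[where f' = "(+) x"])
        (use x in \<open>auto simp: double l_add char2_two[OF char_F] intro!: symmetric_part_add\<close>)
    then show ?thesis by (rule bij_betw_same_card[symmetric])
  qed
  have S_w: "symm_point G w b \<in> symmetric_part" for b by (rule symm_point_in_symmetric_part[OF w])
  have "l ` symmetric_part = UNIV"
    using S_w l_pt[OF w] by (metis (no_types, lifting) UNIV_eq_I image_eqI)
  then have S: "card symmetric_part = card {z \<in> symmetric_part. l z = 0} * CARD('f)"
    using card_uniform_fibers[OF finS fibers] by simp
  have "card ?J = card {z \<in> symmetric_part. l z = 0} * card (l ` ?J)"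
  proof (rule card_uniform_fibers)
    show "finite ?J" using finite_lifts by simp
    fix x assume x: "x \<in> ?J"
    then have "{z \<in> ?J. l z = l x} = {z \<in> symmetric_part. l z = l x}" unfolding J by auto
    then show "card {z \<in> ?J. l z = l x} = card {z \<in> symmetric_part. l z = 0}"
      using fibers x unfolding J by simp
  qed
  moreover have "l ` ?J = ?P"
  proof (intro equalityI subsetI)
    fix b assume "b \<in> ?P"
    then obtain t where "b = l (symm_point G w (t + t * t))" using l_pt[OF w] by auto
    then show "b \<in> l ` ?J" using w_J by blast
  qed (use l_defect in auto)
  \<comment> \<open>Both sets are unions of fibers of \<open>l\<close> of equal size; on one of them
    \<open>l\<close> takes all values, on the other half of them.\<close>
  ultimately have "2 * card ?J = card symmetric_part"
    using char2_artin_schreier[OF char_F] S by simp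
  then show ?thesis by (rule unitary_count_step[OF count])
qed

end

section \<open>Abelian groups\<close>

text \<open>All elements have square one, so \<open>x\<close> times \<open>star G x\<close> is
  concentrated at the identity, with the squared augmentation as its value. Hence unitary means
  augmentation 1.\<close>

lemma (in finite_group) unitary_count_elementary:
  assumes "CHAR('f::{field,finite}) = 2" and el: "\<And>g. g \<in> carrier G \<Longrightarrow> g \<otimes> g = \<one>"
  shows "unitary_count G (F :: 'f itself) 1"
proof -
  let ?s = "\<lambda>x :: 'a \<Rightarrow> 'f. \<Sum>g\<in>carrier G. x g"
  have Om: "Omega_1 G = carrier G" using el by (auto simp: Omega_1_iff)
  have U: "unitary G = {x \<in> coeffs G. ?s x = 1}"
  proof (intro equalityI subsetI)
    fix x assume x: "x \<in> {x \<in> coeffs G. ?s x = 1}"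
    have "conv G x (star G x) = point \<one> 1"
    proof (rule coeffs_eqI[of _ G])
      fix g assume "g \<in> carrier G"
      then show "conv G x (star G x) g = point \<one> 1 g"
        using conv_star_one[OF assms(1), of x] conv_star_involution[OF assms(1), of g x] x
        by (cases "g = \<one>") (auto simp: Om point_def)
    qed auto
    then show "x \<in> unitary G" using x by (simp add: unitary_def)
  qed (use sum_unitary[OF assms(1)] in \<open>auto simp: unitary_def\<close>)
  have s_pt: "?s (x + point \<one> b) = ?s x + b" for x b
    using fin by (simp add: sum.distrib point_def)
  have "card (coeffs G :: ('a \<Rightarrow> 'f) set) = card (unitary G :: ('a \<Rightarrow> 'f) set) * card (?s ` coeffs G)"
  proof (rule card_uniform_fibers)
    fix x :: "'a \<Rightarrow> 'f"
    \<comment> \<open>Changing the coefficient at the identity moves the augmentation from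
      \<open>?s x\<close> to 1; in characteristic two the same change moves it back.\<close>
    let ?t = "\<lambda>z. z + point \<one> (?s x + 1)"
    have "bij_betw ?t {y \<in> coeffs G. ?s y = ?s x} (unitary G)"
      unfolding U
      by (rule bij_betw_byWitness[where f' = ?t])
        (auto simp: s_pt add.assoc point_add char2_two[OF assms(1)] char2_double[OF assms(1)]
          simp flip: mult_2 simp del: plus_fun_apply intro!: coeffs_add)
    then show "card {y \<in> coeffs G. ?s y = ?s x} = card (unitary G :: ('a \<Rightarrow> 'f) set)"
      by (rule bij_betw_same_card)
  qed (rule finite_coeffs(1)[OF fin])
  moreover have "?s ` coeffs G = UNIV"
  proof -
    have "b \<in> ?s ` coeffs G" for b
      using s_pt[of 0 b] by (intro image_eqI[of _ _ "point \<one> b"]) auto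
    then show ?thesis by blast
  qed
  ultimately show ?thesis
    using finite_coeffs(2)[OF fin, where ?'f = 'f]
    by (simp add: unitary_count_def Om order_def mult.commute flip: mult_2)
qed

lemma mod_power_eq_0_iff:
  assumes "0 \<le> i" "i < 2 ^ (n + 1)"
  shows "i mod 2 ^ n = 0 \<longleftrightarrow> i = 0 \<or> i = (2 ^ n :: int)"
proof (cases "i < 2 ^ n")
  case False
  then have "i mod 2 ^ n = (i - 2 ^ n) mod 2 ^ n" by simp
  also have "\<dots> = i - 2 ^ n" using False assms by (intro mod_pos_pos_trivial) auto
  finally show ?thesis using False assms by auto
qed (use assms in auto)

lemma carrier_Z2n: "carrier (integer_mod_group (2 ^ n)) = {0..<2 ^ n}"
  by (simp add: carrier_integer_mod_group)

section \<open>Adjoining a cyclic factor of order 2^n\<close>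

locale finite_comm_group = comm_group G for G (structure) +
  assumes fin: "finite (carrier G)"
begin

sublocale finite_group G by unfold_locales (rule fin)

lemma finite_comm_group_Z2n: "finite_comm_group (G \<times>\<times> integer_mod_group (2 ^ n))"
proof -
  interpret Z: comm_group "integer_mod_group (2 ^ n)" by simp
  interpret P: group "G \<times>\<times> integer_mod_group (2 ^ n)"
    by (rule DirProd_group) (rule is_group, rule Z.is_group)
  have "comm_group (G \<times>\<times> integer_mod_group (2 ^ n))"
    by (rule P.group_comm_groupI) (auto simp: m_comm Z.m_comm simp del: mult_integer_mod_group)
  then show ?thesis
    using fin by (simp add: finite_comm_group_def finite_comm_group_axioms_def carrier_Z2n)
qed

lemma double_cover_fst:
  assumes "CHAR('f::{field,finite}) = 2"
  shows "double_cover TYPE('f) (G \<times>\<times> integer_mod_group (2 ^ 1)) G fst (\<one>, 1)"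
proof -
  interpret Z: finite_comm_group "G \<times>\<times> integer_mod_group (2 ^ 1)" by (rule finite_comm_group_Z2n)
  show ?thesis
  proof
    show "fst \<in> hom (G \<times>\<times> integer_mod_group (2 ^ 1)) G" by (auto simp: hom_def)
    show "fst ` carrier (G \<times>\<times> integer_mod_group (2 ^ 1)) = carrier G"
      by (auto simp: carrier_integer_mod_group image_iff)
  qed (use assms in \<open>auto simp: carrier_integer_mod_group\<close>)
qed

lemma double_cover_Z2n:
  assumes "CHAR('f::{field,finite}) = 2"
  shows "double_cover TYPE('f) (G \<times>\<times> integer_mod_group (2 ^ Suc n)) (G \<times>\<times> integer_mod_group (2 ^ n))
    (\<lambda>(g, j). (g, j mod 2 ^ n)) (\<one>, 2 ^ n)"
proof -
  interpret Z: finite_comm_group "G \<times>\<times> integer_mod_group (2 ^ Suc n)" by (rule finite_comm_group_Z2n)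
  interpret Y: finite_comm_group "G \<times>\<times> integer_mod_group (2 ^ n)" by (rule finite_comm_group_Z2n)
  let ?p = "\<lambda>(g, j :: int). (g, j mod 2 ^ n)"
  show ?thesis
  proof
    have "(a mod (2 * 2 ^ n)) mod 2 ^ n = a mod 2 ^ n" for a :: int
      by (simp add: mod_mod_cancel)
    then show "?p \<in> hom (G \<times>\<times> integer_mod_group (2 ^ Suc n)) (G \<times>\<times> integer_mod_group (2 ^ n))"
      by (auto simp: hom_def carrier_Z2n mod_add_eq)
    show "?p ` carrier (G \<times>\<times> integer_mod_group (2 ^ Suc n)) = carrier (G \<times>\<times> integer_mod_group (2 ^ n))"
    proof (intro equalityI subsetI)
      fix x assume x: "x \<in> carrier (G \<times>\<times> integer_mod_group (2 ^ n))"
      then have "?p x = x" "x \<in> carrier (G \<times>\<times> integer_mod_group (2 ^ Suc n))"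
        by (auto simp: carrier_Z2n carrier_integer_mod_group)
      then show "x \<in> ?p ` carrier (G \<times>\<times> integer_mod_group (2 ^ Suc n))" by (metis image_eqI)
    qed (auto simp: carrier_Z2n carrier_integer_mod_group)
    fix x assume x: "x \<in> carrier (G \<times>\<times> integer_mod_group (2 ^ Suc n))"
    obtain g j where gj: "x = (g, j)" "0 \<le> j" "j < 2 * 2 ^ n"
      using x by (auto simp: carrier_integer_mod_group)
    have "j mod 2 ^ n = 0 \<longleftrightarrow> j = 0 \<or> j = 2 ^ n" using gj by (intro mod_power_eq_0_iff) auto
    then show "?p x = \<one>\<^bsub>G \<times>\<times> integer_mod_group (2 ^ n)\<^esub> \<longleftrightarrow>
        x = \<one>\<^bsub>G \<times>\<times> integer_mod_group (2 ^ Suc n)\<^esub> \<or> x = (\<one>, 2 ^ n)"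
      by (auto simp: gj)
  qed (use assms in \<open>auto simp: carrier_integer_mod_group\<close>)
qed

text \<open>The element \<open>(\<one>, 1)\<close> is not a square, so \<open>Omega_c\<close> is
  empty and the condition on its elements holds vacuously.\<close>

lemma unitary_count_Z2:
  assumes "CHAR('f::{field,finite}) = 2" "unitary_count G (F :: 'f itself) e"
  shows "unitary_count (G \<times>\<times> integer_mod_group (2 ^ 1)) F e"
proof -
  interpret D: double_cover "G \<times>\<times> integer_mod_group (2 ^ 1)" G fst "(\<one>, 1)" F
    by (rule double_cover_fst[OF assms(1)])
  have "v \<notin> Omega_c (G \<times>\<times> integer_mod_group (2 ^ 1)) (\<one>, 1)" for v
    by (cases v) (simp only: D.Omega_c_iff; auto; presburger)
  then show ?thesis by (intro D.unitary_count_noncommuting[OF assms(2)]) simp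
qed

text \<open>For \<open>n \<ge> 2\<close> the element \<open>2 ^ n\<close> of the cyclic factor is
  four times \<open>2 ^ (n - 2)\<close>. By this fourth root the generators at
  \<open>2 ^ (n - 1)\<close> are defects, and commutativity extends this to all of
  \<open>Omega_c\<close>.\<close>

lemma unitary_count_Z2n:
  assumes "CHAR('f::{field,finite}) = 2" "n \<ge> 2"
    and "unitary_count (G \<times>\<times> integer_mod_group (2 ^ n)) (F :: 'f itself) e"
  shows "unitary_count (G \<times>\<times> integer_mod_group (2 ^ Suc n)) F e"
proof -
  interpret D: double_cover "G \<times>\<times> integer_mod_group (2 ^ Suc n)" "G \<times>\<times> integer_mod_group (2 ^ n)"
      "\<lambda>(g, j). (g, j mod 2 ^ n)" "(\<one>, 2 ^ n)" F
    by (rule double_cover_Z2n[OF assms(1)])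
  interpret C: finite_comm_group "G \<times>\<times> integer_mod_group (2 ^ Suc n)" by (rule finite_comm_group_Z2n)
  obtain k where n: "n = k + 2" using assms(2) by (metis le_add_diff_inverse2)
  let ?g = "(\<one>, 2 ^ k) :: 'a \<times> int"
  have g: "?g \<in> carrier (G \<times>\<times> integer_mod_group (2 ^ Suc n))"
    by (simp add: carrier_integer_mod_group n)
  let ?w = "?g \<otimes>\<^bsub>G \<times>\<times> integer_mod_group (2 ^ Suc n)\<^esub> ?g"
  have "2 ^ k + 2 ^ k = (2 * 2 ^ k :: int)" "(2 * 2 ^ k :: int) mod (2 * 2 ^ n) = 2 * 2 ^ k"
    by (simp_all add: n)
  then have "?w = (\<one>, 2 * 2 ^ k)" by simp
  moreover have "(2 * 2 ^ k + 2 * 2 ^ k) mod (2 * 2 ^ n) = (2 ^ n :: int)"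
    by (simp add: n)
  ultimately have g4: "?w \<otimes>\<^bsub>G \<times>\<times> integer_mod_group (2 ^ Suc n)\<^esub> ?w = (\<one>, 2 ^ n)" by simp
  have w: "?w \<in> Omega_c (G \<times>\<times> integer_mod_group (2 ^ Suc n)) (\<one>, 2 ^ n)"
    using g4 D.m_closed[OF g g] by (simp only: D.Omega_c_iff)
  have "D.defect ` D.lifts = D.symmetric_part"
  proof (rule D.defects_full)
    fix v b assume v: "v \<in> Omega_c (G \<times>\<times> integer_mod_group (2 ^ Suc n)) (\<one>, 2 ^ n)"
    show "symm_point (G \<times>\<times> integer_mod_group (2 ^ Suc n)) v b \<in> D.defect ` D.lifts"
      by (rule D.commuting_with_in_defects[OF v w _ D.fourth_root_in_defects[OF g g4]])
        (use v w in \<open>auto simp only: D.Omega_c_iff intro: C.m_comm\<close>)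
  qed
  then show ?thesis using D.unitary_count_step[OF assms(3), of 1] by simp
qed

end

context finite_comm_group
begin

text \<open>In a cyclic factor of order four the element \<open>c\<close> has a square root but no
  fourth root. The functional \<open>l\<close> shows that the coefficients \<open>t + t * t\<close>
  are then a genuine restriction: on defects it depends only on the sums of \<open>y\<close> over
  the four layers given by the second coordinate.\<close>

lemma unitary_count_Z4:
  assumes char: "CHAR('f::{field,finite}) = 2"
    and count: "unitary_count (G \<times>\<times> integer_mod_group (2 ^ 1)) (F :: 'f itself) e"
  shows "unitary_count (G \<times>\<times> integer_mod_group (2 ^ Suc 1)) F (2 * e)"
proof -
  let ?H = "G \<times>\<times> integer_mod_group (2 ^ Suc 1)"
  interpret D: double_cover ?H "G \<times>\<times> integer_mod_group (2 ^ 1)"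
      "\<lambda>(g, j). (g, j mod 2 ^ 1)" "(\<one>, 2 ^ 1)" F
    by (rule double_cover_Z2n[OF char])
  interpret C: finite_comm_group ?H by (rule finite_comm_group_Z2n)
  have H: "(g, j) \<in> carrier ?H \<longleftrightarrow> g \<in> carrier G \<and> 0 \<le> j \<and> j < 4" for g j
    by (auto simp: carrier_integer_mod_group)
  have inv_H: "inv\<^bsub>?H\<^esub> (g, j) = (inv g, (- j) mod 4)" if "g \<in> carrier G" "0 \<le> j" "j < 4" for g j
    using that by (subst inv_DirProd) (auto simp: carrier_integer_mod_group is_group)
  \<comment> \<open>Inversion exchanges the layers 1 and 3, so a symmetric point with odd second
    coordinate is counted exactly once, and the even layers are not seen.\<close>
  define l where "l z = (\<Sum>g\<in>carrier G. z (g, 1))" for z :: "'a \<times> int \<Rightarrow> 'f"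
  have l_symm: "l (symm_point ?H (g, j) b) = (if j = 1 then b else 0) + (if j = 3 then b else 0)"
    if gj: "(g, j) \<in> carrier ?H" for g j b
  proof -
    have j: "g \<in> carrier G" "0 \<le> j" "j < 4" using gj H by auto
    then have "(- j) mod 4 = 1 \<longleftrightarrow> j = 3" by presburger
    moreover have "symm_point ?H (g, j) b (h, 1) =
        (if h = g then if j = 1 then b else 0 else 0) +
        (if h = inv g then if (- j) mod 4 = 1 then b else 0 else 0)" for h
      unfolding symm_point_def inv_H[OF j] point_def by auto
    ultimately show ?thesis using j fin by (simp add: l_def sum.distrib)
  qed
  show ?thesis
  proof (rule D.unitary_count_artin_schreier[OF count])
    show "v \<otimes>\<^bsub>?H\<^esub> w = w \<otimes>\<^bsub>?H\<^esub> v" if "v \<in> Omega_c ?H (\<one>, 2 ^ 1)" "w \<in> Omega_c ?H (\<one>, 2 ^ 1)" for v w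
      using that by (simp only: D.Omega_c_iff C.m_comm)
    have "(\<one>, 1) \<in> carrier ?H" by (simp only: H) simp
    then show "(\<one>, 1) \<in> Omega_c ?H (\<one>, 2 ^ 1)" by (simp only: D.Omega_c_iff) simp
    show "l (x + y) = l x + l y" for x y by (simp add: l_def sum.distrib)
    show "l (symm_point ?H v b) = b" if v: "v \<in> Omega_c ?H (\<one>, 2 ^ 1)" for v b
    proof -
      obtain g j where vj: "v = (g, j)" by (cases v)
      have vH: "(g, j) \<in> carrier ?H" "v \<otimes>\<^bsub>?H\<^esub> v = (\<one>, 2 ^ 1)"
        using v vj by (simp_all only: D.Omega_c_iff)
      have "(j + j) mod 4 = 2" using vH(2) vj by simp
      moreover have "0 \<le> j" "j < 4" using vH(1) H by auto
      ultimately have "j = 1 \<or> j = 3" by presburger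
      then show ?thesis using l_symm[OF vH(1), of b] unfolding vj by auto
    qed
    show "l (symm_point ?H v b + symm_point ?H (v \<otimes>\<^bsub>?H\<^esub> (\<one>, 2 ^ 1)) b) = 0" if v: "v \<in> carrier ?H" for v b
    proof -
      obtain g j where vj: "v = (g, j)" by (cases v)
      have j: "g \<in> carrier G" "0 \<le> j" "j < 4" using v vj H by auto
      have vc: "v \<otimes>\<^bsub>?H\<^esub> (\<one>, 2 ^ 1) = (g, (j + 2) mod 4)" using vj j by simp
      have "(g, j) \<in> carrier ?H" "(g, (j + 2) mod 4) \<in> carrier ?H" using j by (simp_all only: H, simp_all)
      moreover have "l (symm_point ?H (g, j) b + symm_point ?H (g, (j + 2) mod 4) b) =
          l (symm_point ?H (g, j) b) + l (symm_point ?H (g, (j + 2) mod 4) b)"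
        by (simp add: l_def sum.distrib)
      moreover have "j = 0 \<or> j = 1 \<or> j = 2 \<or> j = 3" using j by presburger
      ultimately show ?thesis
        unfolding vc vj using char2_double[OF char, of b] by (auto simp only: l_symm) simp_all
    qed
    show "l (D.defect y) \<in> range (\<lambda>t. t + t * t)" if y: "y \<in> D.lifts" for y
    proof -
      define s where "s j = (\<Sum>g\<in>carrier G. y (g, j))" for j :: int
      have carrier_H: "carrier ?H = carrier G \<times> {0, 1, 2, 3}" by (auto simp: carrier_integer_mod_group)
      have sum_H: "(\<Sum>h\<in>carrier ?H. f h) = (\<Sum>j\<in>{0, 1, 2, 3}. \<Sum>g\<in>carrier G. f (g, j))"
        for f :: "'a \<times> int \<Rightarrow> 'f"
      proof -
        have "(\<Sum>h\<in>carrier ?H. f h) = (\<Sum>g\<in>carrier G. \<Sum>j\<in>{0, 1, 2, 3}. f (g, j))"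
          unfolding carrier_H sum.cartesian_product by (simp only: case_prod_eta)
        then show ?thesis by (simp only: sum.swap[of _ "{0, 1, 2, 3}"])
      qed
      have "sum y (carrier ?H) = 1"
        using y by (rule D.sum_lift)
      moreover have "sum y (carrier ?H) = (\<Sum>j\<in>{0, 1, 2, 3}. s j)"
        by (simp only: sum_H s_def)
      ultimately have s1: "s 0 + s 1 + s 2 + s 3 = 1" by (simp add: add.assoc)
      \<comment> \<open>The identity lies in layer 0, so the summand \<open>point\<close> of the
        defect drops out.\<close>
      have "l (D.defect y) = (\<Sum>g\<in>carrier G. conv ?H y (star ?H y) (g, 1))"
        unfolding l_def D.defect_def by (simp add: point_def)
      also have "\<dots> = (\<Sum>g\<in>carrier G. \<Sum>h\<in>carrier ?H. y h * y (inv\<^bsub>?H\<^esub> (g, 1) \<otimes>\<^bsub>?H\<^esub> h))"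
        by (rule sum.cong[OF HOL.refl], rule D.conv_star_apply) (simp only: H, simp)
      also have "\<dots> = (\<Sum>h\<in>carrier ?H. \<Sum>g\<in>carrier G. y h * y (inv\<^bsub>?H\<^esub> (g, 1) \<otimes>\<^bsub>?H\<^esub> h))"
        by (rule sum.swap)
      \<comment> \<open>Summation over the first coordinate reduces the autocorrelation to one on
        the cyclic group of order four, with the layer sums as coefficients.\<close>
      also have "\<dots> = (\<Sum>h\<in>carrier ?H. y h * s ((snd h - 1) mod 4))"
      proof (rule sum.cong[OF HOL.refl])
        fix h assume h: "h \<in> carrier ?H"
        obtain k j where hj: "h = (k, j)" "k \<in> carrier G" "0 \<le> j" "j < 4"
          using h H by (cases h) auto
        have "inv\<^bsub>?H\<^esub> (g, 1) \<otimes>\<^bsub>?H\<^esub> h = (inv g \<otimes> k, (j - 1) mod 4)" if "g \<in> carrier G" for g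
          using that hj by (simp add: inv_H) presburger
        then have "(\<Sum>g\<in>carrier G. y h * y (inv\<^bsub>?H\<^esub> (g, 1) \<otimes>\<^bsub>?H\<^esub> h)) =
            y h * (\<Sum>g\<in>carrier G. y (inv g \<otimes> k, (j - 1) mod 4))"
          by (simp add: sum_distrib_left)
        also have "(\<Sum>g\<in>carrier G. y (inv g \<otimes> k, (j - 1) mod 4)) = s ((j - 1) mod 4)"
          unfolding s_def by (rule sum_inv_shift[OF hj(2)])
        finally show "(\<Sum>g\<in>carrier G. y h * y (inv\<^bsub>?H\<^esub> (g, 1) \<otimes>\<^bsub>?H\<^esub> h)) =
            y h * s ((snd h - 1) mod 4)" by (simp add: hj)
      qed
      also have "\<dots> = (\<Sum>j\<in>{0, 1, 2, 3}. \<Sum>g\<in>carrier G. y (g, j) * s ((j - 1) mod 4))"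
        by (simp only: sum_H snd_conv)
      also have "\<dots> = (\<Sum>j\<in>{0, 1, 2, 3}. s j * s ((j - 1) mod 4))"
        by (simp add: s_def sum_distrib_right)
      also have "\<dots> = s 0 * s 3 + s 1 * s 0 + s 2 * s 1 + s 3 * s 2"
        by (simp add: add.assoc)
      \<comment> \<open>Every product pairs an even layer with an odd one. Augmentation 1 then
        expresses the result by \<open>t = s 1 + s 3\<close> alone, as
        \<open>(1 + t) * t\<close>.\<close>
      also have "\<dots> = (s 0 + s 2) * (s 1 + s 3)" by (simp add: algebra_simps)
      also have "s 0 + s 2 = 1 + (s 1 + s 3)"
        using s1 char2_eq_iff[OF char, of "s 0 + s 2" "1 + (s 1 + s 3)"]
        by (simp add: add_ac char2_two[OF char])
      finally have "l (D.defect y) = (s 1 + s 3) + (s 1 + s 3) * (s 1 + s 3)"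
        by (simp only: distrib_right mult_1_left)
      then show ?thesis by (rule range_eqI)
    qed
  qed
qed

text \<open>The factor 2 is picked up once, on the way from order two to order four; order two
  itself and all orders from eight on add nothing.\<close>

lemma unitary_count_cyclic:
  assumes "CHAR('f::{field,finite}) = 2" "n \<ge> 1" "unitary_count G (F :: 'f itself) e"
  shows "unitary_count (G \<times>\<times> integer_mod_group (2 ^ n)) F ((if n \<ge> 2 then 2 else 1) * e)"
  using assms(2)
proof (induction n rule: nat_induct_at_least)
  case base
  show ?case using unitary_count_Z2[OF assms(1,3)] by simp
next
  case (Suc n)
  show ?case
  proof (cases "n = 1")
    case True
    then show ?thesis using unitary_count_Z4[OF assms(1), of F e] Suc.IH by simp
  next
    case False
    with Suc.hyps have "n \<ge> 2" by simp
    then show ?thesis using unitary_count_Z2n[OF assms(1)] Suc.IH by simp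
  qed
qed

end

section \<open>The presented groups\<close>

lemma word_eq_context: "word_eq R u v \<Longrightarrow> word_eq R (p @ u @ q) (p @ v @ q)"
proof (induction rule: word_eq.induct)
  case (cancel p' x e q')
  show ?case using word_eq.cancel[of R "p @ p'" x e "q' @ q"] by simp
next
  case (relation l r p' q')
  then show ?case using word_eq.relation[of l r R "p @ p'" "q' @ q"] by simp
qed (auto intro: word_eq.intros)

lemma word_eq_append: "word_eq R u u' \<Longrightarrow> word_eq R v v' \<Longrightarrow> word_eq R (u @ v) (u' @ v')"
  using word_eq_context[of R u u' "[]" v] word_eq_context[of R v v' u' "[]"]
  by (auto intro: word_eq.trans)

lemma word_eq_relation: "(l, r) \<in> R \<Longrightarrow> word_eq R l r"
  using word_eq.relation[of l r R "[]" "[]"] by simp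

definition word_class :: "('x word \<times> 'x word) set \<Rightarrow> 'x word \<Rightarrow> 'x word set" where
  "word_class R w = {v. word_eq R w v}"

lemma word_class_eq_iff: "word_class R u = word_class R v \<longleftrightarrow> word_eq R u v"
  unfolding word_class_def by (blast intro: word_eq.intros)

lemma presented_group_carrier: "carrier (presented_group R) = range (word_class R)"
  by (auto simp: presented_group_def quotient_def word_class_def)

lemma presented_group_one: "\<one>\<^bsub>presented_group R\<^esub> = word_class R []"
  by (simp add: presented_group_def word_class_def)

lemma presented_group_mult:
  "word_class R u \<otimes>\<^bsub>presented_group R\<^esub> word_class R v = word_class R (u @ v)"
proof -
  have "word_eq R (u @ v) w" if "word_eq R u u'" "word_eq R v v'" "word_eq R (u' @ v') w" for u' v' w
    using that word_eq_append word_eq.trans by blast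
  then show ?thesis by (auto simp: presented_group_def word_class_def intro: word_eq.refl)
qed

text \<open>Since \<open>ev\<close> is onto and separates exactly the inequivalent words, the group
  structure can be taken from H: an inverse is the class of any word with the inverse value.\<close>

lemma presented_group_iso:
  assumes "group H" and ev: "\<And>u v. ev (u @ v) = ev u \<otimes>\<^bsub>H\<^esub> ev v" "range ev = carrier H"
    and ev_eq: "\<And>u v. ev u = ev v \<longleftrightarrow> word_eq R u v"
  shows "group (presented_group R)" "presented_group R \<cong> H"
proof -
  interpret H: group H by fact
  have ev_H: "ev u \<in> carrier H" for u using ev(2) by blast
  have "ev [] \<otimes>\<^bsub>H\<^esub> ev [] = ev []" using ev(1)[of "[]" "[]"] by simp
  then have ev_Nil: "ev [] = \<one>\<^bsub>H\<^esub>" using ev_H by simp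
  show "group (presented_group R)"
  proof (rule groupI)
    fix x assume "x \<in> carrier (presented_group R)"
    then obtain u where u: "x = word_class R u" by (auto simp: presented_group_carrier)
    obtain v where "ev v = inv\<^bsub>H\<^esub> (ev u)" using ev(2) ev_H by (metis H.inv_closed imageE)
    then have "word_eq R (v @ u) []" using ev_H by (simp add: ev ev_Nil flip: ev_eq)
    then show "\<exists>y\<in>carrier (presented_group R). y \<otimes>\<^bsub>presented_group R\<^esub> x = \<one>\<^bsub>presented_group R\<^esub>"
      unfolding u presented_group_carrier presented_group_one
      by (intro bexI[of _ "word_class R v"]) (auto simp: presented_group_mult word_class_eq_iff)
  qed (auto simp: presented_group_carrier presented_group_one presented_group_mult)
  define f where "f C = ev (SOME w. word_class R w = C)" for C
  have f: "f (word_class R w) = ev w" for w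
  proof -
    have "word_class R (SOME v. word_class R v = word_class R w) = word_class R w"
      by (rule someI) (rule HOL.refl)
    then show ?thesis by (simp add: f_def ev_eq word_class_eq_iff)
  qed
  have "f \<in> iso (presented_group R) H"
  proof (rule isoI)
    show "f \<in> hom (presented_group R) H"
      by (auto simp: hom_def presented_group_carrier presented_group_mult f ev ev_H)
    show "bij_betw f (carrier (presented_group R)) (carrier H)"
      unfolding bij_betw_def presented_group_carrier
      by (auto simp: inj_on_def f ev_eq word_class_eq_iff image_image ev(2)[symmetric])
  qed
  then show "presented_group R \<cong> H" by (rule is_isoI)
qed

section \<open>Evaluation of words in a group\<close>

context group
begin

definition eval_word :: "('x \<Rightarrow> 'a) \<Rightarrow> 'x word \<Rightarrow> 'a" where
  "eval_word f w = foldr (\<lambda>(x, e) g. (if e then f x else inv f x) \<otimes> g) w \<one>"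

lemma eval_word_simps [simp]:
  "eval_word f [] = \<one>"
  "eval_word f ((x, True) # w) = f x \<otimes> eval_word f w"
  "eval_word f ((x, False) # w) = inv f x \<otimes> eval_word f w"
  by (simp_all add: eval_word_def)

lemma eval_word_closed [simp]:
  assumes "range f \<subseteq> carrier G" shows "eval_word f w \<in> carrier G"
proof (induction w)
  case (Cons l w)
  then show ?case using assms by (cases l; cases "snd l") auto
qed simp

lemma eval_word_append:
  assumes "range f \<subseteq> carrier G"
  shows "eval_word f (u @ v) = eval_word f u \<otimes> eval_word f v"
proof (induction u)
  case (Cons l u)
  moreover have "f (fst l) \<in> carrier G" using assms by auto
  ultimately show ?case using assms by (cases l; cases "snd l") (auto simp: m_assoc)
qed (use assms in simp)

text \<open>Soundness of the word calculus: values for the generators that respect the relations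
  induce a map on the presented group.\<close>

lemma eval_word_eq:
  assumes "range f \<subseteq> carrier G" "\<And>l r. (l, r) \<in> R \<Longrightarrow> eval_word f l = eval_word f r"
  shows "word_eq R u v \<Longrightarrow> eval_word f u = eval_word f v"
proof (induction rule: word_eq.induct)
  case (cancel p x e q)
  have "f x \<in> carrier G" using assms(1) by auto
  then have "eval_word f [(x, e), (x, \<not> e)] = \<one>" by (cases e) simp_all
  then show ?case
    using assms(1) eval_word_append[OF assms(1), of "[(x, e), (x, \<not> e)]" q]
    by (simp add: eval_word_append)
next
  case (relation l r p q)
  then show ?case using assms by (simp add: eval_word_append)
qed simp_all

lemma eval_word_replicate:
  assumes "f x \<in> carrier G"
  shows "eval_word f (replicate i (x, True)) = f x [^] i"
proof (induction i)
  case (Suc i)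
  then show ?case using nat_pow_Suc2[OF assms, of i] by simp
qed simp

end

section \<open>A concrete model of the groups generated by a and b\<close>

text \<open>\<open>pair_group n s\<close> models \<open>\<langle>a, b | a\<^bsup>2^(n+1)\<^esup> = 1, b\<^sup>2 = a\<^bsup>s 2^n\<^esup>, a\<^sup>b = a\<^bsup>1+2^n\<^esup>\<rangle>\<close>; the pair \<open>(i, j)\<close> stands
  for \<open>a\<^sup>i b\<^sup>j\<close>.\<close>

definition pair_group :: "nat \<Rightarrow> int \<Rightarrow> (int \<times> int) monoid" where
  "pair_group n s =
    \<lparr>carrier = {0..<2 ^ (n + 1)} \<times> {0..<2},
     monoid.mult = (\<lambda>x y. ((fst x + fst y + 2 ^ n * (snd x * fst y + s * (snd x * snd y))) mod 2 ^ (n + 1),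
       (snd x + snd y) mod 2)),
     one = (0, 0)\<rparr>"

lemma pair_group_simps [simp]:
  "carrier (pair_group n s) = {0..<2 ^ (n + 1)} \<times> {0..<2}"
  "(i, j) \<otimes>\<^bsub>pair_group n s\<^esub> (i', j') =
    ((i + i' + 2 ^ n * (j * i' + s * (j * j'))) mod 2 ^ (n + 1), (j + j') mod 2)"
  "\<one>\<^bsub>pair_group n s\<^esub> = (0, 0)"
  by (simp_all add: pair_group_def)

lemma group_pair_group:
  assumes "n \<ge> 1" shows "group (pair_group n s)"
proof (rule groupI)
  fix x y z assume "x \<in> carrier (pair_group n s)" "y \<in> carrier (pair_group n s)" "z \<in> carrier (pair_group n s)"
  obtain i j i' j' i'' j'' where xyz: "x = (i, j)" "y = (i', j')" "z = (i'', j'')"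
    by (cases x; cases y; cases z)
  define t P N :: int where "t = 2 ^ (n - 1)" and "P = 2 ^ n" and "N = 2 ^ (n + 1)"
  have P: "P = 2 * t" and N: "N = 2 * P"
    using assms by (auto simp: t_def P_def N_def simp flip: power_Suc)
  define C where "C = i' + i'' + P * (j' * i'' + s * (j' * j''))"
  define u w b where "u = (j + j') div 2" and "w = (j' + j'') div 2" and "b = C div N"
  have u: "(j + j') mod 2 = j + j' - 2 * u" and w: "(j' + j'') mod 2 = j' + j'' - 2 * w"
    and b: "C mod N = C - N * b"
    by (simp_all only: u_def w_def b_def minus_mult_div_eq_mod)
  have "((i + i' + P * (j * i' + s * (j * j'))) mod N + i'' +
        P * ((j + j') mod 2 * i'' + s * ((j + j') mod 2 * j''))) mod N =
      (i + C mod N + P * (j * (C mod N) + s * (j * ((j' + j'') mod 2)))) mod N"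
  proof -
    \<comment> \<open>The difference of the two sides is an explicit multiple of \<open>N\<close>:
      \<open>b\<close>, \<open>u\<close> and \<open>w\<close> are the carries of the reductions, and
      a product of two twists is divisible by \<open>N\<close> because \<open>P * P = N * t\<close>.
      This is where \<open>n \<ge> 1\<close> enters.\<close>
    have "(i + i' + P * (j * i' + s * (j * j')) + i'' +
        P * ((j + j' - 2 * u) * i'' + s * ((j + j' - 2 * u) * j''))) -
      (i + (C - N * b) + P * (j * (C - N * b) + s * (j * (j' + j'' - 2 * w)))) =
      N * (b * (1 + P * j) + s * j * w - u * (i'' + s * j'') - t * j * (j' * i'' + s * (j' * j'')))"
      unfolding C_def N P by (simp add: algebra_simps)
    then have "N dvd (i + i' + P * (j * i' + s * (j * j')) + i'' +
        P * ((j + j' - 2 * u) * i'' + s * ((j + j' - 2 * u) * j''))) -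
      (i + (C - N * b) + P * (j * (C - N * b) + s * (j * (j' + j'' - 2 * w))))"
      by (metis dvd_triv_left)
    then show ?thesis unfolding u w b by (simp only: mod_eq_dvd_iff[symmetric] mod_add_left_eq add.assoc)
  qed
  then show "x \<otimes>\<^bsub>pair_group n s\<^esub> y \<otimes>\<^bsub>pair_group n s\<^esub> z = x \<otimes>\<^bsub>pair_group n s\<^esub> (y \<otimes>\<^bsub>pair_group n s\<^esub> z)"
    unfolding xyz pair_group_simps P_def[symmetric] N_def[symmetric] C_def[symmetric]
    by (simp add: mod_simps add.assoc)
next
  fix x assume "x \<in> carrier (pair_group n s)"
  obtain i j where x: "x = (i, j)" by (cases x)
  \<comment> \<open>The second coordinate is its own inverse modulo 2; the first one cancels
    everything that the product formula adds to it.\<close>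
  let ?y = "((- (i + 2 ^ n * (j * i + s * (j * j)))) mod 2 ^ (n + 1), j)"
  have "?y \<otimes>\<^bsub>pair_group n s\<^esub> x = \<one>\<^bsub>pair_group n s\<^esub>"
    unfolding x pair_group_simps by (simp add: mod_simps add.assoc)
  moreover have "?y \<in> carrier (pair_group n s)"
    using \<open>x \<in> _\<close> unfolding x by simp
  ultimately show "\<exists>y\<in>carrier (pair_group n s). y \<otimes>\<^bsub>pair_group n s\<^esub> x = \<one>\<^bsub>pair_group n s\<^esub>"
    by blast
qed (auto simp: mod_pos_pos_trivial)

text \<open>Collecting letters from the right brings every word into the form \<open>b\<^sup>j a\<^sup>i\<close>.\<close>

lemma normal_form:
  assumes a: "word_eq R (word_a N) []" and b: "word_eq R (word_b 2) (word_a t)"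
    and ab: "word_eq R word_conj_ab (word_a r)" and N: "N > 0" "2 * t mod N = 0"
  shows "\<exists>j<2. \<exists>i<N. word_eq R w (word_b j @ word_a i)"
proof -
  note tr [trans] = word_eq.trans
  have ap: "word_a (i + k) = word_a i @ word_a k" "word_b (i + k) = word_b i @ word_b k" for i k
    by (simp_all add: word_a_def word_b_def replicate_add)
  have aN: "word_eq R (word_a (N * k)) []" for k
  proof (induction k)
    case (Suc k)
    then show ?case using word_eq_append[OF a Suc] by (simp add: ap)
  qed (simp add: word_a_def word_eq.refl)
  have red: "word_eq R (word_a i) (word_a (i mod N))" for i
    using word_eq_append[OF aN[of "i div N"] word_eq.refl[of R "word_a (i mod N)"]]
    by (simp flip: ap)
  have swap1: "word_eq R (word_a 1 @ word_b 1) (word_b 1 @ word_a r)"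
  proof -
    have "word_eq R (word_a 1 @ word_b 1) (word_b 1 @ word_conj_ab)"
      using word_eq.cancel[of R "[]" GenB True "word_a 1 @ word_b 1"]
      by (simp add: word_a_def word_b_def word_conj_ab_def word_eq.sym)
    also have "word_eq R (word_b 1 @ word_conj_ab) (word_b 1 @ word_a r)"
      using word_eq_append[OF word_eq.refl ab] .
    finally show ?thesis .
  qed
  have swap: "word_eq R (word_a i @ word_b 1) (word_b 1 @ word_a (r * i))" for i
  proof (induction i)
    case (Suc i)
    have "word_a (Suc i) @ word_b 1 = word_a i @ (word_a 1 @ word_b 1)"
      using ap(1)[of i 1] by simp
    also have "word_eq R (word_a i @ (word_a 1 @ word_b 1)) (word_a i @ (word_b 1 @ word_a r))"
      by (rule word_eq_append[OF word_eq.refl swap1])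
    also have "word_a i @ (word_b 1 @ word_a r) = (word_a i @ word_b 1) @ word_a r" by simp
    also have "word_eq R \<dots> ((word_b 1 @ word_a (r * i)) @ word_a r)"
      by (rule word_eq_append[OF Suc word_eq.refl])
    also have "(word_b 1 @ word_a (r * i)) @ word_a r = word_b 1 @ word_a (r * Suc i)"
      using ap(1)[of "r * i" r] by (simp add: add.commute)
    finally show ?case .
  qed (simp add: word_a_def word_eq.refl)
  \<comment> \<open>The exponent of \<open>a\<close> stays unbounded here; it is reduced modulo
    \<open>N\<close> only at the end.\<close>
  define nf where "nf w \<longleftrightarrow> (\<exists>j<2. \<exists>i. word_eq R w (word_b j @ word_a i))" for w
  have nf_eq: "nf w" if "word_eq R w v" "nf v" for v w
    using that word_eq.trans unfolding nf_def by blast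
  have nf_b: "nf (w @ word_b 1)" if nf: "nf w" for w
  proof -
    obtain j i where j: "j < 2" and w: "word_eq R w (word_b j @ word_a i)" using nf unfolding nf_def by blast
    have "word_eq R (w @ word_b 1) ((word_b j @ word_a i) @ word_b 1)"
      by (rule word_eq_append[OF w word_eq.refl])
    also have "(word_b j @ word_a i) @ word_b 1 = word_b j @ (word_a i @ word_b 1)" by simp
    also have "word_eq R \<dots> (word_b j @ (word_b 1 @ word_a (r * i)))"
      by (rule word_eq_append[OF word_eq.refl swap])
    finally have 1: "word_eq R (w @ word_b 1) (word_b (j + 1) @ word_a (r * i))"
      by (simp only: ap append_assoc)
    show ?thesis
    proof (cases "j = 0")
      case True
      then show ?thesis using 1 unfolding nf_def by (intro exI[of _ 1]) auto
    next
      case False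
      then have "j + 1 = 2" using j by simp
      then have "word_eq R (w @ word_b 1) (word_a t @ word_a (r * i))"
        using word_eq.trans[OF 1[unfolded \<open>j + 1 = 2\<close>]
            word_eq_append[OF b word_eq.refl[of R "word_a (r * i)"]]] by blast
      then have "word_eq R (w @ word_b 1) (word_b 0 @ word_a (t + r * i))"
        by (simp add: ap) (simp add: word_b_def)
      then show ?thesis unfolding nf_def by (intro exI[of _ 0]) auto
    qed
  qed
  \<comment> \<open>Since \<open>b^2 = a^t\<close> and \<open>a^(2t)\<close> is trivial,
    \<open>b^4\<close> is trivial, and a letter for the inverse of \<open>b\<close> can be replaced
    by \<open>b^3\<close>.\<close>
  have b4: "word_eq R [] (word_b 4)"
  proof -
    have "word_eq R (word_b 4) (word_a t @ word_a t)"
      using word_eq_append[OF b b] ap(2)[of 2 2] by simp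
    also have "word_a t @ word_a t = word_a (N * (2 * t div N))"
    proof -
      have "t + t = N * (2 * t div N)" using N(2) mult_div_mod_eq[of N "2 * t"] by linarith
      then show ?thesis by (simp only: ap(1)[symmetric])
    qed
    also have "word_eq R \<dots> []" by (rule aN)
    finally show ?thesis by (rule word_eq.sym)
  qed
  have nf_letter: "nf (w @ [l])" if w: "nf w" for w l
  proof -
    obtain j i where j: "j < 2" and wji: "word_eq R w (word_b j @ word_a i)" using w unfolding nf_def by blast
    obtain x e where l: "l = (x, e)" by (cases l)
    consider "x = GenA" "e" | "x = GenA" "\<not> e" | "x = GenB" "e" | "x = GenB" "\<not> e"
      by (cases x) auto
    then show ?thesis
    proof cases
      case 1
      then have "[l] = word_a 1" by (simp add: l word_a_def)
      then have "word_eq R (w @ [l]) (word_b j @ word_a (i + 1))"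
        using word_eq_append[OF wji word_eq.refl[of R "[l]"]] by (simp only: ap append_assoc)
      then show ?thesis using j unfolding nf_def by blast
    next
      case 2
      \<comment> \<open>An inverse letter needs a positive letter to cancel with; the trivial word
        \<open>a^N\<close> supplies it.\<close>
      have "word_eq R (word_a i) (word_a (i + (N - 1)) @ [(GenA, True)])"
      proof -
        have "word_a (i + (N - 1)) @ [(GenA, True)] = word_a i @ word_a N"
        proof -
          have "[(GenA, True)] = word_a 1" by (simp add: word_a_def)
          moreover have "i + (N - 1) + 1 = i + N" using N(1) by simp
          ultimately show ?thesis by (simp only: ap[symmetric])
        qed
        then show ?thesis using word_eq.sym[OF word_eq_append[OF word_eq.refl[of R "word_a i"] a]] by simp
      qed
      from word_eq_append[OF this word_eq.refl[of R "[l]"]]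
      have "word_eq R (word_a i @ [l]) (word_a (i + (N - 1)) @ [(GenA, True), (GenA, \<not> True)] @ [])"
        using 2 l by simp
      then have "word_eq R (word_a i @ [l]) (word_a (i + (N - 1)))"
        using word_eq.cancel[of R "word_a (i + (N - 1))" GenA True "[]"] word_eq.trans by fastforce
      from word_eq_append[OF word_eq.refl[of R "word_b j"] this]
      have "word_eq R (w @ [l]) (word_b j @ word_a (i + (N - 1)))"
        using word_eq.trans[OF word_eq_append[OF wji word_eq.refl[of R "[l]"]]] by simp
      then show ?thesis using j unfolding nf_def by blast
    next
      case 3
      then show ?thesis using nf_b[OF w] l by (simp add: word_b_def)
    next
      case 4
      have "word_eq R ([l] @ []) ([l] @ word_b 4)" by (rule word_eq_append[OF word_eq.refl b4])
      also have "[l] @ word_b 4 = [] @ [(GenB, False), (GenB, \<not> False)] @ word_b 3"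
        using 4 l by (simp add: word_b_def numeral_eq_Suc)
      also have "word_eq R \<dots> ([] @ word_b 3)" by (rule word_eq.cancel)
      finally have "word_eq R (w @ [l]) (w @ word_b 3)"
        using word_eq_append[OF word_eq.refl[of R w]] by simp
      also have "w @ word_b 3 = ((w @ word_b 1) @ word_b 1) @ word_b 1"
        by (simp add: word_b_def numeral_eq_Suc)
      finally show ?thesis using nf_eq nf_b w by blast
    qed
  qed
  have "nf w"
  proof (induction w rule: rev_induct)
    case Nil
    have "word_eq R [] (word_b 0 @ word_a 0)" by (simp add: word_a_def word_b_def word_eq.refl)
    then show ?case unfolding nf_def by (intro exI[of _ 0]) auto
  qed (rule nf_letter)
  then obtain j i where "j < 2" "word_eq R w (word_b j @ word_a i)" unfolding nf_def by blast
  then have "word_eq R w (word_b j @ word_a (i mod N))"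
    using word_eq_append[OF word_eq.refl red] word_eq.trans by blast
  then show ?thesis using \<open>j < 2\<close> N(1) by (intro exI[of _ j] conjI exI[of _ "i mod N"]) auto
qed

section \<open>Identification of M2, D8 and Q8 with the model\<close>

lemma pair_group_pow: "(1, 0) [^]\<^bsub>pair_group n s\<^esub> (i :: nat) = (int i mod 2 ^ (n + 1), 0)"
proof (induction i)
  case (Suc i)
  have "(1, 0) [^]\<^bsub>pair_group n s\<^esub> Suc i = (1, 0) [^]\<^bsub>pair_group n s\<^esub> i \<otimes>\<^bsub>pair_group n s\<^esub> (1, 0)"
    by simp
  also have "\<dots> = (int (Suc i) mod 2 ^ (n + 1), 0)"
    unfolding Suc.IH pair_group_simps by (simp add: mod_simps add.commute)
  finally show ?case .
qed simp

text \<open>One treatment of three presentations: \<open>s = 0\<close> gives M2 and D8,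
  \<open>n = 1\<close> and \<open>s = 1\<close> gives Q8. Normal forms bound the presented group
  from above, and their values in the model are distinct. The conjugation relation may also be given
  with the inverse of \<open>a\<close>, which equals \<open>a^(1+2^n)\<close> in the model only for
  \<open>n = 1\<close>.\<close>

lemma presented_pair_group:
  assumes n: "n \<ge> 1" and s: "s = 0 \<or> s = 1"
    and a: "word_eq R (word_a (2 ^ (n + 1))) []" and b: "word_eq R (word_b 2) (word_a (2 ^ n * s))"
    and ab: "word_eq R word_conj_ab (word_a (1 + 2 ^ n))"
    and R: "R \<subseteq> {(word_a (2 ^ (n + 1)), []), (word_b 2, word_a (2 ^ n * s)),
      (word_conj_ab, word_a (1 + 2 ^ n)), (word_conj_ab, [(GenA, False)])}"
    and R_inv: "(word_conj_ab, [(GenA, False)]) \<in> R \<Longrightarrow> n = 1"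
  shows "group (presented_group R)" "presented_group R \<cong> pair_group n (int s)"
proof -
  let ?H = "pair_group n (int s)" and ?N = "2 ^ (n + 1) :: nat"
  interpret H: group ?H by (rule group_pair_group[OF n])
  define f :: "gen \<Rightarrow> int \<times> int" where "f x = (case x of GenA \<Rightarrow> (1, 0) | GenB \<Rightarrow> (0, 1))" for x
  have f: "f GenA = (1, 0)" "f GenB = (0, 1)" by (simp_all add: f_def)
  have big: "(1 :: int) < 2 ^ (n + 1)" by (rule one_less_power) auto
  have AB: "(1, 0) \<in> carrier ?H" "(0, 1) \<in> carrier ?H" using big by auto
  have "f x \<in> carrier ?H" for x using AB f by (cases x) (simp_all only:)
  then have f_H: "range f \<subseteq> carrier ?H" by blast
  let ?ev = "H.eval_word f"
  have ev_a: "?ev (word_a i) = (int i mod 2 ^ (n + 1), 0)" for i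
    using H.eval_word_replicate[of f GenA i] AB f by (simp only: word_a_def pair_group_pow)
  have "?ev (word_b 1) = (0, 1)"
    using H.eval_word_replicate[of f GenB 1] AB f H.nat_pow_Suc[of "(0, 1)" 0]
    by (simp add: word_b_def)
  moreover have "?ev (word_b 0) = (0, 0)" by (simp add: word_b_def)
  ultimately have ev_b: "?ev (word_b j) = (0, int j)" if "j < 2" for j
    using that by (auto simp: less_2_cases_iff)
  have ev_b2: "?ev (word_b 2) = (2 ^ n * int s mod 2 ^ (n + 1), 0)"
  proof -
    have "?ev (word_b 2) = ?ev (word_b 1) \<otimes>\<^bsub>?H\<^esub> ?ev (word_b 1)"
      using H.eval_word_append[OF f_H, of "word_b 1" "word_b 1"]
      by (simp add: word_b_def numeral_2_eq_2)
    then show ?thesis using ev_b[of 1] by simp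
  qed
  have P: "(2 :: int) ^ n = 2 * 2 ^ (n - 1)" using n by (simp flip: power_Suc)
  have conj: "?ev word_conj_ab = ?ev (word_a (1 + 2 ^ n))"
  proof -
    \<comment> \<open>The left side is the first coordinate of \<open>b\<close> times
      \<open>a^(1+2^n)\<close> before reduction; it reduces to 1, the first coordinate of
      \<open>a\<close> times \<open>b\<close>.\<close>
    have "(1 + 2 ^ n + 2 ^ n * (1 + 2 ^ n) :: int) = 1 + 2 ^ (n + 1) * (1 + 2 ^ (n - 1))"
      using P by (simp add: algebra_simps)
    then have "(1 + 2 ^ n + 2 ^ n * (1 + 2 ^ n)) mod 2 ^ (n + 1) = (1 :: int)"
      using big by (simp only: mod_mult_self2 mod_pos_pos_trivial zero_le_one)
    moreover have "(1 + 2 ^ n) mod 2 ^ (n + 1) = (1 + 2 ^ n :: int)"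
      using one_less_power[of "2 :: int" n] n by (intro mod_pos_pos_trivial) simp_all
    ultimately have "(1, 0) \<otimes>\<^bsub>?H\<^esub> (0, 1) = (0, 1) \<otimes>\<^bsub>?H\<^esub> ?ev (word_a (1 + 2 ^ n))"
      unfolding ev_a using big by (simp add: mod_simps)
    moreover have "?ev word_conj_ab = inv\<^bsub>?H\<^esub> (0, 1) \<otimes>\<^bsub>?H\<^esub> ((1, 0) \<otimes>\<^bsub>?H\<^esub> (0, 1))"
      using AB f by (simp add: word_conj_ab_def del: pair_group_simps)
    ultimately show ?thesis
      using AB H.eval_word_closed[OF f_H] by (simp only: H.inv_solve_left' H.m_closed)
  qed
  have rel: "?ev l = ?ev r" if lr: "(l, r) \<in> R" for l r
  proof -
    consider "l = word_a ?N" "r = []" | "l = word_b 2" "r = word_a (2 ^ n * s)"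
      | "l = word_conj_ab" "r = word_a (1 + 2 ^ n)" | "l = word_conj_ab" "r = [(GenA, False)]" "n = 1"
      using lr R R_inv by blast
    then show ?thesis
    proof cases
      case 4
      have "inv\<^bsub>?H\<^esub> (1, 0) = (3, 0)"
        by (rule H.inv_equality) (use 4(3) in auto)
      moreover have "?ev [(GenA, False)] = inv\<^bsub>?H\<^esub> (1, 0)"
        using AB f by (simp del: pair_group_simps)
      moreover have "?ev word_conj_ab = (3, 0)" unfolding conj ev_a using 4(3) by simp
      ultimately show ?thesis by (simp only: 4(1,2))
    qed (use conj in \<open>simp_all add: ev_a ev_b2\<close>)
  qed
  have nf: "\<exists>j<2. \<exists>i<?N. word_eq R w (word_b j @ word_a i)" for w
    by (rule normal_form[OF a b ab]) (use s in auto)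
  have ev_nf: "?ev (word_b j @ word_a i) = (0, int j) \<otimes>\<^bsub>?H\<^esub> (int i, 0)" if "j < 2" "i < ?N" for i j
  proof -
    have "int i < int ?N" using that(2) by (simp only: of_nat_less_iff)
    then have "int i mod 2 ^ (n + 1) = int i" by (intro mod_pos_pos_trivial) auto
    then show ?thesis using that by (simp only: H.eval_word_append[OF f_H] ev_a ev_b)
  qed
  have ev_eq: "?ev u = ?ev v \<longleftrightarrow> word_eq R u v" for u v
  proof
    assume uv: "?ev u = ?ev v"
    obtain j i where u: "j < 2" "i < ?N" "word_eq R u (word_b j @ word_a i)" using nf by blast
    obtain j' i' where v: "j' < 2" "i' < ?N" "word_eq R v (word_b j' @ word_a i')" using nf by blast
    have "(0, int j) \<otimes>\<^bsub>?H\<^esub> (int i, 0) = (0, int j') \<otimes>\<^bsub>?H\<^esub> (int i', 0)"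
      using uv H.eval_word_eq[OF f_H rel u(3)] H.eval_word_eq[OF f_H rel v(3)] u v by (simp only: ev_nf)
    moreover from this have j: "j = j'" using u(1) v(1) by simp
    moreover have "int i < int ?N" "int i' < int ?N" using u(2) v(2) by (simp_all only: of_nat_less_iff)
    then have "(0, int j) \<in> carrier ?H" "(int i, 0) \<in> carrier ?H" "(int i', 0) \<in> carrier ?H"
      using u(1) by simp_all
    ultimately have "(int i, 0) = (int i', 0 :: int)" by (simp only: H.l_cancel)
    then have "i = i'" by simp
    with v(3) j have "word_eq R (word_b j @ word_a i) v" by (simp add: word_eq.sym)
    with u(3) show "word_eq R u v" by (rule word_eq.trans)
  qed (rule H.eval_word_eq[OF f_H rel])
  have "range ?ev = carrier ?H"
  proof (intro equalityI subsetI)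
    fix x assume x: "x \<in> carrier ?H"
    obtain i j where ij: "x = (int i, int j)" "i < ?N" "j < 2"
    proof -
      from x have "x = (int (nat (fst x)), int (nat (snd x)))" "nat (fst x) < ?N" "nat (snd x) < 2"
        by (auto simp: nat_less_iff)
      then show ?thesis using that by blast
    qed
    have "int i < int ?N" using ij(2) by (simp only: of_nat_less_iff)
    then have i: "int i mod 2 ^ (n + 1) = int i" by (intro mod_pos_pos_trivial) auto
    have "x = ?ev (word_a i @ word_b j)"
      using ij i by (simp add: H.eval_word_append[OF f_H] ev_a ev_b)
    then show "x \<in> range ?ev" by blast
  qed (use H.eval_word_closed[OF f_H] in blast)
  from presented_group_iso[OF H.is_group H.eval_word_append[OF f_H] this ev_eq]
  show "group (presented_group R)" "presented_group R \<cong> ?H" .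
qed

lemma M2_pair_group:
  assumes "n \<ge> 1" shows "group (M2 (n + 1) 1)" "M2 (n + 1) 1 \<cong> pair_group n 0"
proof -
  let ?R = "{(word_a (2 ^ (n + 1)), []), (word_b 2, []), (word_conj_ab, word_a (1 + 2 ^ n))}"
  have a0: "word_a 0 = []" by (simp add: word_a_def)
  have R: "?R \<subseteq> {(word_a (2 ^ (n + 1)), []), (word_b 2, word_a (2 ^ n * 0)),
      (word_conj_ab, word_a (1 + 2 ^ n)), (word_conj_ab, [(GenA, False)])}" by (auto simp: a0)
  have "(word_conj_ab, [(GenA, False)]) \<notin> ?R"
    by (auto simp: word_a_def word_b_def word_conj_ab_def)
  then have "group (presented_group ?R)" "presented_group ?R \<cong> pair_group n (int 0)"
    using presented_pair_group[OF assms _ _ _ _ R] by (auto intro!: word_eq_relation simp: a0)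
  then show "group (M2 (n + 1) 1)" "M2 (n + 1) 1 \<cong> pair_group n 0" by (simp_all add: M2_def)
qed

text \<open>The fourth power of \<open>a\<close> is trivial, so its inverse is \<open>a^3\<close>,
  which has the common form \<open>a^(1+2^n)\<close> for \<open>n = 1\<close>.\<close>

lemma D8_Q8_relation:
  assumes "(word_a 4, []) \<in> R" "(word_conj_ab, [(GenA, False)]) \<in> R"
  shows "word_eq R word_conj_ab (word_a (1 + 2 ^ 1))"
proof -
  have "word_eq R (word_a 4 @ [(GenA, False)]) [(GenA, False)]"
    using word_eq_append[OF word_eq_relation[OF assms(1)] word_eq.refl] by simp
  moreover have "word_eq R (word_a 3 @ [(GenA, True), (GenA, \<not> True)] @ []) (word_a 3 @ [])"
    by (rule word_eq.cancel)
  then have "word_eq R (word_a 4 @ [(GenA, False)]) (word_a 3)"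
    by (simp add: word_a_def numeral_eq_Suc)
  ultimately have "word_eq R [(GenA, False)] (word_a 3)" by (metis word_eq.sym word_eq.trans)
  then show ?thesis using word_eq.trans[OF word_eq_relation[OF assms(2)]] by (simp add: numeral_3_eq_3)
qed

lemma D8_pair_group: "group D8" "D8 \<cong> pair_group 1 0"
proof -
  let ?R = "{(word_a 4, []), (word_b 2, []), (word_conj_ab, [(GenA, False)])}"
  have a0: "word_a 0 = []" by (simp add: word_a_def)
  have "group (presented_group ?R)" "presented_group ?R \<cong> pair_group 1 (int 0)"
    using presented_pair_group[of 1 0 ?R] D8_Q8_relation[of ?R]
    by (auto intro!: word_eq_relation simp: a0)
  then show "group D8" "D8 \<cong> pair_group 1 0" by (simp_all add: D8_def)
qed

lemma Q8_pair_group: "group Q8" "Q8 \<cong> pair_group 1 1"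
proof -
  let ?R = "{(word_a 4, []), (word_b 2, word_a 2), (word_conj_ab, [(GenA, False)])}"
  have "group (presented_group ?R)" "presented_group ?R \<cong> pair_group 1 (int 1)"
    using presented_pair_group[of 1 1 ?R] D8_Q8_relation[of ?R]
    by (auto intro!: word_eq_relation)
  then show "group Q8" "Q8 \<cong> pair_group 1 1" by (simp_all add: Q8_def)
qed

section \<open>Central products\<close>

text \<open>Every commutator is 1 or \<open>z\<close>, and at least one is not 1.\<close>

lemma (in group) derived_eq_pair:
  assumes z: "z \<in> carrier G" "z \<otimes> z = \<one>"
    and comm: "\<And>x y. x \<in> carrier G \<Longrightarrow> y \<in> carrier G \<Longrightarrow> x \<otimes> y = y \<otimes> x \<or> x \<otimes> y = z \<otimes> (y \<otimes> x)"
    and ne: "x \<in> carrier G" "y \<in> carrier G" "x \<otimes> y \<noteq> y \<otimes> x"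
  shows "derived G (carrier G) = {\<one>, z}"
proof
  have comm': "u \<otimes> v \<otimes> inv u \<otimes> inv v = \<one> \<or> u \<otimes> v \<otimes> inv u \<otimes> inv v = z"
    if uv: "u \<in> carrier G" "v \<in> carrier G" for u v
  proof -
    have "v \<otimes> u \<otimes> inv u \<otimes> inv v = \<one>" "z \<otimes> (v \<otimes> u) \<otimes> inv u \<otimes> inv v = z"
      using uv z by (simp_all add: m_assoc)
    then show ?thesis using comm[OF uv] by auto
  qed
  have sub: "subgroup {\<one>, z} G"
    by (rule subgroupI) (use z inv_equality[of z z] in auto)
  show "derived G (carrier G) \<subseteq> {\<one>, z}"
    unfolding derived_def
    by (rule generate_subgroup_incl[OF _ sub]) (use comm' in blast)
  have "x \<otimes> y \<otimes> inv x \<otimes> inv y \<noteq> \<one>"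
  proof
    assume "x \<otimes> y \<otimes> inv x \<otimes> inv y = \<one>"
    moreover have "x \<otimes> y \<otimes> inv x \<otimes> inv y \<otimes> (y \<otimes> x) = x \<otimes> y"
      using ne by (simp add: m_assoc)
    ultimately show False using ne by simp
  qed
  then have "z = x \<otimes> y \<otimes> inv x \<otimes> inv y" using comm' ne by blast
  then have "z \<in> derived G (carrier G)"
    unfolding derived_def using ne by (intro generate.incl) blast
  then show "{\<one>, z} \<subseteq> derived G (carrier G)"
    by (simp add: derived_def generate.one)
qed

lemma even_card_xor:
  assumes "finite I"
  shows "even (card {i \<in> I. P i \<noteq> Q i}) \<longleftrightarrow> (even (card {i \<in> I. P i}) \<longleftrightarrow> even (card {i \<in> I. Q i}))"
  using assms
proof (induction I)
  case (insert a I)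
  have "{i \<in> insert a I. R i} = (if R a then insert a {i \<in> I. R i} else {i \<in> I. R i})" for R
    by auto
  then show ?case using insert by auto
qed simp

locale central_family =
  fixes I :: "'i set" and M :: "'i \<Rightarrow> ('a, 'b) monoid_scheme" and z :: "'i \<Rightarrow> 'a"
  assumes finite_I: "finite I"
    and group_M [simp]: "i \<in> I \<Longrightarrow> group (M i)"
    and z_closed [simp]: "i \<in> I \<Longrightarrow> z i \<in> carrier (M i)"
    and z_not_one: "i \<in> I \<Longrightarrow> z i \<noteq> \<one>\<^bsub>M i\<^esub>"
    and z_square [simp]: "i \<in> I \<Longrightarrow> z i \<otimes>\<^bsub>M i\<^esub> z i = \<one>\<^bsub>M i\<^esub>"
    and z_central: "i \<in> I \<Longrightarrow> x \<in> carrier (M i) \<Longrightarrow> x \<otimes>\<^bsub>M i\<^esub> z i = z i \<otimes>\<^bsub>M i\<^esub> x"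
    and M_derived: "i \<in> I \<Longrightarrow> derived (M i) (carrier (M i)) = {\<one>\<^bsub>M i\<^esub>, z i}"
begin

abbreviation "\<Pi>M \<equiv> product_group I M"
abbreviation "Z \<equiv> central_identification I M"

text \<open>On tuples with entries 1 or \<open>z i\<close> this is the exponent of \<open>c\<close>,
  modulo 2, after the identification; \<open>Z\<close> consists of those with exponent zero.\<close>

definition parity :: "('i \<Rightarrow> 'a) \<Rightarrow> bool" where
  "parity x \<longleftrightarrow> odd (card {i \<in> I. x i \<noteq> \<one>\<^bsub>M i\<^esub>})"

lemma Z_iff: "x \<in> Z \<longleftrightarrow> x \<in> (\<Pi>\<^sub>E i\<in>I. {\<one>\<^bsub>M i\<^esub>, z i}) \<and> \<not> parity x"
  by (auto simp: central_identification_def parity_def M_derived cong: PiE_cong)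

sublocale P: group \<Pi>M by simp

text \<open>The tuples multiply like vectors over the field with two elements, and the parity is the
  sum of the entries.\<close>

lemma parity_mult:
  assumes "x \<in> (\<Pi>\<^sub>E i\<in>I. {\<one>\<^bsub>M i\<^esub>, z i})" "y \<in> (\<Pi>\<^sub>E i\<in>I. {\<one>\<^bsub>M i\<^esub>, z i})"
  shows "x \<otimes>\<^bsub>\<Pi>M\<^esub> y \<in> (\<Pi>\<^sub>E i\<in>I. {\<one>\<^bsub>M i\<^esub>, z i})"
    and "parity (x \<otimes>\<^bsub>\<Pi>M\<^esub> y) \<longleftrightarrow> parity x \<noteq> parity y"
proof -
  have xy: "x i = \<one>\<^bsub>M i\<^esub> \<or> x i = z i" "y i = \<one>\<^bsub>M i\<^esub> \<or> y i = z i" if "i \<in> I" for i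
    using assms that by (auto simp: PiE_iff)
  have one: "\<one>\<^bsub>M i\<^esub> \<otimes>\<^bsub>M i\<^esub> \<one>\<^bsub>M i\<^esub> = \<one>\<^bsub>M i\<^esub>" "z i \<otimes>\<^bsub>M i\<^esub> \<one>\<^bsub>M i\<^esub> = z i" "\<one>\<^bsub>M i\<^esub> \<otimes>\<^bsub>M i\<^esub> z i = z i" if "i \<in> I" for i
  proof -
    interpret group "M i" using that by simp
    show "\<one>\<^bsub>M i\<^esub> \<otimes>\<^bsub>M i\<^esub> \<one>\<^bsub>M i\<^esub> = \<one>\<^bsub>M i\<^esub>" "z i \<otimes>\<^bsub>M i\<^esub> \<one>\<^bsub>M i\<^esub> = z i" "\<one>\<^bsub>M i\<^esub> \<otimes>\<^bsub>M i\<^esub> z i = z i"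
      using that by simp_all
  qed
  have mem: "x i \<otimes>\<^bsub>M i\<^esub> y i \<in> {\<one>\<^bsub>M i\<^esub>, z i}" if "i \<in> I" for i
    using xy[OF that] one[OF that] that by auto
  then show "x \<otimes>\<^bsub>\<Pi>M\<^esub> y \<in> (\<Pi>\<^sub>E i\<in>I. {\<one>\<^bsub>M i\<^esub>, z i})" by auto
  have "(x \<otimes>\<^bsub>\<Pi>M\<^esub> y) i \<noteq> \<one>\<^bsub>M i\<^esub> \<longleftrightarrow> (x i \<noteq> \<one>\<^bsub>M i\<^esub>) \<noteq> (y i \<noteq> \<one>\<^bsub>M i\<^esub>)" if "i \<in> I" for i
    using xy[OF that] one[OF that] z_not_one[OF that] that by auto
  then have "{i \<in> I. (x \<otimes>\<^bsub>\<Pi>M\<^esub> y) i \<noteq> \<one>\<^bsub>M i\<^esub>} = {i \<in> I. (x i \<noteq> \<one>\<^bsub>M i\<^esub>) \<noteq> (y i \<noteq> \<one>\<^bsub>M i\<^esub>)}"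
    by blast
  then show "parity (x \<otimes>\<^bsub>\<Pi>M\<^esub> y) \<longleftrightarrow> parity x \<noteq> parity y"
    unfolding parity_def by (simp only: even_card_xor[OF finite_I]) blast
qed

lemma K_subset: "(\<Pi>\<^sub>E i\<in>I. {\<one>\<^bsub>M i\<^esub>, z i}) \<subseteq> carrier \<Pi>M"
proof -
  have "\<one>\<^bsub>M i\<^esub> \<in> carrier (M i)" if "i \<in> I" for i
    using that group_M group.is_monoid monoid.one_closed by blast
  then show ?thesis by (auto simp: PiE_iff; metis z_closed)
qed

lemma K_inv:
  assumes "x \<in> (\<Pi>\<^sub>E i\<in>I. {\<one>\<^bsub>M i\<^esub>, z i})" shows "inv\<^bsub>\<Pi>M\<^esub> x = x"
proof (rule P.inv_equality)
  have "x i \<otimes>\<^bsub>M i\<^esub> x i = \<one>\<^bsub>M i\<^esub>" if "i \<in> I" for i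
  proof -
    interpret group "M i" using that by simp
    show ?thesis using assms that by (auto simp: PiE_iff)
  qed
  then show "x \<otimes>\<^bsub>\<Pi>M\<^esub> x = \<one>\<^bsub>\<Pi>M\<^esub>" by (auto simp: restrict_def)
qed (use assms K_subset in blast)+

lemma K_central:
  assumes "x \<in> (\<Pi>\<^sub>E i\<in>I. {\<one>\<^bsub>M i\<^esub>, z i})" "y \<in> carrier \<Pi>M"
  shows "y \<otimes>\<^bsub>\<Pi>M\<^esub> x = x \<otimes>\<^bsub>\<Pi>M\<^esub> y"
proof -
  have "y i \<otimes>\<^bsub>M i\<^esub> x i = x i \<otimes>\<^bsub>M i\<^esub> y i" if "i \<in> I" for i
  proof -
    interpret group "M i" using that by simp
    show ?thesis using assms that z_central[OF that] by (auto simp: PiE_iff)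
  qed
  then show ?thesis by (auto simp: restrict_def)
qed

lemma Z_subset: "Z \<subseteq> carrier \<Pi>M"
  using Z_iff K_subset by blast

lemma one_in_Z: "\<one>\<^bsub>\<Pi>M\<^esub> \<in> Z"
proof -
  have "{i \<in> I. \<one>\<^bsub>\<Pi>M\<^esub> i \<noteq> \<one>\<^bsub>M i\<^esub>} = {}" by auto
  then show ?thesis unfolding Z_iff parity_def by (auto simp only:) auto
qed

lemma normal_Z: "Z \<lhd> \<Pi>M"
proof -
  have sub: "subgroup Z \<Pi>M"
  proof (rule P.subgroupI)
    show "Z \<noteq> {}" using one_in_Z by blast
    show "inv\<^bsub>\<Pi>M\<^esub> x \<in> Z" if "x \<in> Z" for x using that K_inv Z_iff by simp
    show "x \<otimes>\<^bsub>\<Pi>M\<^esub> y \<in> Z" if "x \<in> Z" "y \<in> Z" for x y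
      using that parity_mult[of x y] unfolding Z_iff by simp
  qed (rule Z_subset)
  have "x \<otimes>\<^bsub>\<Pi>M\<^esub> h \<otimes>\<^bsub>\<Pi>M\<^esub> inv\<^bsub>\<Pi>M\<^esub> x = h" if "x \<in> carrier \<Pi>M" "h \<in> Z" for x h
  proof -
    have "h \<in> carrier \<Pi>M" using that Z_subset by blast
    moreover have "x \<otimes>\<^bsub>\<Pi>M\<^esub> h = h \<otimes>\<^bsub>\<Pi>M\<^esub> x" using that K_central Z_iff by blast
    ultimately show ?thesis using that(1) by (simp only: P.m_assoc P.inv_closed P.r_inv P.r_one)
  qed
  then show ?thesis using sub by (simp add: P.normal_inv_iff)
qed

lemma coset_eq_iff:
  assumes "x \<in> carrier \<Pi>M"
  shows "Z #>\<^bsub>\<Pi>M\<^esub> x = Z \<longleftrightarrow> x \<in> Z"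
proof -
  have sub: "subgroup Z \<Pi>M" using normal_Z by (rule normal_imp_subgroup)
  show ?thesis using P.coset_join1[OF _ assms sub] P.coset_join2[OF assms sub] by iprover
qed

text \<open>The identified tuples are described by the derived subgroups and by their nontrivial
  entries, and isomorphisms respect both. They form the kernel of a homomorphism onto the quotient
  of the other product, which yields the group property as well.\<close>

lemma central_product_iso:
  fixes N :: "'i \<Rightarrow> ('c, 'd) monoid_scheme"
  assumes N: "\<And>i. i \<in> I \<Longrightarrow> group (N i)" "\<And>i. i \<in> I \<Longrightarrow> N i \<cong> M i"
  shows "group (central_product I N)" "central_product I N \<cong> central_product I M"
proof -
  have "\<forall>i\<in>I. \<exists>h. h \<in> iso (N i) (M i)" using N(2) by (auto simp: is_iso_def)
  then obtain h where h: "h i \<in> iso (N i) (M i)" if "i \<in> I" for i by metis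
  interpret PN: group "product_group I N" using N(1) by simp
  interpret Q: group "\<Pi>M Mod Z" using normal_Z by (rule normal.factorgroup_is_group)
  have h_hom: "group_hom (N i) (M i) (h i)" if "i \<in> I" for i
    using that h N by (simp add: group_hom_def group_hom_axioms_def iso_def)
  have h_inj: "h i x = \<one>\<^bsub>M i\<^esub> \<longleftrightarrow> x = \<one>\<^bsub>N i\<^esub>" if "i \<in> I" "x \<in> carrier (N i)" for i x
  proof -
    interpret group_hom "N i" "M i" "h i" by (rule h_hom[OF that(1)])
    have "inj_on (h i) (carrier (N i))" using h[OF that(1)] by (simp add: iso_def bij_betw_def)
    then show ?thesis using that(2) by (metis G.one_closed hom_one inj_onD)
  qed
  have h_derived: "h i x \<in> derived (M i) (carrier (M i)) \<longleftrightarrow> x \<in> derived (N i) (carrier (N i))"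
    if "i \<in> I" "x \<in> carrier (N i)" for i x
  proof -
    interpret group_hom "N i" "M i" "h i" by (rule h_hom[OF that(1)])
    have inj: "inj_on (h i) (carrier (N i))" and img: "h i ` carrier (N i) = carrier (M i)"
      using h[OF that(1)] by (simp_all add: iso_def bij_betw_def)
    have sub: "derived (N i) (carrier (N i)) \<subseteq> carrier (N i)"
      using G.derived_in_carrier by blast
    have "derived (M i) (carrier (M i)) = h i ` derived (N i) (carrier (N i))"
      using derived_img[of "carrier (N i)"] img by simp
    then show ?thesis using inj sub that(2) by (simp add: inj_on_image_mem_iff)
  qed
  define f where "f x = (\<lambda>i\<in>I. h i (x i))" for x
  have hM: "h i y \<in> carrier (M i)" if "i \<in> I" "y \<in> carrier (N i)" for i y
    using h[OF that(1)] that(2) by (auto simp: iso_def hom_def)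
  have f_hom: "f \<in> hom (product_group I N) \<Pi>M"
  proof (rule homI)
    fix x y assume x: "x \<in> carrier (product_group I N)" and y: "y \<in> carrier (product_group I N)"
    show "f x \<in> carrier \<Pi>M" using x hM by (auto simp: f_def)
    have "h i (x i \<otimes>\<^bsub>N i\<^esub> y i) = h i (x i) \<otimes>\<^bsub>M i\<^esub> h i (y i)" if "i \<in> I" for i
      using h[OF that] x y that by (auto simp: iso_def hom_def PiE_iff)
    then show "f (x \<otimes>\<^bsub>product_group I N\<^esub> y) = f x \<otimes>\<^bsub>\<Pi>M\<^esub> f y" by (auto simp: f_def)
  qed
  have f_surj: "f ` carrier (product_group I N) = carrier \<Pi>M"
  proof (intro equalityI subsetI)
    fix y assume y: "y \<in> carrier \<Pi>M"
    have "\<exists>x\<in>carrier (N i). h i x = y i" if "i \<in> I" for i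
    proof -
      have "y i \<in> h i ` carrier (N i)" using h[OF that] y that by (auto simp: iso_def bij_betw_def)
      then show ?thesis by auto
    qed
    then obtain x where x: "x i \<in> carrier (N i)" "h i (x i) = y i" if "i \<in> I" for i by metis
    have "f (restrict x I) = y" using y x by (auto simp: f_def PiE_iff extensional_def)
    moreover have "restrict x I \<in> carrier (product_group I N)" using x by auto
    ultimately show "y \<in> f ` carrier (product_group I N)" by blast
  qed (use hM in \<open>auto simp: f_def PiE_iff\<close>)
  have f_Z: "f x \<in> Z \<longleftrightarrow> x \<in> central_identification I N" if x: "x \<in> carrier (product_group I N)" for x
  proof -
    have "{i \<in> I. f x i \<noteq> \<one>\<^bsub>M i\<^esub>} = {i \<in> I. x i \<noteq> \<one>\<^bsub>N i\<^esub>}"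
      using x h_inj by (auto simp: f_def PiE_iff)
    moreover have "f x \<in> (\<Pi>\<^sub>E i\<in>I. derived (M i) (carrier (M i))) \<longleftrightarrow>
        x \<in> (\<Pi>\<^sub>E i\<in>I. derived (N i) (carrier (N i)))"
      using x h_derived by (auto simp: f_def PiE_iff extensional_def)
    ultimately show ?thesis by (simp add: central_identification_def)
  qed
  define r where "r x = Z #>\<^bsub>\<Pi>M\<^esub> f x" for x
  have "r \<in> hom (product_group I N) (\<Pi>M Mod Z)"
    using hom_compose[OF f_hom normal.r_coset_hom_Mod[OF normal_Z]] by (simp add: r_def[abs_def] comp_def)
  then interpret r: group_hom "product_group I N" "\<Pi>M Mod Z" r by unfold_locales
  have fM: "f x \<in> carrier \<Pi>M" if "x \<in> carrier (product_group I N)" for x using f_surj that by blast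
  have ND: "x \<in> carrier (product_group I N)" if "x \<in> central_identification I N" for x
  proof -
    have "derived (N i) (carrier (N i)) \<subseteq> carrier (N i)" if "i \<in> I" for i
      using group.derived_in_carrier[OF N(1)[OF that]] by blast
    then show ?thesis using that by (auto simp: central_identification_def PiE_iff)
  qed
  have ker: "kernel (product_group I N) (\<Pi>M Mod Z) r = central_identification I N"
  proof -
    have "r x = \<one>\<^bsub>\<Pi>M Mod Z\<^esub> \<longleftrightarrow> x \<in> central_identification I N"
      if "x \<in> carrier (product_group I N)" for x
      by (simp only: r_def one_FactGroup coset_eq_iff[OF fM[OF that]] f_Z[OF that])
    then show ?thesis unfolding kernel_def using ND by blast
  qed
  have img: "r ` carrier (product_group I N) = carrier (\<Pi>M Mod Z)"
  proof -
    have "r ` carrier (product_group I N) = (\<lambda>y. Z #>\<^bsub>\<Pi>M\<^esub> y) ` f ` carrier (product_group I N)"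
      by (simp add: image_image r_def)
    then show ?thesis unfolding f_surj by (simp only: carrier_FactGroup)
  qed
  show "central_product I N \<cong> central_product I M"
    using r.FactGroup_iso[OF img] unfolding ker central_product_def .
  show "group (central_product I N)"
    using normal.factorgroup_is_group[OF r.normal_kernel] unfolding ker central_product_def .
qed

end

section \<open>Commutators in the model groups\<close>

lemma pow2_mod_eq_iff:
  "(a + 2 ^ n * u) mod 2 ^ (n + 1) = (a + 2 ^ n * v) mod (2 ^ (n + 1) :: int) \<longleftrightarrow> (even u \<longleftrightarrow> even v)"
proof -
  have "(a + 2 ^ n * u) - (a + 2 ^ n * v) = 2 ^ n * (u - v)" by (simp add: algebra_simps)
  then have "(a + 2 ^ n * u) mod 2 ^ (n + 1) = (a + 2 ^ n * v) mod (2 ^ (n + 1) :: int) \<longleftrightarrow>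
      2 ^ n * 2 dvd 2 ^ n * (u - v)"
    unfolding mod_eq_dvd_iff by (simp only: power_add power_one_right)
  also have "\<dots> \<longleftrightarrow> even (u - v)" by (subst dvd_mult_cancel_left) simp
  finally show ?thesis by simp
qed

text \<open>The contribution \<open>s * (j * j')\<close> is symmetric, so commutation is decided by
  the alternating form \<open>j * i' - j' * i\<close> modulo 2.\<close>

lemma pair_commute_iff:
  "(i, j) \<otimes>\<^bsub>pair_group n s\<^esub> (i', j') = (i', j') \<otimes>\<^bsub>pair_group n s\<^esub> (i, j) \<longleftrightarrow>
    (even (j * i') \<longleftrightarrow> even (j' * i))"
proof -
  have "(even (j * i' + s * (j * j')) \<longleftrightarrow> even (j' * i + s * (j' * j))) \<longleftrightarrow> (even (j * i') \<longleftrightarrow> even (j' * i))"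
    by (simp only: even_add mult.commute[of j' j]) blast
  then show ?thesis
    using pow2_mod_eq_iff[of "i + i'" n "j * i' + s * (j * j')" "j' * i + s * (j' * j)"]
    by (simp only: pair_group_simps prod.inject add.commute[of i' i] add.commute[of j' j] simp_thms)
qed

lemma pair_commute:
  assumes "n \<ge> 1" "x \<in> carrier (pair_group n s)" "y \<in> carrier (pair_group n s)"
  shows "x \<otimes>\<^bsub>pair_group n s\<^esub> y = y \<otimes>\<^bsub>pair_group n s\<^esub> x \<or>
    x \<otimes>\<^bsub>pair_group n s\<^esub> y = (2 ^ n, 0) \<otimes>\<^bsub>pair_group n s\<^esub> (y \<otimes>\<^bsub>pair_group n s\<^esub> x)"
proof -
  obtain i j i' j' where xy: "x = (i, j)" "y = (i', j')" by (cases x; cases y)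
  let ?u = "j * i' + s * (j * j')" and ?v = "j' * i + s * (j' * j)"
  have "(2 ^ n, 0) \<otimes>\<^bsub>pair_group n s\<^esub> (y \<otimes>\<^bsub>pair_group n s\<^esub> x) =
      (((i + i') + 2 ^ n * (?v + 1)) mod 2 ^ (n + 1), (j + j') mod 2)"
    by (simp add: xy mod_simps algebra_simps)
  moreover have "y \<otimes>\<^bsub>pair_group n s\<^esub> x = (((i + i') + 2 ^ n * ?v) mod 2 ^ (n + 1), (j + j') mod 2)"
    by (simp add: xy add.commute)
  moreover have "x \<otimes>\<^bsub>pair_group n s\<^esub> y = (((i + i') + 2 ^ n * ?u) mod 2 ^ (n + 1), (j + j') mod 2)"
    by (simp add: xy)
  moreover have "even (?v + 1) \<longleftrightarrow> \<not> even ?v" by simp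
  ultimately show ?thesis
    by (simp only: prod.inject pow2_mod_eq_iff simp_thms) blast
qed

lemma central_family_pair_group:
  assumes "finite I" and n: "\<And>i. i \<in> I \<Longrightarrow> n i \<ge> 1"
  shows "central_family I (\<lambda>i. pair_group (n i) (s i)) (\<lambda>i. (2 ^ n i, 0))"
proof (rule central_family.intro)
  fix i assume i: "i \<in> I"
  let ?H = "pair_group (n i) (s i)" and ?z = "(2 ^ n i, 0) :: int \<times> int"
  interpret group ?H by (rule group_pair_group[OF n[OF i]])
  show "group ?H" by (rule is_group)
  show z: "?z \<in> carrier ?H" by simp
  show "?z \<noteq> \<one>\<^bsub>?H\<^esub>" by simp
  show z2: "?z \<otimes>\<^bsub>?H\<^esub> ?z = \<one>\<^bsub>?H\<^esub>" by (simp flip: mult_2)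
  have "even (2 ^ n i :: int)" using n[OF i] by simp
  then show "x \<otimes>\<^bsub>?H\<^esub> ?z = ?z \<otimes>\<^bsub>?H\<^esub> x" for x
    by (cases x) (simp only: pair_commute_iff, simp)
  have "(1, 0) \<in> carrier ?H" "(0, 1) \<in> carrier ?H"
    using one_less_power[of "2 :: int" "n i + 1"] by auto
  moreover have "(1, 0) \<otimes>\<^bsub>?H\<^esub> (0, 1) \<noteq> (0, 1) \<otimes>\<^bsub>?H\<^esub> (1, 0)"
    by (simp only: pair_commute_iff) simp
  ultimately show "derived ?H (carrier ?H) = {\<one>\<^bsub>?H\<^esub>, ?z}"
    by (intro derived_eq_pair[OF z z2 pair_commute[OF n[OF i]]])
qed (rule assms(1))

text \<open>Even plus odd counts all tuples. Even minus odd is a sum of signs, and the sign of a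
  tuple is the product of the signs of its entries, so the sum factors over
  \<open>I\<close>.\<close>

lemma parity_count:
  assumes "finite I" "\<And>i. i \<in> I \<Longrightarrow> finite (B i)"
  shows "int (card {x \<in> Pi\<^sub>E I B. even (card {i \<in> I. R i (x i)})}) +
      int (card {x \<in> Pi\<^sub>E I B. odd (card {i \<in> I. R i (x i)})}) = (\<Prod>i\<in>I. int (card (B i)))"
    and "int (card {x \<in> Pi\<^sub>E I B. even (card {i \<in> I. R i (x i)})}) -
      int (card {x \<in> Pi\<^sub>E I B. odd (card {i \<in> I. R i (x i)})}) =
      (\<Prod>i\<in>I. \<Sum>x\<in>B i. if R i x then - 1 else 1)"
proof -
  define E where "E = {x \<in> Pi\<^sub>E I B. even (card {i \<in> I. R i (x i)})}"
  define Od where "Od = {x \<in> Pi\<^sub>E I B. odd (card {i \<in> I. R i (x i)})}"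
  have fin: "finite (Pi\<^sub>E I B)" using assms by (intro finite_PiE)
  have EO: "Pi\<^sub>E I B = E \<union> Od" "E \<inter> Od = {}" "finite E" "finite Od"
    using fin by (auto simp: E_def Od_def)
  have "card (Pi\<^sub>E I B) = card E + card Od"
    unfolding EO(1) by (rule card_Un_disjoint[OF EO(3,4,2)])
  then show "int (card {x \<in> Pi\<^sub>E I B. even (card {i \<in> I. R i (x i)})}) +
      int (card {x \<in> Pi\<^sub>E I B. odd (card {i \<in> I. R i (x i)})}) = (\<Prod>i\<in>I. int (card (B i)))"
    using card_PiE[OF assms(1), of B]
    unfolding E_def[symmetric] Od_def[symmetric] by (simp flip: of_nat_prod of_nat_add)
  have sign: "(\<Prod>i\<in>I. if R i (x i) then - 1 else 1 :: int) =
      (if even (card {i \<in> I. R i (x i)}) then 1 else - 1)" for x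
  proof -
    have "(\<Prod>i\<in>I. if R i (x i) then - 1 else 1 :: int) = (- 1) ^ card {i \<in> I. R i (x i)}"
      using assms(1) by (simp add: prod.If_cases Int_def)
    then show ?thesis by simp
  qed
  have "(\<Prod>i\<in>I. \<Sum>x\<in>B i. if R i x then - 1 else 1 :: int) =
      (\<Sum>x\<in>Pi\<^sub>E I B. \<Prod>i\<in>I. if R i (x i) then - 1 else 1)"
    by (rule prod_sum_PiE) (use assms in auto)
  also have "\<dots> = (\<Sum>x\<in>E. if even (card {i \<in> I. R i (x i)}) then 1 else - 1) +
      (\<Sum>x\<in>Od. if even (card {i \<in> I. R i (x i)}) then 1 else - 1)"
    unfolding EO(1) sign by (rule sum.union_disjoint[OF EO(3,4,2)])
  also have "(\<Sum>x\<in>E. if even (card {i \<in> I. R i (x i)}) then 1 else - 1 :: int) = int (card E)"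
    by (simp add: E_def)
  also have "(\<Sum>x\<in>Od. if even (card {i \<in> I. R i (x i)}) then 1 else - 1 :: int) = - int (card Od)"
    by (simp add: Od_def)
  finally show "int (card {x \<in> Pi\<^sub>E I B. even (card {i \<in> I. R i (x i)})}) -
      int (card {x \<in> Pi\<^sub>E I B. odd (card {i \<in> I. R i (x i)})}) =
      (\<Prod>i\<in>I. \<Sum>x\<in>B i. if R i x then - 1 else 1)"
    unfolding E_def[symmetric] Od_def[symmetric] by simp
qed

lemma hom_factor:
  assumes r: "r \<in> hom D G" "r ` carrier D = carrier G" and q: "q \<in> hom D A"
    and "group D" "group G" "group A"
    and ker: "\<And>d. d \<in> carrier D \<Longrightarrow> r d = \<one>\<^bsub>G\<^esub> \<Longrightarrow> q d = \<one>\<^bsub>A\<^esub>"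
  obtains p where "p \<in> hom G A" "\<And>d. d \<in> carrier D \<Longrightarrow> p (r d) = q d"
proof -
  interpret D: group D by fact
  interpret A: group A by fact
  interpret r: group_hom D G r using assms by (simp add: group_hom_def group_hom_axioms_def)
  interpret q: group_hom D A q using assms by (simp add: group_hom_def group_hom_axioms_def)
  have q_eq: "q d = q e" if "d \<in> carrier D" "e \<in> carrier D" "r d = r e" for d e
  proof -
    have "r (d \<otimes>\<^bsub>D\<^esub> inv\<^bsub>D\<^esub> e) = \<one>\<^bsub>G\<^esub>" using that by simp
    then have "q d \<otimes>\<^bsub>A\<^esub> inv\<^bsub>A\<^esub> (q e) = \<one>\<^bsub>A\<^esub>" using ker[of "d \<otimes>\<^bsub>D\<^esub> inv\<^bsub>D\<^esub> e"] that by simp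
    then show ?thesis using that by (simp add: A.inv_solve_right')
  qed
  define p where "p g = q (SOME d. d \<in> carrier D \<and> r d = g)" for g
  have p: "p (r d) = q d" if "d \<in> carrier D" for d
  proof -
    have "(SOME e. e \<in> carrier D \<and> r e = r d) \<in> carrier D \<and> r (SOME e. e \<in> carrier D \<and> r e = r d) = r d"
      by (rule someI[of _ d]) (use that in simp)
    then show ?thesis unfolding p_def using q_eq that by blast
  qed
  have "p \<in> hom G A"
  proof (rule homI)
    fix g h assume "g \<in> carrier G" "h \<in> carrier G"
    then obtain d e where "d \<in> carrier D" "e \<in> carrier D" "g = r d" "h = r e"
      unfolding r(2)[symmetric] by blast
    then show "p (g \<otimes>\<^bsub>G\<^esub> h) = p g \<otimes>\<^bsub>A\<^esub> p h" "p g \<in> carrier A"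
      by (simp_all add: p flip: r.hom_mult)
  qed
  then show ?thesis using p that by blast
qed

section \<open>Groups covered by a product of central factors\<close>

locale central_product_cover = central_family I M z + G: group G + C: comm_group C
  for I :: "'i set" and M :: "'i \<Rightarrow> ('a, 'b) monoid_scheme" and z
    and G :: "('g, 'h) monoid_scheme" (structure) and C :: "('c, 'd) monoid_scheme" +
  fixes r :: "('i \<Rightarrow> 'a) \<times> 'c \<Rightarrow> 'g" and c :: 'g
  assumes r_hom: "r \<in> hom (\<Pi>M \<times>\<times> C) G"
    and r_surj: "r ` carrier (\<Pi>M \<times>\<times> C) = carrier G"
    and r_kernel: "x \<in> carrier \<Pi>M \<Longrightarrow> u \<in> carrier C \<Longrightarrow> r (x, u) = \<one> \<longleftrightarrow> x \<in> Z \<and> u = \<one>\<^bsub>C\<^esub>"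
    and c_G [simp]: "c \<in> carrier G"
    and derived_c: "derived G (carrier G) = generate G {c}"
    and card_derived: "card (derived G (carrier G)) = 2"
    and fin_M: "i \<in> I \<Longrightarrow> finite (carrier (M i))" and fin_C: "finite (carrier C)"
begin

abbreviation "K \<equiv> \<Pi>\<^sub>E i\<in>I. {\<one>\<^bsub>M i\<^esub>, z i}"

sublocale D: group "\<Pi>M \<times>\<times> C"
  by (rule DirProd_group) (rule P.is_group, rule C.is_group)

sublocale r: group_hom "\<Pi>M \<times>\<times> C" G r
  by unfold_locales (rule r_hom)

lemma r_closed [simp]:
  "x \<in> carrier \<Pi>M \<Longrightarrow> u \<in> carrier C \<Longrightarrow> r (x, u) \<in> carrier G"
  by (rule r.hom_closed) simp

lemma r_lift:
  assumes "g \<in> carrier G" obtains x u where "x \<in> carrier \<Pi>M" "u \<in> carrier C" "g = r (x, u)"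
proof -
  have "g \<in> r ` carrier (\<Pi>M \<times>\<times> C)" using assms by (simp only: r_surj)
  then obtain d where "d \<in> carrier (\<Pi>M \<times>\<times> C)" "g = r d" by (elim imageE)
  then show ?thesis using that[of "fst d" "snd d"] by auto
qed

lemma r_mult:
  assumes "x \<in> carrier \<Pi>M" "u \<in> carrier C" "y \<in> carrier \<Pi>M" "v \<in> carrier C"
  shows "r (x, u) \<otimes> r (y, v) = r (x \<otimes>\<^bsub>\<Pi>M\<^esub> y, u \<otimes>\<^bsub>C\<^esub> v)"
  using r.hom_mult[of "(x, u)" "(y, v)"] assms by (simp only: mult_DirProd carrier_DirProd mem_Sigma_iff)

lemma r_inv:
  assumes "x \<in> carrier \<Pi>M" "u \<in> carrier C"
  shows "inv (r (x, u)) = r (inv\<^bsub>\<Pi>M\<^esub> x, inv\<^bsub>C\<^esub> u)"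
  using r.hom_inv[of "(x, u)"] assms by (simp only: inv_DirProd[OF P.is_group C.is_group] carrier_DirProd mem_Sigma_iff)

lemma c_not_one: "c \<noteq> \<one>"
proof
  assume "c = \<one>"
  then show False using card_derived derived_c G.generate_one by simp
qed

lemma commutator_in_K:
  assumes "x \<in> carrier \<Pi>M" "y \<in> carrier \<Pi>M"
  shows "x \<otimes>\<^bsub>\<Pi>M\<^esub> y \<otimes>\<^bsub>\<Pi>M\<^esub> inv\<^bsub>\<Pi>M\<^esub> x \<otimes>\<^bsub>\<Pi>M\<^esub> inv\<^bsub>\<Pi>M\<^esub> y \<in> K"
proof -
  have "x i \<otimes>\<^bsub>M i\<^esub> y i \<otimes>\<^bsub>M i\<^esub> inv\<^bsub>M i\<^esub> (x i) \<otimes>\<^bsub>M i\<^esub> inv\<^bsub>M i\<^esub> (y i) \<in> {\<one>\<^bsub>M i\<^esub>, z i}" if "i \<in> I" for i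
  proof -
    have "x i \<in> carrier (M i)" "y i \<in> carrier (M i)" using assms that by (auto simp: PiE_iff)
    then have "x i \<otimes>\<^bsub>M i\<^esub> y i \<otimes>\<^bsub>M i\<^esub> inv\<^bsub>M i\<^esub> (x i) \<otimes>\<^bsub>M i\<^esub> inv\<^bsub>M i\<^esub> (y i) \<in> derived (M i) (carrier (M i))"
      unfolding derived_def by (intro generate.incl) blast
    then show ?thesis using M_derived[OF that] by simp
  qed
  moreover have "inv\<^bsub>\<Pi>M\<^esub> x = (\<lambda>i\<in>I. inv\<^bsub>M i\<^esub> (x i))" "inv\<^bsub>\<Pi>M\<^esub> y = (\<lambda>i\<in>I. inv\<^bsub>M i\<^esub> (y i))"
    using assms by (simp_all add: inv_product_group)
  ultimately show ?thesis by auto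
qed

lemma K_carrier: "x \<in> K \<Longrightarrow> x \<in> carrier \<Pi>M"
  using K_subset by blast

lemma r_K_mult:
  assumes "x \<in> K" "y \<in> K"
  shows "r (x, \<one>\<^bsub>C\<^esub>) \<otimes> r (y, \<one>\<^bsub>C\<^esub>) = r (x \<otimes>\<^bsub>\<Pi>M\<^esub> y, \<one>\<^bsub>C\<^esub>)"
  using assms K_carrier by (subst r_mult) auto

lemma r_K_one:
  assumes "x \<in> K" shows "r (x, \<one>\<^bsub>C\<^esub>) = \<one> \<longleftrightarrow> \<not> parity x"
proof -
  have "r (x, \<one>\<^bsub>C\<^esub>) = \<one> \<longleftrightarrow> x \<in> Z" using r_kernel[OF K_carrier[OF assms], of "\<one>\<^bsub>C\<^esub>"] by simp
  then show ?thesis using Z_iff assms by simp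
qed

lemma r_K_inj:
  assumes "x \<in> K" "y \<in> K" "parity x = parity y"
  shows "r (x, \<one>\<^bsub>C\<^esub>) = r (y, \<one>\<^bsub>C\<^esub>)"
proof -
  have "r (x, \<one>\<^bsub>C\<^esub>) \<otimes> r (y, \<one>\<^bsub>C\<^esub>) = \<one>" "r (y, \<one>\<^bsub>C\<^esub>) \<otimes> r (y, \<one>\<^bsub>C\<^esub>) = \<one>"
    using assms parity_mult by (simp_all only: r_K_mult r_K_one)
  then have "r (x, \<one>\<^bsub>C\<^esub>) \<otimes> r (y, \<one>\<^bsub>C\<^esub>) = r (y, \<one>\<^bsub>C\<^esub>) \<otimes> r (y, \<one>\<^bsub>C\<^esub>)" by simp
  then show ?thesis using assms K_carrier by (subst (asm) G.r_cancel) auto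
qed

text \<open>The assumptions know \<open>c\<close> only as a generator of the derived subgroup of G.
  All commutators come from \<open>K\<close>, hence so does \<open>c\<close>, and being nontrivial
  it is the image of a tuple of odd parity.\<close>

lemma c_in_r_K: obtains x where "x \<in> K" "parity x" "r (x, \<one>\<^bsub>C\<^esub>) = c"
proof -
  let ?L = "(\<lambda>x. r (x, \<one>\<^bsub>C\<^esub>)) ` K"
  have one_K: "\<one>\<^bsub>\<Pi>M\<^esub> \<in> K" using one_in_Z Z_iff by blast
  have "subgroup ?L G"
  proof (rule G.subgroupI)
    show "?L \<subseteq> carrier G" using K_carrier by auto
    show "?L \<noteq> {}" using one_K by blast
    fix g h assume "g \<in> ?L" "h \<in> ?L"
    then obtain x y where x: "x \<in> K" "g = r (x, \<one>\<^bsub>C\<^esub>)" and y: "y \<in> K" "h = r (y, \<one>\<^bsub>C\<^esub>)" by blast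
    have "inv g = g" unfolding x(2) using K_carrier[OF x(1)] by (simp only: r_inv K_inv[OF x(1)] C.inv_one C.one_closed)
    then show "inv g \<in> ?L" using \<open>g \<in> ?L\<close> by simp
    show "g \<otimes> h \<in> ?L" unfolding x(2) y(2) r_K_mult[OF x(1) y(1)]
      using parity_mult(1)[OF x(1) y(1)] by blast
  qed
  moreover have "g \<otimes> h \<otimes> inv g \<otimes> inv h \<in> ?L" if g: "g \<in> carrier G" and h: "h \<in> carrier G" for g h
  proof -
    obtain x u y v where x: "x \<in> carrier \<Pi>M" "u \<in> carrier C" "g = r (x, u)"
        and y: "y \<in> carrier \<Pi>M" "v \<in> carrier C" "h = r (y, v)"
      using r_lift[OF g] r_lift[OF h] by metis
    have "u \<otimes>\<^bsub>C\<^esub> v \<otimes>\<^bsub>C\<^esub> inv\<^bsub>C\<^esub> u \<otimes>\<^bsub>C\<^esub> inv\<^bsub>C\<^esub> v = \<one>\<^bsub>C\<^esub>"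
      using x(2) y(2) C.m_comm[of u v] by (simp add: C.m_assoc)
    then have "g \<otimes> h \<otimes> inv g \<otimes> inv h =
        r (x \<otimes>\<^bsub>\<Pi>M\<^esub> y \<otimes>\<^bsub>\<Pi>M\<^esub> inv\<^bsub>\<Pi>M\<^esub> x \<otimes>\<^bsub>\<Pi>M\<^esub> inv\<^bsub>\<Pi>M\<^esub> y, \<one>\<^bsub>C\<^esub>)"
      unfolding x(3) y(3) using x(1,2) y(1,2)
      by (simp only: r_mult r_inv P.inv_closed C.inv_closed P.m_closed C.m_closed)
    then show ?thesis using commutator_in_K[OF x(1) y(1)] by blast
  qed
  ultimately have "derived G (carrier G) \<subseteq> ?L"
    unfolding derived_def by (intro G.generate_subgroup_incl) blast+
  moreover have "c \<in> derived G (carrier G)"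
    unfolding derived_c by (rule generate.incl) simp
  ultimately obtain x where x: "x \<in> K" "c = r (x, \<one>\<^bsub>C\<^esub>)" by blast
  then have "parity x" using r_K_one c_not_one by blast
  then show ?thesis using that x by blast
qed

lemma r_K:
  assumes "x \<in> K" shows "r (x, \<one>\<^bsub>C\<^esub>) = (if parity x then c else \<one>)"
proof -
  obtain y where "y \<in> K" "parity y" "r (y, \<one>\<^bsub>C\<^esub>) = c" by (rule c_in_r_K)
  then show ?thesis using r_K_inj[OF assms, of y] r_K_one[OF assms] by auto
qed

text \<open>The tuples differ by an element \<open>w\<close> of \<open>K\<close> that marks the
  coordinates where they disagree, and on \<open>K\<close> the map \<open>r\<close> sees only the
  parity.\<close>

lemma r_eq_iff:
  assumes x: "x \<in> carrier \<Pi>M" and y: "y \<in> carrier \<Pi>M" and u: "u \<in> carrier C"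
    and xy: "\<And>i. i \<in> I \<Longrightarrow> x i = y i \<or> x i = z i \<otimes>\<^bsub>M i\<^esub> y i"
  shows "r (x, u) = r (y, u) \<longleftrightarrow> even (card {i \<in> I. x i \<noteq> y i})"
proof -
  define w where "w = (\<lambda>i\<in>I. if x i = y i then \<one>\<^bsub>M i\<^esub> else z i)"
  have w: "w \<in> K" by (auto simp: w_def)
  have "w i \<otimes>\<^bsub>M i\<^esub> y i = x i" if "i \<in> I" for i
  proof -
    interpret group "M i" using that by simp
    have "y i \<in> carrier (M i)" using y that by (auto simp: PiE_iff)
    then show ?thesis using xy[OF that] that by (auto simp: w_def)
  qed
  then have "w \<otimes>\<^bsub>\<Pi>M\<^esub> y = x" using x by (auto simp: restrict_def PiE_iff extensional_def)
  then have "r (x, u) = r (w, \<one>\<^bsub>C\<^esub>) \<otimes> r (y, u)"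
    using w y u K_carrier by (subst r_mult) (simp_all only: C.one_closed C.l_one)
  then have "r (x, u) = r (y, u) \<longleftrightarrow> r (w, \<one>\<^bsub>C\<^esub>) = \<one>"
    using w y u K_carrier by (simp only: G.l_cancel_one' r_closed C.one_closed) (simp only: G.r_cancel_one r_closed C.one_closed)
  moreover have "{i \<in> I. w i \<noteq> \<one>\<^bsub>M i\<^esub>} = {i \<in> I. x i \<noteq> y i}"
    using z_not_one by (auto simp: w_def)
  ultimately show ?thesis using r_K_one[OF w] by (simp only: parity_def not_not)
qed

text \<open>Each coordinate with noncommuting entries contributes one factor \<open>c\<close> to the
  commutator.\<close>

lemma commute_iff:
  assumes x: "x \<in> carrier \<Pi>M" and y: "y \<in> carrier \<Pi>M" and u: "u \<in> carrier C" "v \<in> carrier C"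
  shows "r (x, u) \<otimes> r (y, v) = r (y, v) \<otimes> r (x, u) \<longleftrightarrow>
    even (card {i \<in> I. x i \<otimes>\<^bsub>M i\<^esub> y i \<noteq> y i \<otimes>\<^bsub>M i\<^esub> x i})"
proof -
  have "x i \<otimes>\<^bsub>M i\<^esub> y i = y i \<otimes>\<^bsub>M i\<^esub> x i \<or> x i \<otimes>\<^bsub>M i\<^esub> y i = z i \<otimes>\<^bsub>M i\<^esub> (y i \<otimes>\<^bsub>M i\<^esub> x i)" if i: "i \<in> I" for i
  proof -
    interpret group "M i" using i by simp
    have xi: "x i \<in> carrier (M i)" "y i \<in> carrier (M i)" using x y i by (auto simp: PiE_iff)
    have "x i \<otimes>\<^bsub>M i\<^esub> y i \<otimes>\<^bsub>M i\<^esub> inv\<^bsub>M i\<^esub> (x i) \<otimes>\<^bsub>M i\<^esub> inv\<^bsub>M i\<^esub> (y i) \<in> derived (M i) (carrier (M i))"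
      unfolding derived_def using xi by (intro generate.incl) blast
    then have "x i \<otimes>\<^bsub>M i\<^esub> y i \<otimes>\<^bsub>M i\<^esub> inv\<^bsub>M i\<^esub> (x i) \<otimes>\<^bsub>M i\<^esub> inv\<^bsub>M i\<^esub> (y i) \<in> {\<one>\<^bsub>M i\<^esub>, z i}"
      using M_derived[OF i] by simp
    moreover have "x i \<otimes>\<^bsub>M i\<^esub> y i = x i \<otimes>\<^bsub>M i\<^esub> y i \<otimes>\<^bsub>M i\<^esub> inv\<^bsub>M i\<^esub> (x i) \<otimes>\<^bsub>M i\<^esub> inv\<^bsub>M i\<^esub> (y i) \<otimes>\<^bsub>M i\<^esub> (y i \<otimes>\<^bsub>M i\<^esub> x i)"
      using xi by (simp add: m_assoc)
    ultimately show ?thesis using xi by (metis insertE l_one m_closed singletonD)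
  qed
  then have "r (x \<otimes>\<^bsub>\<Pi>M\<^esub> y, u \<otimes>\<^bsub>C\<^esub> v) = r (y \<otimes>\<^bsub>\<Pi>M\<^esub> x, u \<otimes>\<^bsub>C\<^esub> v) \<longleftrightarrow>
      even (card {i \<in> I. (x \<otimes>\<^bsub>\<Pi>M\<^esub> y) i \<noteq> (y \<otimes>\<^bsub>\<Pi>M\<^esub> x) i})"
    using x y u by (intro r_eq_iff) (simp_all only: P.m_closed C.m_closed, simp)
  moreover have "{i \<in> I. (x \<otimes>\<^bsub>\<Pi>M\<^esub> y) i \<noteq> (y \<otimes>\<^bsub>\<Pi>M\<^esub> x) i} =
      {i \<in> I. x i \<otimes>\<^bsub>M i\<^esub> y i \<noteq> y i \<otimes>\<^bsub>M i\<^esub> x i}" by auto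
  ultimately show ?thesis using assms C.m_comm[of u v] by (simp only: r_mult)
qed

lemma r_Omega_1_iff:
  assumes x: "x \<in> carrier \<Pi>M" and u: "u \<in> carrier C"
  shows "r (x, u) \<in> Omega_1 G \<longleftrightarrow>
    u \<otimes>\<^bsub>C\<^esub> u = \<one>\<^bsub>C\<^esub> \<and> x \<otimes>\<^bsub>\<Pi>M\<^esub> x \<in> K \<and> \<not> parity (x \<otimes>\<^bsub>\<Pi>M\<^esub> x)"
proof -
  have "r (x, u) \<in> Omega_1 G \<longleftrightarrow> r (x \<otimes>\<^bsub>\<Pi>M\<^esub> x, u \<otimes>\<^bsub>C\<^esub> u) = \<one>"
    using assms by (simp only: G.Omega_1_iff r_closed simp_thms r_mult)
  also have "\<dots> \<longleftrightarrow> x \<otimes>\<^bsub>\<Pi>M\<^esub> x \<in> Z \<and> u \<otimes>\<^bsub>C\<^esub> u = \<one>\<^bsub>C\<^esub>"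
    by (rule r_kernel) (use assms in \<open>simp_all only: P.m_closed C.m_closed\<close>)
  finally show ?thesis using Z_iff by blast
qed

lemma r_Omega_c_iff:
  assumes x: "x \<in> carrier \<Pi>M" and u: "u \<in> carrier C"
  shows "r (x, u) \<in> Omega_c G c \<longleftrightarrow>
    u \<otimes>\<^bsub>C\<^esub> u = \<one>\<^bsub>C\<^esub> \<and> x \<otimes>\<^bsub>\<Pi>M\<^esub> x \<in> K \<and> parity (x \<otimes>\<^bsub>\<Pi>M\<^esub> x)"
proof
  have xx: "x \<otimes>\<^bsub>\<Pi>M\<^esub> x \<in> carrier \<Pi>M" "u \<otimes>\<^bsub>C\<^esub> u \<in> carrier C"
    using assms by (simp_all only: P.m_closed C.m_closed)
  assume "r (x, u) \<in> Omega_c G c"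
  then have sq: "r (x \<otimes>\<^bsub>\<Pi>M\<^esub> x, u \<otimes>\<^bsub>C\<^esub> u) = c"
    using assms by (simp only: G.Omega_c_iff r_mult)
  \<comment> \<open>Multiplying by an odd element of \<open>K\<close> replaces the value
    \<open>c\<close> by the identity, so that \<open>r_kernel\<close> applies; a second
    multiplication undoes the first.\<close>
  obtain y where y: "y \<in> K" "parity y" "r (y, \<one>\<^bsub>C\<^esub>) = c" by (rule c_in_r_K)
  have yy: "y \<otimes>\<^bsub>\<Pi>M\<^esub> y = \<one>\<^bsub>\<Pi>M\<^esub>"
    using K_inv[OF y(1)] P.r_inv[OF K_carrier[OF y(1)]] by (simp only:)
  have "r ((x \<otimes>\<^bsub>\<Pi>M\<^esub> x) \<otimes>\<^bsub>\<Pi>M\<^esub> y, (u \<otimes>\<^bsub>C\<^esub> u) \<otimes>\<^bsub>C\<^esub> \<one>\<^bsub>C\<^esub>) = r (y, \<one>\<^bsub>C\<^esub>) \<otimes> r (y, \<one>\<^bsub>C\<^esub>)"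
    using r_mult[OF xx K_carrier[OF y(1)] C.one_closed] sq y(3) by simp
  also have "\<dots> = r (y \<otimes>\<^bsub>\<Pi>M\<^esub> y, \<one>\<^bsub>C\<^esub>)" by (rule r_K_mult[OF y(1) y(1)])
  also have "\<dots> = \<one>" using parity_mult[OF y(1) y(1)] by (simp only: r_K_one)
  finally have "(x \<otimes>\<^bsub>\<Pi>M\<^esub> x) \<otimes>\<^bsub>\<Pi>M\<^esub> y \<in> Z" "u \<otimes>\<^bsub>C\<^esub> u = \<one>\<^bsub>C\<^esub>"
    using r_kernel[of "(x \<otimes>\<^bsub>\<Pi>M\<^esub> x) \<otimes>\<^bsub>\<Pi>M\<^esub> y" "u \<otimes>\<^bsub>C\<^esub> u"] xx K_carrier[OF y(1)]
    by (simp_all only: P.m_closed C.r_one)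
  moreover have "((x \<otimes>\<^bsub>\<Pi>M\<^esub> x) \<otimes>\<^bsub>\<Pi>M\<^esub> y) \<otimes>\<^bsub>\<Pi>M\<^esub> y = x \<otimes>\<^bsub>\<Pi>M\<^esub> x"
    using xx(1) K_carrier[OF y(1)] yy by (simp only: P.m_assoc P.r_one)
  ultimately show "u \<otimes>\<^bsub>C\<^esub> u = \<one>\<^bsub>C\<^esub> \<and> x \<otimes>\<^bsub>\<Pi>M\<^esub> x \<in> K \<and> parity (x \<otimes>\<^bsub>\<Pi>M\<^esub> x)"
    using parity_mult[of "(x \<otimes>\<^bsub>\<Pi>M\<^esub> x) \<otimes>\<^bsub>\<Pi>M\<^esub> y" y] y Z_iff by (simp only:) blast
next
  assume "u \<otimes>\<^bsub>C\<^esub> u = \<one>\<^bsub>C\<^esub> \<and> x \<otimes>\<^bsub>\<Pi>M\<^esub> x \<in> K \<and> parity (x \<otimes>\<^bsub>\<Pi>M\<^esub> x)"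
  then show "r (x, u) \<in> Omega_c G c"
    using assms r_K[of "x \<otimes>\<^bsub>\<Pi>M\<^esub> x"] by (simp only: G.Omega_c_iff r_closed r_mult if_True simp_thms)
qed

lemma fin_D: "finite (carrier (\<Pi>M \<times>\<times> C))"
  using finite_I fin_M fin_C by (simp add: finite_PiE)

text \<open>The fibers of \<open>r\<close> are cosets of its kernel, which is a copy of
  \<open>Z\<close>.\<close>

lemma card_preimage:
  assumes "S \<subseteq> carrier G"
  shows "card {d \<in> carrier (\<Pi>M \<times>\<times> C). r d \<in> S} = card Z * card S"
proof -
  let ?D = "{d \<in> carrier (\<Pi>M \<times>\<times> C). r d \<in> S}"
  have "card ?D = card Z * card (r ` ?D)"
  proof (rule card_uniform_fibers)
    show "finite ?D" using fin_D by simp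
    fix d assume d: "d \<in> ?D"
    let ?f = "\<lambda>x. (x, \<one>\<^bsub>C\<^esub>) \<otimes>\<^bsub>\<Pi>M \<times>\<times> C\<^esub> d"
    have Zc: "(x, \<one>\<^bsub>C\<^esub>) \<in> carrier (\<Pi>M \<times>\<times> C)" "r (x, \<one>\<^bsub>C\<^esub>) = \<one>" if "x \<in> Z" for x
      using that Z_subset r_kernel[of x "\<one>\<^bsub>C\<^esub>"] by auto
    have "bij_betw ?f Z {e \<in> ?D. r e = r d}"
      unfolding bij_betw_def
    proof (intro conjI inj_onI equalityI subsetI)
      fix x y assume "x \<in> Z" "y \<in> Z" "?f x = ?f y"
      then have "(x, \<one>\<^bsub>C\<^esub>) = (y, \<one>\<^bsub>C\<^esub>)" using Zc d by (simp only: D.r_cancel mem_Collect_eq)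
      then show "x = y" by simp
    next
      fix e assume "e \<in> ?f ` Z"
      then obtain x where x: "x \<in> Z" "e = ?f x" by blast
      then have "e \<in> carrier (\<Pi>M \<times>\<times> C)" "r e = r d"
        using Zc[OF x(1)] d by (simp_all only: D.m_closed mem_Collect_eq r.hom_mult G.l_one r.hom_closed)
      then show "e \<in> {e \<in> ?D. r e = r d}" using d by simp
    next
      fix e assume e: "e \<in> {e \<in> ?D. r e = r d}"
      let ?w = "e \<otimes>\<^bsub>\<Pi>M \<times>\<times> C\<^esub> inv\<^bsub>\<Pi>M \<times>\<times> C\<^esub> d"
      have w: "?w \<in> carrier (\<Pi>M \<times>\<times> C)" "r ?w = \<one>" "?w \<otimes>\<^bsub>\<Pi>M \<times>\<times> C\<^esub> d = e"
        using d e by (simp_all only: mem_Collect_eq D.m_closed D.inv_closed r.hom_mult r.hom_inv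
          D.m_assoc D.l_inv D.r_one G.r_inv r.hom_closed)
      obtain x u where xu: "?w = (x, u)" by (cases ?w)
      then have "x \<in> Z" "u = \<one>\<^bsub>C\<^esub>" using w(1,2) r_kernel[of x u] unfolding xu by auto
      then show "e \<in> ?f ` Z" using w(3) xu by (metis image_eqI)
    qed
    then show "card {e \<in> ?D. r e = r d} = card Z" by (rule bij_betw_same_card[symmetric])
  qed
  moreover have "r ` ?D = S"
  proof (intro equalityI subsetI)
    fix g assume g: "g \<in> S"
    then have "g \<in> carrier G" using assms by blast
    then obtain x u where "x \<in> carrier \<Pi>M" "u \<in> carrier C" "g = r (x, u)" by (rule r_lift)
    then show "g \<in> r ` ?D" using g by (intro image_eqI[of _ _ "(x, u)"]) auto
  qed auto
  ultimately show ?thesis by simp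
qed

text \<open>The preimages of \<open>Omega_1\<close> and \<open>Omega_c\<close> consist of the tuples
  from \<open>B\<close> with an even or an odd number of nontrivial squares, together with an
  element of square one in C. The powers of two come from \<open>K\<close>, which has
  \<open>2 ^ card I\<close> elements, half of them in \<open>Z\<close>.\<close>

lemma card_Omega_1_c:
  assumes "I \<noteq> {}"
  defines "B \<equiv> \<lambda>i. {x \<in> carrier (M i). x \<otimes>\<^bsub>M i\<^esub> x \<in> {\<one>\<^bsub>M i\<^esub>, z i}}"
    and "q \<equiv> int (card {u \<in> carrier C. u \<otimes>\<^bsub>C\<^esub> u = \<one>\<^bsub>C\<^esub>})"
  shows "2 ^ card I * (int (card (Omega_1 G)) + int (card (Omega_c G c))) =
      2 * q * (\<Prod>i\<in>I. int (card (B i)))"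
    and "2 ^ card I * (int (card (Omega_1 G)) - int (card (Omega_c G c))) =
      2 * q * (\<Prod>i\<in>I. \<Sum>x\<in>B i. if x \<otimes>\<^bsub>M i\<^esub> x \<noteq> \<one>\<^bsub>M i\<^esub> then - 1 else 1)"
proof -
  let ?K = "\<lambda>i. {\<one>\<^bsub>M i\<^esub>, z i}" and ?R = "\<lambda>i x. x \<otimes>\<^bsub>M i\<^esub> x \<noteq> \<one>\<^bsub>M i\<^esub>"
  have Z: "Z = {x \<in> K. even (card {i \<in> I. x i \<noteq> \<one>\<^bsub>M i\<^esub>})}" using Z_iff parity_def by blast
  \<comment> \<open>\<open>Z\<close> is itself counted by parity: for a nonempty index set the
    signed count of \<open>K\<close> is zero, so even and odd tuples are equally many.\<close>
  have "card (?K i) = 2" "(\<Sum>x\<in>?K i. if x \<noteq> \<one>\<^bsub>M i\<^esub> then - 1 else 1 :: int) = 0" if "i \<in> I" for i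
    using z_not_one[OF that] by auto
  then have "(\<Prod>i\<in>I. int (card (?K i))) = 2 ^ card I"
      "(\<Prod>i\<in>I. \<Sum>x\<in>?K i. if x \<noteq> \<one>\<^bsub>M i\<^esub> then - 1 else 1 :: int) = 0"
    using finite_I assms(1) by auto
  then have card_Z: "2 ^ card I = 2 * int (card Z)"
    using parity_count[OF finite_I, of ?K "\<lambda>i x. x \<noteq> \<one>\<^bsub>M i\<^esub>"] unfolding Z by simp
  have par: "parity (x \<otimes>\<^bsub>\<Pi>M\<^esub> x) \<longleftrightarrow> odd (card {i \<in> I. ?R i (x i)})" for x
  proof -
    have "{i \<in> I. (x \<otimes>\<^bsub>\<Pi>M\<^esub> x) i \<noteq> \<one>\<^bsub>M i\<^esub>} = {i \<in> I. ?R i (x i)}" by auto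
    then show ?thesis by (simp only: parity_def)
  qed
  have xK: "x \<in> carrier \<Pi>M \<and> x \<otimes>\<^bsub>\<Pi>M\<^esub> x \<in> K \<longleftrightarrow> x \<in> Pi\<^sub>E I B" for x
    by (auto simp: B_def PiE_iff)
  let ?E = "{x \<in> Pi\<^sub>E I B. even (card {i \<in> I. ?R i (x i)})}"
  let ?O = "{x \<in> Pi\<^sub>E I B. odd (card {i \<in> I. ?R i (x i)})}"
  let ?T = "{u \<in> carrier C. u \<otimes>\<^bsub>C\<^esub> u = \<one>\<^bsub>C\<^esub>}"
  have "{d \<in> carrier (\<Pi>M \<times>\<times> C). r d \<in> Omega_1 G} = ?E \<times> ?T"
  proof -
    have "d \<in> carrier (\<Pi>M \<times>\<times> C) \<and> r d \<in> Omega_1 G \<longleftrightarrow> d \<in> ?E \<times> ?T" for d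
      using r_Omega_1_iff[of "fst d" "snd d"] xK[of "fst d"] par[of "fst d"] by (cases d) (simp only: carrier_DirProd mem_Sigma_iff fst_conv snd_conv mem_Collect_eq, blast)
    then show ?thesis by blast
  qed
  then have E: "int (card ?E) * q = int (card Z) * int (card (Omega_1 G))"
    using card_preimage[of "Omega_1 G"] by (simp add: q_def G.Omega_1_iff subset_iff flip: of_nat_mult card_cartesian_product)
  have "{d \<in> carrier (\<Pi>M \<times>\<times> C). r d \<in> Omega_c G c} = ?O \<times> ?T"
  proof -
    have "d \<in> carrier (\<Pi>M \<times>\<times> C) \<and> r d \<in> Omega_c G c \<longleftrightarrow> d \<in> ?O \<times> ?T" for d
      using r_Omega_c_iff[of "fst d" "snd d"] xK[of "fst d"] par[of "fst d"] by (cases d) (simp only: carrier_DirProd mem_Sigma_iff fst_conv snd_conv mem_Collect_eq, blast)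
    then show ?thesis by blast
  qed
  then have O: "int (card ?O) * q = int (card Z) * int (card (Omega_c G c))"
    using card_preimage[of "Omega_c G c"] by (simp add: q_def G.Omega_c_iff subset_iff flip: of_nat_mult card_cartesian_product)
  have finB: "finite (B i)" if "i \<in> I" for i using fin_M[OF that] by (simp add: B_def)
  have count: "int (card ?E) + int (card ?O) = (\<Prod>i\<in>I. int (card (B i)))"
      "int (card ?E) - int (card ?O) =
        (\<Prod>i\<in>I. \<Sum>x\<in>B i. if x \<otimes>\<^bsub>M i\<^esub> x \<noteq> \<one>\<^bsub>M i\<^esub> then - 1 else 1)"
    by (rule parity_count[OF finite_I finB], assumption)+
  show "2 ^ card I * (int (card (Omega_1 G)) + int (card (Omega_c G c))) =
      2 * q * (\<Prod>i\<in>I. int (card (B i)))"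
  proof -
    have "2 ^ card I * (int (card (Omega_1 G)) + int (card (Omega_c G c))) =
        2 * (int (card Z) * int (card (Omega_1 G)) + int (card Z) * int (card (Omega_c G c)))"
      unfolding card_Z by (simp add: algebra_simps)
    also have "\<dots> = 2 * q * (int (card ?E) + int (card ?O))"
      unfolding E[symmetric] O[symmetric] by (simp add: algebra_simps)
    finally show ?thesis unfolding count(1) .
  qed
  show "2 ^ card I * (int (card (Omega_1 G)) - int (card (Omega_c G c))) =
      2 * q * (\<Prod>i\<in>I. \<Sum>x\<in>B i. if x \<otimes>\<^bsub>M i\<^esub> x \<noteq> \<one>\<^bsub>M i\<^esub> then - 1 else 1)"
  proof -
    have "2 ^ card I * (int (card (Omega_1 G)) - int (card (Omega_c G c))) =
        2 * (int (card Z) * int (card (Omega_1 G)) - int (card Z) * int (card (Omega_c G c)))"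
      unfolding card_Z by (simp add: algebra_simps)
    also have "\<dots> = 2 * q * (int (card ?E) - int (card ?O))"
      unfolding E[symmetric] O[symmetric] by (simp add: algebra_simps)
    finally show ?thesis unfolding count(2) .
  qed
qed

end

text \<open>\<open>r\<close> is the quotient map in the first component followed by an isomorphism
  onto G; the given factors are exchanged for the model groups by
  \<open>central_product_iso\<close>.\<close>

lemma (in central_family) central_product_cover_exists:
  fixes N :: "'i \<Rightarrow> ('c, 'd) monoid_scheme" and G :: "('g, 'h) monoid_scheme" and C :: "('e, 'f) monoid_scheme"
  assumes N: "\<And>i. i \<in> I \<Longrightarrow> group (N i)" "\<And>i. i \<in> I \<Longrightarrow> N i \<cong> M i"
    and G: "group G" and C: "comm_group C" "finite (carrier C)"
    and fin_M: "\<And>i. i \<in> I \<Longrightarrow> finite (carrier (M i))"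
    and iso: "G \<cong> central_product I N \<times>\<times> C"
    and c: "c \<in> carrier G" "derived G (carrier G) = generate G {c}" "card (derived G (carrier G)) = 2"
  obtains r where "central_product_cover I M z G C r c"
proof -
  interpret G: group G by (rule G)
  interpret C: comm_group C by (rule C(1))
  interpret Q: group "\<Pi>M Mod Z" using normal_Z by (rule normal.factorgroup_is_group)
  interpret D: group "\<Pi>M \<times>\<times> C"
    by (rule DirProd_group) (rule P.is_group, rule C.is_group)
  interpret QC: group "((\<Pi>M Mod Z) \<times>\<times> C)"
    by (rule DirProd_group) (rule Q.is_group, rule C.is_group)
  have "central_product I N \<times>\<times> C \<cong> ((\<Pi>M Mod Z) \<times>\<times> C)"
    using group.DirProd_iso_trans[OF central_product_iso(1)[OF N] central_product_iso(2)[OF N] iso_refl]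
    unfolding central_product_def .
  then have "G \<cong> ((\<Pi>M Mod Z) \<times>\<times> C)" using iso iso_trans by blast
  then have "((\<Pi>M Mod Z) \<times>\<times> C) \<cong> G" by (rule G.iso_sym)
  then obtain f where f: "f \<in> iso (((\<Pi>M Mod Z) \<times>\<times> C)) G" by (auto simp: is_iso_def)
  then interpret f: group_hom "((\<Pi>M Mod Z) \<times>\<times> C)" G f
    by unfold_locales (simp add: iso_def)
  have f_bij: "inj_on f (carrier (((\<Pi>M Mod Z) \<times>\<times> C)))" "f ` carrier (((\<Pi>M Mod Z) \<times>\<times> C)) = carrier G"
    using f by (simp_all add: iso_def bij_betw_def)
  define g where "g d = (Z #>\<^bsub>\<Pi>M\<^esub> fst d, snd d)" for d :: "('i \<Rightarrow> 'a) \<times> 'e"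
  have coset_hom: "(\<lambda>x. Z #>\<^bsub>\<Pi>M\<^esub> x) \<in> hom \<Pi>M (\<Pi>M Mod Z)"
    by (rule normal.r_coset_hom_Mod[OF normal_Z])
  have g_hom: "g \<in> hom (\<Pi>M \<times>\<times> C) (((\<Pi>M Mod Z) \<times>\<times> C))"
  proof (rule homI)
    fix d e assume "d \<in> carrier (\<Pi>M \<times>\<times> C)" and "e \<in> carrier (\<Pi>M \<times>\<times> C)"
    then obtain x u y v where d: "d = (x, u)" "x \<in> carrier \<Pi>M" "u \<in> carrier C"
      and e: "e = (y, v)" "y \<in> carrier \<Pi>M" "v \<in> carrier C" by (cases d; cases e) (simp only: carrier_DirProd mem_Sigma_iff)
    show "g d \<in> carrier (((\<Pi>M Mod Z) \<times>\<times> C))"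
      unfolding g_def d(1) using hom_in_carrier[OF coset_hom d(2)] d(3) by (simp only: carrier_DirProd mem_Sigma_iff fst_conv snd_conv)
    show "g (d \<otimes>\<^bsub>\<Pi>M \<times>\<times> C\<^esub> e) = g d \<otimes>\<^bsub>(\<Pi>M Mod Z) \<times>\<times> C\<^esub> g e"
      unfolding g_def d(1) e(1) using hom_mult[OF coset_hom d(2) e(2)] by (simp only: mult_DirProd fst_conv snd_conv)
  qed
  define r where "r = f \<circ> g"
  have g_img: "g ` carrier (\<Pi>M \<times>\<times> C) = carrier (((\<Pi>M Mod Z) \<times>\<times> C))"
  proof (intro equalityI subsetI)
    fix d assume "d \<in> carrier (((\<Pi>M Mod Z) \<times>\<times> C))"
    then obtain x u where "x \<in> carrier \<Pi>M" "u \<in> carrier C" "d = g (x, u)"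
      by (cases d) (auto simp: g_def carrier_FactGroup simp del: carrier_product_group)
    then show "d \<in> g ` carrier (\<Pi>M \<times>\<times> C)" by (intro image_eqI[of _ _ "(x, u)"]) auto
  next
    fix d assume "d \<in> g ` carrier (\<Pi>M \<times>\<times> C)"
    then show "d \<in> carrier (((\<Pi>M Mod Z) \<times>\<times> C))" using hom_in_carrier[OF g_hom] by blast
  qed
  have "central_product_cover I M z G C r c"
  proof (intro central_product_cover.intro central_product_cover_axioms.intro)
    show "r \<in> hom (\<Pi>M \<times>\<times> C) G" unfolding r_def using g_hom f.homh by (rule hom_compose)
    show "r ` carrier (\<Pi>M \<times>\<times> C) = carrier G"
      unfolding r_def image_comp[symmetric] g_img f_bij(2) ..
    fix x u assume x: "x \<in> carrier \<Pi>M" and u: "u \<in> carrier C"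
    have gx: "g (x, u) \<in> carrier (((\<Pi>M Mod Z) \<times>\<times> C))"
      using x u by (intro hom_in_carrier[OF g_hom]) simp
    have "r (x, u) = \<one>\<^bsub>G\<^esub> \<longleftrightarrow> f (g (x, u)) = f \<one>\<^bsub>(\<Pi>M Mod Z) \<times>\<times> C\<^esub>"
      by (simp only: r_def comp_apply f.hom_one)
    also have "\<dots> \<longleftrightarrow> g (x, u) = \<one>\<^bsub>(\<Pi>M Mod Z) \<times>\<times> C\<^esub>"
      using f_bij(1) gx QC.one_closed by (rule inj_on_eq_iff)
    also have "\<dots> \<longleftrightarrow> x \<in> Z \<and> u = \<one>\<^bsub>C\<^esub>"
      using coset_eq_iff[OF x] by (simp only: g_def one_DirProd prod.inject fst_conv snd_conv one_FactGroup)
    finally show "r (x, u) = \<one>\<^bsub>G\<^esub> \<longleftrightarrow> x \<in> Z \<and> u = \<one>\<^bsub>C\<^esub>" .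
  qed (use c C fin_M central_family_axioms G in auto)
  then show ?thesis using that by blast
qed

section \<open>Squares in the individual factors\<close>

lemma square_count_pair_1:
  assumes "s = 0 \<or> s = 1"
  defines "B \<equiv> {x \<in> carrier (pair_group 1 s). x \<otimes>\<^bsub>pair_group 1 s\<^esub> x \<in> {\<one>\<^bsub>pair_group 1 s\<^esub>, (2 ^ 1, 0)}}"
  shows "card B = 8"
    and "(\<Sum>x\<in>B. if x \<otimes>\<^bsub>pair_group 1 s\<^esub> x \<noteq> \<one>\<^bsub>pair_group 1 s\<^esub> then - 1 else 1 :: int) = (if s = 0 then 4 else - 4)"
proof -
  have "{0..<4 :: int} = {0, 1, 2, 3}" "{0..<2 :: int} = {0, 1}" by auto
  \<comment> \<open>In both groups of order eight all squares are 1 or \<open>c\<close>. For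
    \<open>s = 0\<close> six elements have square 1 and two have square \<open>c\<close>, for
    \<open>s = 1\<close> it is the other way round; hence the values 4 and -4.\<close>
  then have "B = {0, 1, 2, 3} \<times> {0, 1}" unfolding B_def using assms(1) by auto
  moreover have "{0, 1, 2, 3} \<times> {0, 1} = {(0, 0), (0, 1), (1, 0), (1, 1), (2, 0), (2, 1), (3, 0), (3 :: int, 1 :: int)}"
    by auto
  ultimately show "card B = 8"
    and "(\<Sum>x\<in>B. if x \<otimes>\<^bsub>pair_group 1 s\<^esub> x \<noteq> \<one>\<^bsub>pair_group 1 s\<^esub> then - 1 else 1 :: int) = (if s = 0 then 4 else - 4)"
    using assms(1) by auto
qed

text \<open>The elements in question are \<open>a^(h 2^(n-1)) b^j\<close> with
  \<open>0 \<le> h < 4\<close>, and the square is trivial exactly for even \<open>h\<close>. The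
  signed count is therefore zero, which is why D8 and Q8 lead to the same numbers for
  \<open>n \<ge> 2\<close>.\<close>

lemma square_count_pair:
  assumes n: "n \<ge> 2"
  defines "B \<equiv> {x \<in> carrier (pair_group n 0). x \<otimes>\<^bsub>pair_group n 0\<^esub> x \<in> {\<one>\<^bsub>pair_group n 0\<^esub>, (2 ^ n, 0)}}"
  shows "card B = 8"
    and "(\<Sum>x\<in>B. if x \<otimes>\<^bsub>pair_group n 0\<^esub> x \<noteq> \<one>\<^bsub>pair_group n 0\<^esub> then - 1 else 1 :: int) = 0"
proof -
  obtain l where l: "n = l + 2" using n by (metis le_add_diff_inverse2)
  let ?f = "\<lambda>(h, j). (h * 2 ^ (l + 1), j) :: int \<times> int"
  have sq: "?f (h, j) \<otimes>\<^bsub>pair_group n 0\<^esub> ?f (h, j) = (if even h then (0, 0) else (2 ^ n, 0))" for h j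
  proof -
    have "?f (h, j) \<otimes>\<^bsub>pair_group n 0\<^esub> ?f (h, j) = ((0 + 2 ^ n * (h + j * (h * 2 ^ (l + 1)))) mod 2 ^ (n + 1), 0)"
      by (simp add: l algebra_simps)
    also have "(0 + 2 ^ n * (h + j * (h * 2 ^ (l + 1)))) mod 2 ^ (n + 1) =
        (0 + 2 ^ n * (if even h then 0 else 1)) mod (2 ^ (n + 1) :: int)"
      unfolding pow2_mod_eq_iff by simp
    finally show ?thesis by simp
  qed
  have inj: "inj_on ?f ({0, 1, 2, 3} \<times> {0, 1})" by (auto simp: inj_on_def)
  have B: "B = ?f ` ({0, 1, 2, 3} \<times> {0, 1})"
  proof (intro equalityI subsetI)
    fix x assume "x \<in> ?f ` ({0, 1, 2, 3} \<times> {0, 1})"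
    then obtain h j where hj: "x = ?f (h, j)" "h \<in> {0, 1, 2, 3}" "j \<in> {0, 1}" by blast
    then have "x \<in> carrier (pair_group n 0)" by (auto simp: l)
    then show "x \<in> B" unfolding B_def hj(1) mem_Collect_eq sq by simp
  next
    fix x assume x: "x \<in> B"
    obtain i j where ij: "x = (i, j)" by (cases x)
    have i: "0 \<le> i" "i < 2 ^ (n + 1)" and j: "j = 0 \<or> j = 1" using x by (auto simp: B_def ij)
    have "(2 * i + 2 ^ n * (j * i)) mod 2 ^ (n + 1) \<in> {0, 2 ^ n}"
      using x by (auto simp: B_def ij simp flip: mult_2)
    then have "2 ^ n dvd (2 * i + 2 ^ n * (j * i)) mod 2 ^ (n + 1)" by auto
    then have "2 ^ n dvd 2 * i + 2 ^ n * (j * i)"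
      by (subst (asm) dvd_mod_iff) (simp_all add: power_add)
    then have "2 ^ n dvd 2 * i" by (simp add: dvd_add_left_iff)
    then have "2 * 2 ^ (l + 1) dvd 2 * i" by (simp add: l)
    then have "2 ^ (l + 1) dvd i" by (subst (asm) dvd_mult_cancel_left) simp
    then obtain h where h: "i = 2 ^ (l + 1) * h" by blast
    have "2 ^ (l + 1) * h < 2 ^ (l + 1) * 4" using i(2) by (simp add: h l)
    then have "0 \<le> h" "h < 4" using i(1) by (simp_all add: h zero_le_mult_iff)
    then have "h \<in> {0, 1, 2, 3}" by auto
    then show "x \<in> ?f ` ({0, 1, 2, 3} \<times> {0, 1})"
      using j by (intro image_eqI[of _ _ "(h, j)"]) (auto simp: ij h)
  qed
  show "card B = 8" unfolding B card_image[OF inj] by simp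
  show "(\<Sum>x\<in>B. if x \<otimes>\<^bsub>pair_group n 0\<^esub> x \<noteq> \<one>\<^bsub>pair_group n 0\<^esub> then - 1 else 1 :: int) = 0"
  proof -
    have "(\<Sum>x\<in>B. if x \<otimes>\<^bsub>pair_group n 0\<^esub> x \<noteq> \<one>\<^bsub>pair_group n 0\<^esub> then - 1 else 1 :: int) =
        (\<Sum>(h, j)\<in>{0, 1, 2, 3 :: int} \<times> {0, 1 :: int}. if odd h then - 1 else 1)"
      unfolding B sum.reindex[OF inj] comp_def
    proof (rule sum.cong[OF HOL.refl])
      fix d :: "int \<times> int"
      obtain h j where "d = (h, j)" by (cases d)
      then show "(if ?f d \<otimes>\<^bsub>pair_group n 0\<^esub> ?f d \<noteq> \<one>\<^bsub>pair_group n 0\<^esub> then - 1 else 1 :: int) =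
          (case d of (h, j) \<Rightarrow> if odd h then - 1 else 1)"
        by (simp only: sq) simp
    qed
    also have "\<dots> = 0" unfolding sum.cartesian_product[symmetric] by simp
    finally show ?thesis .
  qed
qed

lemma card_square_one_Z2n:
  assumes "m \<ge> 1"
  shows "card {u \<in> carrier (integer_mod_group (2 ^ m)). u \<otimes>\<^bsub>integer_mod_group (2 ^ m)\<^esub> u = \<one>\<^bsub>integer_mod_group (2 ^ m)\<^esub>} = 2"
proof -
  obtain l where l: "m = l + 1" using assms by (metis le_add_diff_inverse2)
  have "u \<in> {0, 2 ^ l}" if "u \<in> {u \<in> {0..<2 ^ m}. (u + u) mod 2 ^ m = 0}" for u :: int
  proof -
    have u: "0 \<le> u" "u < 2 ^ m" "(u + u) mod 2 ^ m = 0" using that by simp_all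
    have "2 * 2 ^ l dvd 2 * u" using u(3) by (simp add: l mod_eq_0_iff_dvd)
    then have "2 ^ l dvd u" by simp
    then obtain h where h: "u = 2 ^ l * h" by blast
    have "2 ^ l * h < 2 ^ l * 2" using u(2) by (simp add: h l)
    then have "0 \<le> h" "h < 2" using u(1) by (simp_all add: h zero_le_mult_iff)
    then have "h = 0 \<or> h = 1" by auto
    then show ?thesis by (auto simp: h)
  qed
  then have "{u \<in> {0..<2 ^ m}. (u + u) mod 2 ^ m = 0} \<subseteq> {0, 2 ^ l :: int}"
    by (rule subsetI)
  moreover have "{0, 2 ^ l :: int} \<subseteq> {u \<in> {0..<2 ^ m}. (u + u) mod 2 ^ m = 0}"
    by (auto simp: l simp flip: mult_2)
  ultimately have "{u \<in> {0..<2 ^ m}. (u + u) mod 2 ^ m = 0} = {0, 2 ^ l :: int}" by (rule equalityI)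
  then show ?thesis
    by (simp only: carrier_Z2n mult_integer_mod_group one_integer_mod_group of_nat_power of_nat_numeral) simp
qed

text \<open>For finite \<open>S\<close> an elementary abelian 2-group with the singletons of
  elements of \<open>S\<close> as a basis.\<close>

definition symm_diff_group :: "'a set \<Rightarrow> 'a set monoid" where
  "symm_diff_group S = \<lparr>carrier = Pow S, monoid.mult = (\<lambda>A B. (A - B) \<union> (B - A)), one = {}\<rparr>"

lemma symm_diff_group_simps [simp]:
  "carrier (symm_diff_group S) = Pow S"
  "A \<otimes>\<^bsub>symm_diff_group S\<^esub> B = (A - B) \<union> (B - A)"
  "\<one>\<^bsub>symm_diff_group S\<^esub> = {}"
  by (simp_all add: symm_diff_group_def)

lemma finite_comm_group_symm_diff:
  assumes "finite S" shows "finite_comm_group (symm_diff_group S)"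
proof -
  have "comm_group (symm_diff_group S)"
    by (rule comm_groupI) (auto intro!: exI[of _ "_ :: 'a set"])
  then show ?thesis
    using assms by (simp add: finite_comm_group_def finite_comm_group_axioms_def)
qed

section \<open>Commutation and exponents in the factors\<close>

lemma pair_square_cases:
  assumes "s = 0 \<or> s = 1" "x \<in> carrier (pair_group 1 s)"
  shows "x \<otimes>\<^bsub>pair_group 1 s\<^esub> x = (0, 0) \<or> x \<otimes>\<^bsub>pair_group 1 s\<^esub> x = (2, 0)"
proof -
  obtain i j where x: "x = (i, j)" by (cases x)
  have "i \<in> {0, 1, 2, 3}" "j \<in> {0, 1}" using assms(2) by (auto simp: x)
  then show ?thesis using assms(1) by (auto simp: x)
qed

text \<open>A central element has even exponents, so it is a power of \<open>a^2\<close>.\<close>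

lemma pair_central_square:
  assumes "s = 0 \<or> s = 1" "x \<in> carrier (pair_group 1 s)"
    and comm: "\<And>y. y \<in> carrier (pair_group 1 s) \<Longrightarrow> x \<otimes>\<^bsub>pair_group 1 s\<^esub> y = y \<otimes>\<^bsub>pair_group 1 s\<^esub> x"
  shows "x \<otimes>\<^bsub>pair_group 1 s\<^esub> x = (0, 0)"
proof -
  obtain i j where x: "x = (i, j)" by (cases x)
  have "even j" using comm[of "(1, 0)"] unfolding x pair_commute_iff by simp
  moreover have "even i" using comm[of "(0, 1)"] unfolding x pair_commute_iff by simp
  moreover have "i \<in> {0, 1, 2, 3}" "j \<in> {0, 1}" using assms(2) by (auto simp: x)
  ultimately show ?thesis by (auto simp: x)
qed

text \<open>An element that does not commute with \<open>a\<close> is a reflection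
  \<open>a^i b\<close>. The neighbouring reflection \<open>a^(i+1) b\<close> has square one and does
  not commute with it.\<close>

lemma pair_involution_rotation:
  assumes "x \<in> carrier (pair_group 1 0)" "x \<otimes>\<^bsub>pair_group 1 0\<^esub> (1, 0) \<noteq> (1, 0) \<otimes>\<^bsub>pair_group 1 0\<^esub> x"
  obtains y where "y \<in> carrier (pair_group 1 0)" "y \<otimes>\<^bsub>pair_group 1 0\<^esub> y = (0, 0)"
    "x \<otimes>\<^bsub>pair_group 1 0\<^esub> y \<noteq> y \<otimes>\<^bsub>pair_group 1 0\<^esub> x"
proof -
  obtain i j where x: "x = (i, j)" by (cases x)
  have "odd j" using assms(2) unfolding x pair_commute_iff by simp
  moreover have "0 \<le> j" "j < 2" using assms(1) by (simp_all add: x)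
  ultimately have j: "j = 1" by presburger
  have "i \<in> {0, 1, 2, 3}" using assms(1) by (auto simp: x)
  then have "(i + 1) mod 4 \<in> {0, 1, 2, 3}" "even ((i + 1) mod 4) \<longleftrightarrow> odd i" by auto
  moreover from this have "((i + 1) mod 4, 1) \<otimes>\<^bsub>pair_group 1 0\<^esub> ((i + 1) mod 4, 1) = (0, 0)" by auto
  moreover have "(i, j) \<otimes>\<^bsub>pair_group 1 0\<^esub> ((i + 1) mod 4, 1) \<noteq> ((i + 1) mod 4, 1) \<otimes>\<^bsub>pair_group 1 0\<^esub> (i, j)"
    unfolding pair_commute_iff using calculation(2) j by simp
  ultimately show ?thesis using that[of "((i + 1) mod 4, 1)"] unfolding x by auto
qed

text \<open>An element that commutes with \<open>a\<close> and has nontrivial square is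
  \<open>a\<close> or its inverse, and \<open>b\<close> interchanges these.\<close>

lemma pair_involution_reflection:
  assumes "x \<in> carrier (pair_group 1 0)" "x \<otimes>\<^bsub>pair_group 1 0\<^esub> (1, 0) = (1, 0) \<otimes>\<^bsub>pair_group 1 0\<^esub> x"
    and "x \<otimes>\<^bsub>pair_group 1 0\<^esub> x \<noteq> (0, 0)"
  shows "x \<otimes>\<^bsub>pair_group 1 0\<^esub> (0, 1) \<noteq> (0, 1) \<otimes>\<^bsub>pair_group 1 0\<^esub> x"
proof -
  obtain i j where x: "x = (i, j)" by (cases x)
  have "even j" using assms(2) unfolding x pair_commute_iff by simp
  then have j: "j = 0" using assms(1) by (auto simp: x)
  have "i \<in> {0, 1, 2, 3}" using assms(1) by (auto simp: x)
  then have "odd i" using assms(3) by (auto simp: x j)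
  then show ?thesis unfolding x pair_commute_iff by (simp add: j)
qed

text \<open>The twist is even for \<open>n \<ge> 1\<close>, so exponents add modulo 2. These
  parities become the coordinates of the elementary abelian part of the quotient.\<close>

lemma pair_parity:
  assumes "n \<ge> 1"
  shows "odd (fst (x \<otimes>\<^bsub>pair_group n s\<^esub> y)) \<longleftrightarrow> odd (fst x) \<noteq> odd (fst y)"
    and "odd (snd (x \<otimes>\<^bsub>pair_group n s\<^esub> y)) \<longleftrightarrow> odd (snd x) \<noteq> odd (snd y)"
proof -
  have "even (a mod 2 ^ (n + 1)) \<longleftrightarrow> even a" for a :: int
    by (rule dvd_mod_iff) simp
  then show "odd (fst (x \<otimes>\<^bsub>pair_group n s\<^esub> y)) \<longleftrightarrow> odd (fst x) \<noteq> odd (fst y)"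
    using assms by (cases x; cases y) (simp del: power_Suc add: even_add)
  show "odd (snd (x \<otimes>\<^bsub>pair_group n s\<^esub> y)) \<longleftrightarrow> odd (snd x) \<noteq> odd (snd y)"
    by (cases x; cases y) (simp add: even_add)
qed

text \<open>Modulo \<open>2 ^ n\<close> the twist disappears. For the first factor this gives the
  cyclic part of the quotient.\<close>

lemma pair_fst_mod:
  "fst (x \<otimes>\<^bsub>pair_group n s\<^esub> y) mod 2 ^ n = (fst x mod 2 ^ n + fst y mod 2 ^ n) mod 2 ^ n"
proof -
  have "(a mod 2 ^ (n + 1)) mod 2 ^ n = a mod (2 ^ n :: int)" for a
    by (rule mod_mod_cancel) simp
  then show ?thesis
    by (cases x; cases y) (simp only: pair_group_simps fst_conv mod_mult_self2 mod_add_eq)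
qed

section \<open>The product of k central factors and a cyclic group\<close>

definition central_factor :: "nat \<Rightarrow> int \<Rightarrow> nat \<Rightarrow> (int \<times> int) monoid" where
  "central_factor n t i = pair_group (if i = 0 then n else 1) (if i = 1 then t else 0)"

definition central_factor_c :: "nat \<Rightarrow> nat \<Rightarrow> int \<times> int" where
  "central_factor_c n i = (2 ^ (if i = 0 then n else 1), 0)"

lemma central_family_factor:
  assumes "n \<ge> 1" shows "central_family {..<k} (central_factor n t) (central_factor_c n)"
  unfolding central_factor_def[abs_def] central_factor_c_def[abs_def]
  by (rule central_family_pair_group) (use assms in auto)

lemma central_factor_simps [simp]: "central_factor n t 0 = pair_group n 0" "central_factor_c n 0 = (2 ^ n, 0)"
  by (simp_all add: central_factor_def central_factor_c_def)

text \<open>Index 0 carries the model of M2, index 1 that of D8 or Q8 for \<open>t = 0\<close> or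
  \<open>t = 1\<close>, and all further indices that of D8.\<close>

locale factor_cover = central_product_cover "{..<k}" "central_factor n t" "central_factor_c n" G "integer_mod_group (2 ^ m)" r c
  for n m k :: nat and t :: int and G :: "('g, 'h) monoid_scheme" (structure) and r c +
  assumes n: "n \<ge> 1" and m: "m \<ge> 1" and k: "k \<ge> 2" and t: "t = 0 \<or> t = 1"
begin

abbreviation "Z_m \<equiv> integer_mod_group (2 ^ m)"

lemma factor_pos:
  assumes "i \<ge> 1"
  obtains s where "s = 0 \<or> s = 1" "central_factor n t i = pair_group 1 s" "central_factor_c n i = (2, 0)"
  by (rule that[of "if i = 1 then t else 0"]) (use assms t in \<open>auto simp: central_factor_def central_factor_c_def\<close>)

lemma central_factor_one [simp]: "\<one>\<^bsub>central_factor n t i\<^esub> = (0, 0)"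
  by (simp add: central_factor_def)

lemma square_factor:
  assumes "i \<ge> 1" "y \<in> carrier (central_factor n t i)"
  shows "y \<otimes>\<^bsub>central_factor n t i\<^esub> y = (0, 0) \<or> y \<otimes>\<^bsub>central_factor n t i\<^esub> y = central_factor_c n i"
  using factor_pos[OF assms(1)] pair_square_cases assms(2) by metis

text \<open>Every factor has eight elements with square 1 or \<open>c\<close>. The signed counts are
  4 for D8, -4 for Q8 and 0 for M2 with \<open>n \<ge> 2\<close>, and the cyclic factor contributes
  its two elements of square one.\<close>

lemma card_Omega:
  shows "int (card (Omega_1 G)) + int (card (Omega_c G c)) = 4 * 4 ^ k"
    and "int (card (Omega_1 G)) - int (card (Omega_c G c)) =
      (if n = 1 then if t = 0 then 4 * 2 ^ k else - (4 * 2 ^ k) else 0)"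
proof -
  let ?B = "\<lambda>i. {x \<in> carrier (central_factor n t i). x \<otimes>\<^bsub>central_factor n t i\<^esub> x \<in> {\<one>\<^bsub>central_factor n t i\<^esub>, central_factor_c n i}}"
  let ?s = "\<lambda>i. \<Sum>x\<in>?B i. if x \<otimes>\<^bsub>central_factor n t i\<^esub> x \<noteq> \<one>\<^bsub>central_factor n t i\<^esub> then - 1 else 1 :: int"
  have I: "{..<k} = insert 0 (insert 1 {2..<k})" using k by auto
  have split: "(\<Prod>i<k. f i) = f 0 * (f 1 * (\<Prod>i\<in>{2..<k}. f i))" for f :: "nat \<Rightarrow> int"
    unfolding I by simp
  have pos: "card (?B i) = 8" "?s i = (if i = 1 \<and> t = 1 then - 4 else 4)" if i: "i \<ge> 1" for i
  proof -
    let ?u = "if i = 1 then t else 0"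
    have u: "?u = 0 \<or> ?u = 1" using t by auto
    have "central_factor n t i = pair_group 1 ?u" "central_factor_c n i = (2 ^ 1, 0)" using i by (simp_all add: central_factor_def central_factor_c_def)
    then show "card (?B i) = 8" "?s i = (if i = 1 \<and> t = 1 then - 4 else 4)"
      using square_count_pair_1[OF u] t by (simp_all only:) auto
  qed
  have zero: "card (?B 0) = 8" "?s 0 = (if n = 1 then 4 else 0)"
  proof -
    have "card (?B 0) = 8 \<and> ?s 0 = (if n = 1 then 4 else 0)"
    proof (cases "n = 1")
      case True
      then show ?thesis using square_count_pair_1[of 0] by (simp only: central_factor_simps) simp
    next
      case False
      then have "n \<ge> 2" using n by simp
      then show ?thesis using square_count_pair[of n] False by (simp only: central_factor_simps) simp
    qed
    then show "card (?B 0) = 8" by (rule conjunct1)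
    show "?s 0 = (if n = 1 then 4 else 0)" using \<open>card (?B 0) = 8 \<and> _\<close> by (rule conjunct2)
  qed
  obtain j where j: "k = j + 2" using k by (metis le_add_diff_inverse2)
  have "(\<Prod>i\<in>{2..<k}. int (card (?B i))) = 8 ^ j" using pos(1) by (simp add: j)
  then have B: "(\<Prod>i<k. int (card (?B i))) = 8 ^ k" unfolding split pos(1)[OF order_refl] zero by (simp add: j)
  have "(\<Prod>i\<in>{2..<k}. ?s i) = (\<Prod>i\<in>{2..<k}. 4)" by (rule prod.cong) (use pos(2) in auto)
  then have s: "(\<Prod>i<k. ?s i) = (if n = 1 then if t = 0 then 4 ^ k else - (4 ^ k) else 0)"
  proof -
    have "(\<Prod>i<k. ?s i) = (if n = 1 then 4 else 0) * ((if 1 = (1 :: nat) \<and> t = 1 then - 4 else 4) * 4 ^ j)"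
      unfolding split pos(2)[OF order_refl] zero \<open>(\<Prod>i\<in>{2..<k}. ?s i) = _\<close> by (simp add: j)
    moreover have "(4 :: int) ^ k = 4 * (4 * 4 ^ j)" by (simp add: j)
    ultimately show ?thesis using t by (elim disjE) simp_all
  qed
  have q: "card {u \<in> carrier Z_m. u \<otimes>\<^bsub>Z_m\<^esub> u = \<one>\<^bsub>Z_m\<^esub>} = 2" by (rule card_square_one_Z2n[OF m])
  have "0 \<in> {..<k}" using k by simp
  then have ne: "{..<k} \<noteq> {}" by blast
  have "2 ^ k * (int (card (Omega_1 G)) + int (card (Omega_c G c))) = 2 * 2 * 8 ^ k"
    using card_Omega_1_c(1)[OF ne] unfolding B q card_lessThan by simp
  also have "\<dots> = 2 ^ k * (4 * 4 ^ k)" by (simp flip: power_mult_distrib)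
  finally show "int (card (Omega_1 G)) + int (card (Omega_c G c)) = 4 * 4 ^ k" by simp
  have "2 ^ k * (int (card (Omega_1 G)) - int (card (Omega_c G c))) =
      2 * 2 * (if n = 1 then if t = 0 then 4 ^ k else - (4 ^ k) else 0)"
    using card_Omega_1_c(2)[OF ne] unfolding s q card_lessThan by simp
  also have "\<dots> = 2 ^ k * (if n = 1 then if t = 0 then 4 * 2 ^ k else - (4 * 2 ^ k) else 0)"
    by (simp flip: power_mult_distrib)
  finally show "int (card (Omega_1 G)) - int (card (Omega_c G c)) =
      (if n = 1 then if t = 0 then 4 * 2 ^ k else - (4 * 2 ^ k) else 0)"
    by (simp only: mult_cancel_left) simp
qed

definition insertion :: "nat \<Rightarrow> int \<times> int \<Rightarrow> nat \<Rightarrow> int \<times> int" where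
  "insertion i y = (\<lambda>j\<in>{..<k}. if j = i then y else (0, 0))"

lemma zero_in_factor: "i < k \<Longrightarrow> (0, 0) \<in> carrier (central_factor n t i)"
  by (simp add: central_factor_def)

lemma insertion_closed:
  "i < k \<Longrightarrow> y \<in> carrier (central_factor n t i) \<Longrightarrow> insertion i y \<in> carrier \<Pi>M"
  using zero_in_factor by (auto simp: insertion_def)

lemma one_commute:
  assumes "i < k" "x \<in> carrier (central_factor n t i)"
  shows "x \<otimes>\<^bsub>central_factor n t i\<^esub> (0, 0) = (0, 0) \<otimes>\<^bsub>central_factor n t i\<^esub> x"
    and "(0, 0) \<otimes>\<^bsub>central_factor n t i\<^esub> x = x" "x \<otimes>\<^bsub>central_factor n t i\<^esub> (0, 0) = x"
proof -
  interpret group "central_factor n t i" using assms by simp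
  show 1: "(0, 0) \<otimes>\<^bsub>central_factor n t i\<^esub> x = x" "x \<otimes>\<^bsub>central_factor n t i\<^esub> (0, 0) = x"
    using l_one[OF assms(2)] r_one[OF assms(2)] by simp_all
  then show "x \<otimes>\<^bsub>central_factor n t i\<^esub> (0, 0) = (0, 0) \<otimes>\<^bsub>central_factor n t i\<^esub> x" by simp
qed

lemma zero_Z_m: "(0 :: int) \<in> carrier Z_m" "0 \<otimes>\<^bsub>Z_m\<^esub> 0 = \<one>\<^bsub>Z_m\<^esub>"
  by (simp_all add: carrier_Z2n)

text \<open>Placed alone in coordinate \<open>i\<close>, \<open>y\<close> gives an element of square
  one, and its commutator with \<open>r (x, u)\<close> involves only that coordinate.\<close>

lemma involution_single:
  assumes i: "i < k" and y: "y \<in> carrier (central_factor n t i)" "y \<otimes>\<^bsub>central_factor n t i\<^esub> y = (0, 0)"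
    and x: "x \<in> carrier \<Pi>M" "u \<in> carrier Z_m" and ne: "x i \<otimes>\<^bsub>central_factor n t i\<^esub> y \<noteq> y \<otimes>\<^bsub>central_factor n t i\<^esub> x i"
  shows "\<exists>g\<in>Omega_1 G. r (x, u) \<otimes> g \<noteq> g \<otimes> r (x, u)"
proof
  let ?w = "insertion i y"
  have w: "?w \<in> carrier \<Pi>M" by (rule insertion_closed[OF i y(1)])
  have ww: "(?w \<otimes>\<^bsub>\<Pi>M\<^esub> ?w) j = (0, 0)" if "j < k" for j
    using that y(2) one_commute(2)[OF that zero_in_factor[OF that]] by (auto simp: insertion_def)
  then have "?w \<otimes>\<^bsub>\<Pi>M\<^esub> ?w \<in> K" by (auto simp: PiE_iff)
  moreover have "{j \<in> {..<k}. (?w \<otimes>\<^bsub>\<Pi>M\<^esub> ?w) j \<noteq> \<one>\<^bsub>central_factor n t j\<^esub>} = {}" using ww by auto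
  then have "\<not> parity (?w \<otimes>\<^bsub>\<Pi>M\<^esub> ?w)" unfolding parity_def by (simp only: card.empty) simp
  ultimately show "r (?w, 0) \<in> Omega_1 G" by (simp only: r_Omega_1_iff[OF w zero_Z_m(1)] zero_Z_m(2) simp_thms)
  have "x j \<otimes>\<^bsub>central_factor n t j\<^esub> ?w j \<noteq> ?w j \<otimes>\<^bsub>central_factor n t j\<^esub> x j \<longleftrightarrow> j = i" if "j < k" for j
  proof -
    have "x j \<in> carrier (central_factor n t j)" using x that by (auto simp: PiE_iff)
    then show ?thesis using ne that one_commute(1) by (auto simp: insertion_def)
  qed
  then have "{j \<in> {..<k}. x j \<otimes>\<^bsub>central_factor n t j\<^esub> ?w j \<noteq> ?w j \<otimes>\<^bsub>central_factor n t j\<^esub> x j} = {i}" using i by auto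
  then show "r (x, u) \<otimes> r (?w, 0) \<noteq> r (?w, 0) \<otimes> r (x, u)"
    unfolding commute_iff[OF x(1) w x(2) zero_Z_m(1)] by simp
qed

text \<open>If \<open>y\<close> has square \<open>c\<close>, then \<open>y\<close> times the element \<open>a^(2^(n-1))\<close> of the first factor is an
  involution.\<close>

lemma involution_pair:
  assumes i: "1 \<le> i" "i < k" and y: "y \<in> carrier (central_factor n t i)"
    and x: "x \<in> carrier \<Pi>M" "u \<in> carrier Z_m" and ne: "x i \<otimes>\<^bsub>central_factor n t i\<^esub> y \<noteq> y \<otimes>\<^bsub>central_factor n t i\<^esub> x i"
    and x0: "x 0 \<otimes>\<^bsub>pair_group n 0\<^esub> (2 ^ (n - 1), 0) = (2 ^ (n - 1), 0) \<otimes>\<^bsub>pair_group n 0\<^esub> x 0"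
  shows "\<exists>g\<in>Omega_1 G. r (x, u) \<otimes> g \<noteq> g \<otimes> r (x, u)"
proof (cases "y \<otimes>\<^bsub>central_factor n t i\<^esub> y = (0, 0)")
  case True
  then show ?thesis using involution_single[OF i(2) y _ x ne] by blast
next
  case False
  then have y2: "y \<otimes>\<^bsub>central_factor n t i\<^esub> y = central_factor_c n i" using square_factor[OF i(1) y] by simp
  let ?z = "(2 ^ (n - 1), 0) :: int \<times> int"
  have P: "(2 :: int) ^ n = 2 * 2 ^ (n - 1)" using n by (simp flip: power_Suc)
  have z: "?z \<in> carrier (central_factor n t 0)" using P by auto
  have z2: "?z \<otimes>\<^bsub>central_factor n t 0\<^esub> ?z = central_factor_c n 0" using P by auto
  define w where "w = (\<lambda>j\<in>{..<k}. if j = i then y else if j = 0 then ?z else (0, 0))"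
  have w: "w \<in> carrier \<Pi>M"
    using zero_in_factor y z by (auto simp: w_def simp del: central_factor_simps)
  have ww: "(w \<otimes>\<^bsub>\<Pi>M\<^esub> w) j = (if j = i \<or> j = 0 then central_factor_c n j else (0, 0))" if "j < k" for j
    using that y2 z2 i one_commute(2)[OF that zero_in_factor[OF that]] by (auto simp: w_def simp del: central_factor_simps)
  show ?thesis
  proof
    have "w \<otimes>\<^bsub>\<Pi>M\<^esub> w \<in> K" using ww by (auto simp: PiE_iff simp del: central_factor_simps)
    moreover have "{j \<in> {..<k}. (w \<otimes>\<^bsub>\<Pi>M\<^esub> w) j \<noteq> \<one>\<^bsub>central_factor n t j\<^esub>} = {i, 0}"
      using ww i by (auto simp: central_factor_c_def simp del: central_factor_simps split: if_splits)
    then have "\<not> parity (w \<otimes>\<^bsub>\<Pi>M\<^esub> w)" unfolding parity_def using i by simp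
    ultimately show "r (w, 0) \<in> Omega_1 G" by (simp only: r_Omega_1_iff[OF w zero_Z_m(1)] zero_Z_m(2) simp_thms)
    have "x j \<otimes>\<^bsub>central_factor n t j\<^esub> w j \<noteq> w j \<otimes>\<^bsub>central_factor n t j\<^esub> x j \<longleftrightarrow> j = i" if "j < k" for j
    proof -
      have "x j \<in> carrier (central_factor n t j)" using x that by (auto simp: PiE_iff)
      then show ?thesis using ne that one_commute(1) x0 by (auto simp: w_def)
    qed
    then have "{j \<in> {..<k}. x j \<otimes>\<^bsub>central_factor n t j\<^esub> w j \<noteq> w j \<otimes>\<^bsub>central_factor n t j\<^esub> x j} = {i}" using i by auto
    then show "r (x, u) \<otimes> r (w, 0) \<noteq> r (w, 0) \<otimes> r (x, u)"
      unfolding commute_iff[OF x(1) w x(2) zero_Z_m(1)] by simp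
  qed
qed

text \<open>Where an involution not commuting with \<open>v\<close> can be found, \<open>v\<close>
  itself serves as \<open>w\<close>. The remaining case is \<open>n \<ge> 2\<close> with all entries
  after the first one central, for instance \<open>a^(2^(n-1))\<close> in the first factor; there an
  element of order four in factor 1 takes the role of \<open>w\<close>.\<close>

lemma Omega_c_noncommuting:
  assumes "v \<in> Omega_c G c"
  shows "\<exists>w\<in>Omega_c G c. v \<otimes> w = w \<otimes> v \<and> (\<exists>g\<in>Omega_1 G. w \<otimes> g \<noteq> g \<otimes> w)"
proof -
  have "v \<in> carrier G" using assms by (simp add: G.Omega_c_iff)
  then obtain x u where x: "x \<in> carrier \<Pi>M" "u \<in> carrier Z_m" and v: "v = r (x, u)" by (rule r_lift)
  have xj: "x j \<in> carrier (central_factor n t j)" if "j < k" for j using x that by (auto simp: PiE_iff)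
  have xx: "x \<otimes>\<^bsub>\<Pi>M\<^esub> x \<in> K" "parity (x \<otimes>\<^bsub>\<Pi>M\<^esub> x)"
    using assms unfolding v r_Omega_c_iff[OF x] by simp_all
  let ?z = "(2 ^ (n - 1), 0) :: int \<times> int"
  let ?ok = "\<exists>g\<in>Omega_1 G. v \<otimes> g \<noteq> g \<otimes> v"
  have good: ?thesis if ?ok using that assms by blast
  show ?thesis
  proof (cases "x 0 \<otimes>\<^bsub>pair_group n 0\<^esub> ?z = ?z \<otimes>\<^bsub>pair_group n 0\<^esub> x 0")
    case False
    \<comment> \<open>For \<open>n \<ge> 2\<close> the exponent \<open>2 ^ (n - 1)\<close> is even,
      so \<open>?z\<close> commutes with the whole first factor.\<close>
    have n1: "n = 1"
    proof (rule ccontr)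
      assume "n \<noteq> 1"
      then have "even (2 ^ (n - 1) :: int)" using n by simp
      then show False using False by (cases "x 0") (simp only: pair_commute_iff, simp)
    qed
    have k0: "0 < k" using k by simp
    obtain y where "y \<in> carrier (central_factor n t 0)" "y \<otimes>\<^bsub>central_factor n t 0\<^esub> y = (0, 0)"
        "x 0 \<otimes>\<^bsub>central_factor n t 0\<^esub> y \<noteq> y \<otimes>\<^bsub>central_factor n t 0\<^esub> x 0"
      using pair_involution_rotation[of "x 0"] xj[OF k0] False unfolding central_factor_simps n1 by auto
    then show ?thesis using involution_single[OF k0 _ _ x] good unfolding v by blast
  next
    case x0: True
    show ?thesis
    proof (cases "\<exists>i\<in>{1..<k}. \<exists>y\<in>carrier (central_factor n t i). x i \<otimes>\<^bsub>central_factor n t i\<^esub> y \<noteq> y \<otimes>\<^bsub>central_factor n t i\<^esub> x i")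
      case True
      then obtain i y where "1 \<le> i" "i < k" "y \<in> carrier (central_factor n t i)"
          "x i \<otimes>\<^bsub>central_factor n t i\<^esub> y \<noteq> y \<otimes>\<^bsub>central_factor n t i\<^esub> x i" by auto
      then show ?thesis using involution_pair[OF _ _ _ x _ x0] good unfolding v by blast
    next
      case False
      then have central: "x i \<otimes>\<^bsub>central_factor n t i\<^esub> y = y \<otimes>\<^bsub>central_factor n t i\<^esub> x i"
        if "1 \<le> i" "i < k" "y \<in> carrier (central_factor n t i)" for i y using that by auto
      show ?thesis
      proof (cases "n = 1")
        case n1: True
        have sq: "x i \<otimes>\<^bsub>central_factor n t i\<^esub> x i = (0, 0)" if i: "1 \<le> i" "i < k" for i
        proof -
          obtain s where s: "s = 0 \<or> s = 1" "central_factor n t i = pair_group 1 s"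
            by (rule factor_pos[OF i(1)])
          show ?thesis
            using pair_central_square[OF s(1) xj[OF i(2), unfolded s(2)] central[OF i, unfolded s(2)]]
            unfolding s(2) .
        qed
        have k0: "0 < k" using k by simp
        \<comment> \<open>All later entries have trivial squares, so the odd parity of the square
          must come from entry 0.\<close>
        have sq0: "x 0 \<otimes>\<^bsub>central_factor n t 0\<^esub> x 0 \<noteq> (0, 0)"
        proof
          assume 0: "x 0 \<otimes>\<^bsub>central_factor n t 0\<^esub> x 0 = (0, 0)"
          have "(x \<otimes>\<^bsub>\<Pi>M\<^esub> x) i = \<one>\<^bsub>central_factor n t i\<^esub>" if "i < k" for i
            using that 0 sq[of i] by (cases "i = 0") (simp_all del: central_factor_simps)
          then have "{i \<in> {..<k}. (x \<otimes>\<^bsub>\<Pi>M\<^esub> x) i \<noteq> \<one>\<^bsub>central_factor n t i\<^esub>} = {}" by auto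
          then show False using xx(2) unfolding parity_def by (simp only: card.empty) simp
        qed
        have "x 0 \<otimes>\<^bsub>central_factor n t 0\<^esub> (0, 1) \<noteq> (0, 1) \<otimes>\<^bsub>central_factor n t 0\<^esub> x 0"
          using pair_involution_reflection[of "x 0"] xj[OF k0] sq0 x0 unfolding central_factor_simps n1 by simp
        then show ?thesis
          using involution_single[OF k0 _ _ x, of "(0, 1)"] good unfolding v by simp
      next
        case False
        let ?a = "(1, 0) :: int \<times> int" and ?b = "(0, 1) :: int \<times> int"
        have k1: "1 < k" using k by simp
        obtain s where s: "s = 0 \<or> s = 1" "central_factor n t 1 = pair_group 1 s" "central_factor_c n 1 = (2, 0)"
          using factor_pos[of 1] by auto
        have ab: "?a \<in> carrier (central_factor n t 1)" "?b \<in> carrier (central_factor n t 1)"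
            "?a \<otimes>\<^bsub>central_factor n t 1\<^esub> ?b \<noteq> ?b \<otimes>\<^bsub>central_factor n t 1\<^esub> ?a"
          unfolding s(2) pair_commute_iff by simp_all
        \<comment> \<open>In D8 as well as in Q8 the generator \<open>a\<close> has square
          \<open>c\<close>, and it commutes with the central entry \<open>x 1\<close>.\<close>
        let ?w = "insertion 1 ?a"
        have w: "?w \<in> carrier \<Pi>M" by (rule insertion_closed[OF k1 ab(1)])
        have ww: "(?w \<otimes>\<^bsub>\<Pi>M\<^esub> ?w) j = (if j = 1 then central_factor_c n j else (0, 0))" if "j < k" for j
          using that one_commute(2)[OF that zero_in_factor[OF that]] s by (auto simp: insertion_def)
        have "?w \<otimes>\<^bsub>\<Pi>M\<^esub> ?w \<in> K" using ww by (auto simp: PiE_iff simp del: central_factor_simps)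
        moreover have "{j \<in> {..<k}. (?w \<otimes>\<^bsub>\<Pi>M\<^esub> ?w) j \<noteq> \<one>\<^bsub>central_factor n t j\<^esub>} = {1}"
          using ww k1 s(3) by (auto simp del: central_factor_simps split: if_splits)
        then have "parity (?w \<otimes>\<^bsub>\<Pi>M\<^esub> ?w)" unfolding parity_def by simp
        ultimately have wO: "r (?w, 0) \<in> Omega_c G c"
          by (simp only: r_Omega_c_iff[OF w zero_Z_m(1)] zero_Z_m(2) simp_thms)
        have "x j \<otimes>\<^bsub>central_factor n t j\<^esub> ?w j = ?w j \<otimes>\<^bsub>central_factor n t j\<^esub> x j" if "j < k" for j
          using that central[of 1 ?a] one_commute(1)[OF that xj[OF that]] ab(1) k1 by (auto simp: insertion_def)
        then have "{j \<in> {..<k}. x j \<otimes>\<^bsub>central_factor n t j\<^esub> ?w j \<noteq> ?w j \<otimes>\<^bsub>central_factor n t j\<^esub> x j} = {}" by auto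
        then have vw: "v \<otimes> r (?w, 0) = r (?w, 0) \<otimes> v"
          unfolding v commute_iff[OF x(1) w x(2) zero_Z_m(1)] by (simp only: card.empty) simp
        have w01: "?w 0 = (0, 0)" "?w 1 = ?a" using k1 by (auto simp: insertion_def)
        \<comment> \<open>Entry 0 of \<open>?w\<close> is trivial, so \<open>involution_pair\<close>
          applies with \<open>b\<close> in factor 1, whether \<open>b\<close> has square 1 or
          \<open>c\<close>.\<close>
        have "\<exists>g\<in>Omega_1 G. r (?w, 0) \<otimes> g \<noteq> g \<otimes> r (?w, 0)"
          by (rule involution_pair[OF order_refl k1 ab(2) w zero_Z_m(1)])
            (use ab(3) in \<open>simp_all only: w01 pair_commute_iff\<close>, simp_all)
        then show ?thesis using wO vw by blast
      qed
    qed
  qed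
qed

end

section \<open>The abelian quotient by c\<close>

context factor_cover
begin

text \<open>One basis vector for each generator modulo \<open>c\<close>: \<open>(i, True)\<close>
  stands for \<open>b\<close> and \<open>(i, False)\<close> for \<open>a\<close> in factor
  \<open>i\<close>. The generator \<open>a\<close> of factor 0 is left out because it yields the
  cyclic factor of order \<open>2 ^ n\<close>.\<close>

abbreviation "S \<equiv> {(i, e). i < k \<and> (e \<or> i \<noteq> 0)}"

abbreviation "A \<equiv> (symm_diff_group S \<times>\<times> Z_m) \<times>\<times> integer_mod_group (2 ^ n)"

definition exponent_parities :: "(nat \<Rightarrow> int \<times> int) \<Rightarrow> (nat \<times> bool) set" where
  "exponent_parities x = {(i, e) \<in> S. odd (if e then snd (x i) else fst (x i))}"

text \<open>Defined on the covering product, where coordinates are available; it descends to G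
  because it is trivial on the kernel of \<open>r\<close>.\<close>

definition q :: "(nat \<Rightarrow> int \<times> int) \<times> int \<Rightarrow> ((nat \<times> bool) set \<times> int) \<times> int" where
  "q d = ((exponent_parities (fst d), snd d), fst (fst d 0) mod 2 ^ n)"

lemma finite_comm_group_parts:
  "finite_comm_group (symm_diff_group S)" "finite_comm_group (symm_diff_group S \<times>\<times> Z_m)"
  "finite_comm_group A"
proof -
  have "finite S" by (rule finite_subset[of _ "{..<k} \<times> UNIV"]) auto
  then show 1: "finite_comm_group (symm_diff_group S)" by (rule finite_comm_group_symm_diff)
  then show 2: "finite_comm_group (symm_diff_group S \<times>\<times> Z_m)"
    by (rule finite_comm_group.finite_comm_group_Z2n)
  then show "finite_comm_group A" by (rule finite_comm_group.finite_comm_group_Z2n)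
qed

lemma q_hom: "q \<in> hom (\<Pi>M \<times>\<times> Z_m) A"
proof (rule homI)
  fix d e assume d: "d \<in> carrier (\<Pi>M \<times>\<times> Z_m)" and e: "e \<in> carrier (\<Pi>M \<times>\<times> Z_m)"
  obtain x u y v where de: "d = (x, u)" "e = (y, v)" by (cases d; cases e)
  have "exponent_parities x \<in> Pow S" unfolding exponent_parities_def by blast
  moreover have "u \<in> carrier Z_m" using d by (simp add: de)
  moreover have "fst (x 0) mod 2 ^ n \<in> carrier (integer_mod_group (2 ^ n))" by (simp add: carrier_Z2n)
  ultimately show "q d \<in> carrier A"
    by (simp only: de q_def fst_conv snd_conv carrier_DirProd mem_Sigma_iff symm_diff_group_simps simp_thms)
  have xy: "(x \<otimes>\<^bsub>\<Pi>M\<^esub> y) i = x i \<otimes>\<^bsub>central_factor n t i\<^esub> y i" if "i < k" for i using that by simp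
  have par: "odd (fst (x i \<otimes>\<^bsub>central_factor n t i\<^esub> y i)) \<longleftrightarrow> odd (fst (x i)) \<noteq> odd (fst (y i))"
      "odd (snd (x i \<otimes>\<^bsub>central_factor n t i\<^esub> y i)) \<longleftrightarrow> odd (snd (x i)) \<noteq> odd (snd (y i))" for i
    unfolding central_factor_def using pair_parity n by simp_all
  have "exponent_parities (x \<otimes>\<^bsub>\<Pi>M\<^esub> y) =
      exponent_parities x \<otimes>\<^bsub>symm_diff_group S\<^esub> exponent_parities y"
  proof (rule Set.set_eqI)
    fix s :: "nat \<times> bool"
    obtain i b where s: "s = (i, b)" by (cases s)
    show "s \<in> exponent_parities (x \<otimes>\<^bsub>\<Pi>M\<^esub> y) \<longleftrightarrow>
        s \<in> exponent_parities x \<otimes>\<^bsub>symm_diff_group S\<^esub> exponent_parities y"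
      unfolding s using xy[of i] par[of i]
      by (cases b) (auto simp: exponent_parities_def simp del: mult_product_group)
  qed
  moreover have "fst ((x \<otimes>\<^bsub>\<Pi>M\<^esub> y) 0) mod 2 ^ n =
      (fst (x 0) mod 2 ^ n + fst (y 0) mod 2 ^ n) mod 2 ^ n"
    using xy[of 0] k pair_fst_mod[where x = "x 0" and y = "y 0" and n = n and s = 0] by (simp del: mult_product_group pair_group_simps)
  ultimately show "q (d \<otimes>\<^bsub>\<Pi>M \<times>\<times> Z_m\<^esub> e) = q d \<otimes>\<^bsub>A\<^esub> q e"
    unfolding de q_def by (simp del: mult_product_group symm_diff_group_simps)
qed

lemma q_surj: "q ` carrier (\<Pi>M \<times>\<times> Z_m) = carrier A"
proof (intro equalityI subsetI)
  fix a assume a: "a \<in> carrier A"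
  obtain T u w where Tuw: "a = ((T, u), w)" by (metis prod.collapse)
  have T: "T \<subseteq> S" and u: "u \<in> carrier Z_m" and w: "0 \<le> w" "w < 2 ^ n"
    using a by (auto simp: Tuw carrier_Z2n)
  define x where "x = (\<lambda>i\<in>{..<k}. (if i = 0 then w else of_bool ((i, False) \<in> T), of_bool ((i, True) \<in> T) :: int))"
  have "x \<in> carrier \<Pi>M" using w by (auto simp: x_def central_factor_def)
  moreover have "exponent_parities x = T"
  proof (rule Set.set_eqI)
    fix s :: "nat \<times> bool"
    obtain i b where s: "s = (i, b)" by (cases s)
    show "s \<in> exponent_parities x \<longleftrightarrow> s \<in> T"
      unfolding s using T by (cases b) (auto simp: exponent_parities_def x_def)
  qed
  moreover have "fst (x 0) mod 2 ^ n = w" using w k by (simp add: x_def)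
  ultimately show "a \<in> q ` carrier (\<Pi>M \<times>\<times> Z_m)"
    using u by (intro image_eqI[of _ _ "(x, u)"]) (simp_all add: q_def Tuw)
qed (use q_hom in \<open>auto simp only: hom_def Pi_iff\<close>)

text \<open>Even parities leave exponent 0 for \<open>b\<close>, and 0 or 2 for \<open>a\<close> in
  the later factors; the reduction modulo \<open>2 ^ n\<close> leaves 0 or \<open>2 ^ n\<close> in
  factor 0. These are exactly the entries allowed in \<open>K\<close>.\<close>

lemma q_kernel:
  assumes x: "x \<in> carrier \<Pi>M"
  shows "q (x, u) = \<one>\<^bsub>A\<^esub> \<longleftrightarrow> x \<in> K \<and> u = 0"
proof -
  have "exponent_parities x = {} \<and> fst (x 0) mod 2 ^ n = 0 \<longleftrightarrow> x \<in> K"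
  proof
    assume q1: "exponent_parities x = {} \<and> fst (x 0) mod 2 ^ n = 0"
    have "x i \<in> {\<one>\<^bsub>central_factor n t i\<^esub>, central_factor_c n i}" if i: "i < k" for i
    proof -
      obtain a b where ab: "x i = (a, b)" by (cases "x i")
      have xi: "(a, b) \<in> carrier (central_factor n t i)" using x i by (auto simp: PiE_iff simp flip: ab)
      then have "b = 0 \<or> b = 1" by (auto simp: central_factor_def)
      moreover have "(i, True) \<notin> exponent_parities x" using q1 by simp
      then have "even b" using i by (simp add: exponent_parities_def ab)
      ultimately have b: "b = 0" by auto
      show ?thesis
      proof (cases "i = 0")
        case True
        then have "0 \<le> a" "a < 2 ^ (n + 1)" "a mod 2 ^ n = 0" using xi q1 ab by (auto simp: central_factor_def)
        then show ?thesis using mod_power_eq_0_iff[of a n] True ab b by auto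
      next
        case False
        then have a: "a \<in> {0, 1, 2, 3}" using xi by (auto simp: central_factor_def)
        have "(i, False) \<notin> exponent_parities x" using q1 by simp
        then have "even a" using i False by (simp add: exponent_parities_def ab)
        then show ?thesis using a False by (auto simp: ab b central_factor_c_def)
      qed
    qed
    then show "x \<in> K" using x by (auto simp: PiE_iff simp del: central_factor_simps)
  next
    assume xK: "x \<in> K"
    have x01: "x i = (0, 0) \<or> x i = central_factor_c n i" if "i < k" for i
      using xK that by (auto simp: PiE_iff simp del: central_factor_simps)
    have no: "(i, e) \<notin> exponent_parities x" for i e
      using x01[of i] k by (cases "i < k"; cases e; cases "i = 0") (auto simp: exponent_parities_def central_factor_c_def)
    have "exponent_parities x = {}"
    proof (rule equals0I)
      fix s assume "s \<in> exponent_parities x"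
      then show False using no[of "fst s" "snd s"] by simp
    qed
    moreover have "fst (x 0) mod 2 ^ n = 0" using x01[of 0] k by auto
    ultimately show "exponent_parities x = {} \<and> fst (x 0) mod 2 ^ n = 0" by blast
  qed
  then show ?thesis by (auto simp: q_def)
qed

text \<open>In the first component the kernel \<open>K\<close> of \<open>q\<close> contains the
  kernel \<open>Z\<close> of \<open>r\<close>, so \<open>q\<close> induces a map from G to A. Its
  kernel is the image of \<open>K\<close>, that is, the identity and \<open>c\<close>.\<close>

lemma unitary_count_G:
  assumes "CHAR('f::{field,finite}) = 2"
  shows "unitary_count G TYPE('f) ((if n \<ge> 2 then 2 else 1) * (if m \<ge> 2 then 2 else 1))"
proof -
  interpret B: finite_comm_group "symm_diff_group S" by (rule finite_comm_group_parts)
  interpret Bm: finite_comm_group "symm_diff_group S \<times>\<times> Z_m" by (rule finite_comm_group_parts)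
  interpret A: finite_comm_group A by (rule finite_comm_group_parts)
  have "unitary_count (symm_diff_group S) TYPE('f) 1"
    by (rule B.unitary_count_elementary[OF assms]) auto
  then have "unitary_count (symm_diff_group S \<times>\<times> Z_m) TYPE('f) (if m \<ge> 2 then 2 else 1)"
    using B.unitary_count_cyclic[OF assms m] by fastforce
  then have count: "unitary_count A TYPE('f) ((if n \<ge> 2 then 2 else 1) * (if m \<ge> 2 then 2 else 1))"
    by (rule Bm.unitary_count_cyclic[OF assms n])
  have ker: "q d = \<one>\<^bsub>A\<^esub>" if "d \<in> carrier (\<Pi>M \<times>\<times> Z_m)" "r d = \<one>" for d
  proof -
    obtain x u where d: "d = (x, u)" by (cases d)
    have xu: "x \<in> carrier \<Pi>M" "u \<in> carrier Z_m" using that(1) d by simp_all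
    then have "x \<in> Z" "u = 0" using r_kernel[OF xu] that(2) d by simp_all
    then show ?thesis unfolding d q_kernel[OF xu(1)] using Z_iff by blast
  qed
  obtain p where p: "p \<in> hom G A" "\<And>d. d \<in> carrier (\<Pi>M \<times>\<times> Z_m) \<Longrightarrow> p (r d) = q d"
    using hom_factor[OF r_hom r_surj q_hom D.is_group G.is_group A.is_group ker] by blast
  have "p ` carrier G = p ` r ` carrier (\<Pi>M \<times>\<times> Z_m)" by (simp only: r_surj)
  also have "\<dots> = q ` carrier (\<Pi>M \<times>\<times> Z_m)" using p(2) by (simp only: image_image cong: image_cong)
  finally have p_surj: "p ` carrier G = carrier A" by (simp only: q_surj)
  have finG: "finite (carrier G)" using fin_D by (simp only: r_surj[symmetric] finite_imageI)
  have p_ker: "p g = \<one>\<^bsub>A\<^esub> \<longleftrightarrow> g = \<one> \<or> g = c" if g: "g \<in> carrier G" for g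
  proof -
    obtain x u where xu: "x \<in> carrier \<Pi>M" "u \<in> carrier Z_m" "g = r (x, u)" using g by (rule r_lift)
    obtain y where y: "y \<in> K" "parity y" "r (y, \<one>\<^bsub>Z_m\<^esub>) = c" by (rule c_in_r_K)
    have pc: "p c = \<one>\<^bsub>A\<^esub>"
      unfolding y(3)[symmetric] using p(2)[of "(y, \<one>\<^bsub>Z_m\<^esub>)"] q_kernel[OF K_carrier[OF y(1)], of 0] y(1) K_carrier[OF y(1)]
      by simp
    have p1: "p \<one> = \<one>\<^bsub>A\<^esub>" using hom_one[OF p(1) G.is_group A.is_group] .
    show ?thesis
    proof
      assume "p g = \<one>\<^bsub>A\<^esub>"
      then have "q (x, u) = \<one>\<^bsub>A\<^esub>" using p(2)[of "(x, u)"] xu by simp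
      then have "x \<in> K" "u = \<one>\<^bsub>Z_m\<^esub>" using q_kernel[OF xu(1)] by simp_all
      then show "g = \<one> \<or> g = c" using r_K[of x] xu(3) by (simp split: if_splits)
    qed (use pc p1 in blast)
  qed
  interpret DC: double_cover G A p c "TYPE('f)"
    by (intro double_cover.intro finite_group.intro finite_group_axioms.intro double_cover_axioms.intro)
      (use p(1) p_surj p_ker finG c_not_one assms G.is_group A.comm_group_axioms in simp_all)
  show ?thesis
    by (rule DC.unitary_count_noncommuting[OF count Omega_c_noncommuting])
qed

end

section \<open>From unitary elements to unitary units\<close>

lemma (in finite_group) unitary_units_eq_unitary:
  assumes "CHAR('f::{field,finite}) = 2"
  shows "unitary_units G = (unitary G :: ('a \<Rightarrow> 'f) set)"
proof -
  let ?R = "group_algebra G :: ('a \<Rightarrow> 'f) ring"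
  have coeffs: "carrier ?R = coeffs G"
    using fin by (auto simp: group_algebra_def coeffs_def intro: rev_finite_subset)
  have supp: "{g. x g \<noteq> 0} \<subseteq> carrier G" if "x \<in> coeffs G" for x :: "'a \<Rightarrow> 'f"
    using that by (auto simp: coeffs_def)
  have mult: "x \<otimes>\<^bsub>?R\<^esub> y = conv G x y" for x y
    unfolding group_algebra_def conv_def
    using fin by (auto simp: fun_eq_iff intro!: sum.mono_neutral_left)
  have one: "\<one>\<^bsub>?R\<^esub> = point \<one> 1"
    by (simp add: group_algebra_def point_def)
  interpret R: monoid ?R
    by (rule monoidI) (auto simp: coeffs mult one conv_assoc conv_one_left conv_one_right)
  have sum: "(\<Sum>g\<in>{g. x g \<noteq> 0}. x g) = (\<Sum>g\<in>carrier G. x g)" if "x \<in> coeffs G" for x :: "'a \<Rightarrow> 'f"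
    using fin supp[OF that] by (intro sum.mono_neutral_left) auto
  show ?thesis
  proof (intro equalityI subsetI)
    fix x :: "'a \<Rightarrow> 'f" assume "x \<in> unitary_units G"
    then have x: "x \<in> coeffs G" "x \<in> Units ?R" "star G x = inv\<^bsub>?R\<^esub> x"
      by (auto simp: unitary_units_def normalized_elements_def coeffs)
    then show "x \<in> unitary G"
      using R.Units_r_inv[OF x(2)] by (simp add: unitary_def mult one)
  next
    fix x :: "'a \<Rightarrow> 'f" assume x: "x \<in> unitary G"
    then have xC: "x \<in> coeffs G" and xs: "conv G x (star G x) = point \<one> 1" by (simp_all add: unitary_def)
    \<comment> \<open>Right multiplication by \<open>x\<close> is undone by right multiplication by
      \<open>star G x\<close>, hence bijective on a finite set. This produces a left inverse of
      \<open>x\<close>, which must be \<open>star G x\<close>.\<close>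
    have "inj_on (\<lambda>u. conv G u x) (coeffs G)"
      by (rule inj_on_inverseI[where g = "\<lambda>u. conv G u (star G x)"])
        (simp add: conv_assoc xs conv_one_right)
    then have "(\<lambda>u. conv G u x) ` coeffs G = coeffs G"
      by (intro endo_inj_surj finite_coeffs(1)[OF fin]) auto
    then obtain u where u: "u \<in> coeffs G" "conv G u x = point \<one> 1"
      by (metis (mono_tags, lifting) imageE one_closed point_in_coeffs)
    have "star G x = conv G (conv G u x) (star G x)" by (simp add: u conv_one_left)
    also have "\<dots> = conv G u (point \<one> 1)" by (simp only: conv_assoc xs)
    also have "\<dots> = u" by (simp add: u conv_one_right)
    finally have sx: "conv G (star G x) x = point \<one> 1" by (simp add: u)
    have "x \<in> Units ?R"
      unfolding Units_def using xC xs sx by (auto simp: coeffs mult one intro!: bexI[of _ "star G x"])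
    moreover have "inv\<^bsub>?R\<^esub> x = star G x"
      by (rule R.inv_unique'[symmetric]) (use xC xs sx in \<open>simp_all add: coeffs mult one\<close>)
    ultimately show "x \<in> unitary_units G"
      using sum_unitary[OF assms x] sum[OF xC] xC
      by (simp add: unitary_units_def normalized_elements_def coeffs)
  qed
qed

text \<open>The exponent is at least one because the identity lies in both sets, so one factor
  \<open>CARD('f)\<close> can be cancelled.\<close>

lemma (in finite_group) card_unitary_units:
  assumes char: "CHAR('f::{field,finite}) = 2" and count: "unitary_count G TYPE('f) e"
  shows "card (unitary_units G :: ('a \<Rightarrow> 'f) set) =
    e * CARD('f) ^ ((order G + card (Omega_1 G)) div 2 - 1)"
proof -
  have "\<one> \<in> Omega_1 G" by (simp add: Omega_1_iff)
  moreover have "Omega_1 G \<subseteq> carrier G" by (auto simp: Omega_1_iff)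
  ultimately have "card (Omega_1 G) > 0" "card (carrier G) > 0"
    using fin by (auto simp: card_gt_0_iff finite_subset)
  then have "(order G + card (Omega_1 G)) div 2 \<ge> 1" by (simp add: order_def)
  then obtain h where h: "(order G + card (Omega_1 G)) div 2 = Suc h" by (metis Suc_le_D One_nat_def)
  have "CARD('f) * card (unitary G :: ('a \<Rightarrow> 'f) set) = CARD('f) * (e * CARD('f) ^ h)"
    using count by (simp add: unitary_count_def h)
  then show ?thesis by (simp add: unitary_units_eq_unitary[OF char] h)
qed

theorem theorem4p14:
  fixes G :: "nat \<Rightarrow> ('a, 'e) monoid_scheme"
    and c :: "nat \<Rightarrow> 'a"
    and n m k :: nat
  assumes char_F: "CHAR('f::{field, finite}) = 2"
    and "n \<ge> m" and "m \<ge> 1" and "k \<ge> 2"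
    and "\<And>l. l \<in> {1, 2} \<Longrightarrow> group (G l)"
    and "\<And>l. l \<in> {1, 2} \<Longrightarrow>
      G l \<cong>
        central_product {..<k}
          (\<lambda>i. if i = 0 then M2 (n + 1) 1
               else if i = 1 then (if l = 1 then D8 else Q8)
               else D8)
        \<times>\<times> integer_mod_group (2 ^ m)"
    and "\<And>l. l \<in> {1, 2} \<Longrightarrow>
      c l \<in> carrier (G l) \<and>
      derived (G l) (carrier (G l)) = generate (G l) {c l} \<and>
      card (derived (G l) (carrier (G l))) = 2"
  shows "(n = 1 \<longrightarrow>
            card (Omega_1 (G 1)) = 2 ^ (2 * k + 1) + 2 ^ (k + 1) \<and>
            card (Omega_c (G 2) (c 2)) = 2 ^ (2 * k + 1) + 2 ^ (k + 1) \<and>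
            card (Omega_c (G 1) (c 1)) = 2 ^ (2 * k + 1) - 2 ^ (k + 1) \<and>
            card (Omega_1 (G 2)) = 2 ^ (2 * k + 1) - 2 ^ (k + 1)) \<and>
         (n \<ge> 2 \<longrightarrow>
            (\<forall>l\<in>{1, 2}. card (Omega_1 (G l)) = 2 ^ (2 * k + 1) \<and>
                         card (Omega_c (G l) (c l)) = 2 ^ (2 * k + 1))) \<and>
         (\<forall>l\<in>{1, 2}.
            (n = 1 \<and> m = 1 \<longrightarrow>
               card (unitary_units (G l) :: ('a \<Rightarrow> 'f) set) =
                 CARD('f) ^ ((order (G l) + card (Omega_1 (G l))) div 2 - 1)) \<and>
            (n > m \<and> m = 1 \<longrightarrow>
               card (unitary_units (G l) :: ('a \<Rightarrow> 'f) set) =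
                 2 * CARD('f) ^ ((order (G l) + card (Omega_1 (G l))) div 2 - 1)) \<and>
            (n \<ge> m \<and> m \<ge> 2 \<longrightarrow>
               card (unitary_units (G l) :: ('a \<Rightarrow> 'f) set) =
                 4 * CARD('f) ^ ((order (G l) + card (Omega_1 (G l))) div 2 - 1)))"
proof -
  have n: "n \<ge> 1" using assms(2,3) by simp
  \<comment> \<open>Selects D8 for \<open>l = 1\<close> and Q8 for \<open>l = 2\<close>; for
    \<open>n = 1\<close> it decides the sign of the difference of the two counts.\<close>
  define t :: "nat \<Rightarrow> int" where "t l = (if l = 1 then 0 else 1)" for l
  interpret C: comm_group "integer_mod_group (2 ^ m)" by simp
  have cover: "\<exists>r. factor_cover n m k (t l) (G l) r (c l)" if l: "l \<in> {1, 2}" for l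
  proof -
    let ?N = "\<lambda>i. if i = 0 then M2 (n + 1) 1 else if i = 1 then (if l = 1 then D8 else Q8) else D8"
    interpret F: central_family "{..<k}" "central_factor n (t l)" "central_factor_c n" by (rule central_family_factor[OF n])
    have N: "group (?N i)" "?N i \<cong> central_factor n (t l) i" for i
      using M2_pair_group[OF n] D8_pair_group Q8_pair_group by (auto simp: central_factor_def t_def)
    have finF: "finite (carrier (central_factor n (t l) i))" for i by (simp add: central_factor_def)
    have finC: "finite (carrier (integer_mod_group (2 ^ m)))" by (simp add: carrier_Z2n)
    obtain r where "central_product_cover {..<k} (central_factor n (t l)) (central_factor_c n) (G l) (integer_mod_group (2 ^ m)) r (c l)"
      using F.central_product_cover_exists[OF N assms(5)[OF l] C.comm_group_axioms finC finF assms(6)[OF l]]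
        assms(7)[OF l] by blast
    then have "factor_cover n m k (t l) (G l) r (c l)"
      using n assms(3,4) by (simp add: factor_cover_def factor_cover_axioms_def t_def)
    then show ?thesis by blast
  qed
  have finG: "finite_group (G l)" if l: "l \<in> {1, 2}" for l
  proof -
    obtain r where "factor_cover n m k (t l) (G l) r (c l)" using cover[OF l] by blast
    then interpret factor_cover n m k "t l" "G l" r "c l" .
    show ?thesis
      using fin_D assms(5)[OF l]
      by (simp only: finite_group_def finite_group_axioms_def r_surj[symmetric] finite_imageI)
  qed
  have Om: "int (card (Omega_1 (G l))) + int (card (Omega_c (G l) (c l))) = 4 * 4 ^ k"
      "int (card (Omega_1 (G l))) - int (card (Omega_c (G l) (c l))) =
        (if n = 1 then if t l = 0 then 4 * 2 ^ k else - (4 * 2 ^ k) else 0)"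
      "unitary_count (G l) TYPE('f) ((if n \<ge> 2 then 2 else 1) * (if m \<ge> 2 then 2 else 1))"
    if l: "l \<in> {1, 2}" for l
  proof -
    obtain r where "factor_cover n m k (t l) (G l) r (c l)" using cover[OF l] by blast
    then interpret factor_cover n m k "t l" "G l" r "c l" .
    show "int (card (Omega_1 (G l))) + int (card (Omega_c (G l) (c l))) = 4 * 4 ^ k"
      "int (card (Omega_1 (G l))) - int (card (Omega_c (G l) (c l))) =
        (if n = 1 then if t l = 0 then 4 * 2 ^ k else - (4 * 2 ^ k) else 0)"
      "unitary_count (G l) TYPE('f) ((if n \<ge> 2 then 2 else 1) * (if m \<ge> 2 then 2 else 1))"
      using card_Omega unitary_count_G[OF char_F] by blast+
  qed
  have pow: "2 ^ (2 * k + 1) = (2 * 4 ^ k :: nat)" "2 ^ (k + 1) = (2 * 2 ^ k :: nat)"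
    by (simp_all add: power_mult)
  have le: "(2 :: nat) ^ k \<le> 4 ^ k" by (rule power_mono) auto
  have plus: "card (Omega_1 (G l)) = 2 * 4 ^ k + 2 * 2 ^ k \<and> card (Omega_c (G l) (c l)) = 2 * 4 ^ k - 2 * 2 ^ k"
    if "l = 1" "n = 1" for l
  proof -
    \<comment> \<open>Half the sum and half the difference of the counts. The second equation has
      the subtracted power on the left and so shows that the subtraction of naturals does not
      truncate.\<close>
    have "int (card (Omega_1 (G l))) = int (2 * 4 ^ k + 2 * 2 ^ k)"
        "int (card (Omega_c (G l) (c l))) + int (2 * 2 ^ k) = int (2 * 4 ^ k)"
      using Om(1,2)[of l] that by (simp_all add: t_def)
    then show ?thesis by linarith
  qed
  have minus: "card (Omega_c (G l) (c l)) = 2 * 4 ^ k + 2 * 2 ^ k \<and> card (Omega_1 (G l)) = 2 * 4 ^ k - 2 * 2 ^ k"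
    if "l = 2" "n = 1" for l
  proof -
    have "int (card (Omega_c (G l) (c l))) = int (2 * 4 ^ k + 2 * 2 ^ k)"
        "int (card (Omega_1 (G l))) + int (2 * 2 ^ k) = int (2 * 4 ^ k)"
      using Om(1,2)[of l] that by (simp_all add: t_def)
    then show ?thesis by linarith
  qed
  have eq: "card (Omega_1 (G l)) = 2 * 4 ^ k \<and> card (Omega_c (G l) (c l)) = 2 * 4 ^ k"
    if "l \<in> {1, 2}" "n \<ge> 2" for l
  proof -
    have "int (card (Omega_1 (G l))) = int (2 * 4 ^ k)" "int (card (Omega_c (G l) (c l))) = int (2 * 4 ^ k)"
      using Om(1,2)[OF that(1)] that(2) by simp_all
    then show ?thesis by linarith
  qed
  have units: "card (unitary_units (G l) :: ('a \<Rightarrow> 'f) set) =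
      ((if n \<ge> 2 then 2 else 1) * (if m \<ge> 2 then 2 else 1)) *
        CARD('f) ^ ((order (G l) + card (Omega_1 (G l))) div 2 - 1)" if l: "l \<in> {1, 2}" for l
    using finite_group.card_unitary_units[OF finG[OF l] char_F Om(3)[OF l]] .
  show ?thesis
    unfolding pow
  proof (intro conjI impI ballI)
    fix l :: nat assume l: "l \<in> {1, 2}"
    show "card (unitary_units (G l) :: ('a \<Rightarrow> 'f) set) =
        CARD('f) ^ ((order (G l) + card (Omega_1 (G l))) div 2 - 1)" if "n = 1 \<and> m = 1"
      using units[OF l] that by simp
    show "card (unitary_units (G l) :: ('a \<Rightarrow> 'f) set) =
        2 * CARD('f) ^ ((order (G l) + card (Omega_1 (G l))) div 2 - 1)" if "n > m \<and> m = 1"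
      using units[OF l] that by simp
    show "card (unitary_units (G l) :: ('a \<Rightarrow> 'f) set) =
        4 * CARD('f) ^ ((order (G l) + card (Omega_1 (G l))) div 2 - 1)" if "n \<ge> m \<and> m \<ge> 2"
      using units[OF l] that by simp
  qed (use plus[of 1] minus[of 2] eq in simp_all)
qed

end
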